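(* Let $S\ge 1$ be an integer. Let $V^{st}$ ($s,t\in\{1,\dots,S\}$) be potentials satisfying Assumption A for some $\mathsf K$, $V_{\mathrm{reg}}^{st}$ and $W_k^s$, and let $V_\delta^{st}$ ($\delta>0$, $s,t\in\{1,\dots,S\}$) be potentials satisfying Assumption B for some $V_{\mathrm{reg}}^{\delta,st}$ and $W_{\delta,k}^s$ (Assumptions A and B, and the energies below, are spelled out in the context). Let $\delta_n>0$ with $\delta_n\to 0$ as $n\to\infty$, and assume that $\gamma_n\to 0$ as $n\to\infty$, where $$\gamma_n=\frac1{n^2}\sum_{s=1}^S\sum_{i=1}^{n_s}\big|V_{\delta_n}^{ss}(0)\big|=\frac1{n^2}\sum_{s=1}^S n_s\,\big|V_{\delta_n}^{ss}(0)\big| ,$$ for every choice of integers $n_s=n_s(n)\ge 0$ with $\sum_{s=1}^S n_s=n$. Then $E_n$ $\Gamma$-converges to $E$ with respect to the modified narrow topology, i.e.: (a) for every $\boldsymbol\mu\in D(E)$ and every sequence $\boldsymbol\mu_n\in D(E_n)$ with $\boldsymbol\mu_n\stackrel{c}{\rightharpoonup}\boldsymbol\mu$, $$\liminf_{n\to\infty}E_n(\boldsymbol\mu_n)\ \ge\ E(\boldsymbol\mu);$$ (b) for every $\boldsymbol\mu\in D(E)$ there exists a sequence $\boldsymbol\mu_n\in D(E_n)$ with $\boldsymbol\mu_n\stackrel{c}{\rightharpoonup}\boldsymbol\mu$ and $$\limsup_{n\to\infty}E_n(\boldsymbol\mu_n)\ \le\ E(\boldsymbol\mu).$$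
   Context: Notation. $B(x,r)\subset\mathbb R^2$ is the ball of radius $r$ centred at $x$; for a function $W$ on $\mathbb R^2$, $\overline W(x):=W(-x)$; $*$ is convolution on $\mathbb R^2$ (of functions, or of a function and a measure). $\mathcal M_+(\mathbb R^2)$ is the set of non-negative finite Borel measures on $\mathbb R^2$. A probability measure $\boldsymbol\mu\in\mathcal P(\mathbb R^2\times\{1,\dots,S\})$ is identified with the tuple $\boldsymbol\mu=(\mu^1,\dots,\mu^S)$, $\mu^s\in\mathcal M_+(\mathbb R^2)$, $\sum_s\mu^s(\mathbb R^2)=1$. Convergence in $C_{\mathrm{loc}}(\mathbb R^2)$ is uniform convergence on compact sets. Assumption A (on $V^{st}$). There are $\mathsf K\in\mathbb N$ and functions $V_{\mathrm{reg}}^{st}$, $W_k^s$ ($s,t\in\{1,\dots,S\}$, $k\in\{1,\dots,\mathsf K\}$; $\mathsf K$ independent of $s,t$ and $W_k^s$ depending only on $s,k$) such that $$V^{st}(x)=\sum_{k=1}^{\mathsf K}\big(\overline W_k^s*W_k^t\big)(x)+V_{\mathrm{reg}}^{st}(x)\quad\text{for a.e. }x\in\mathbb R^2,$$ and for all $s,t,k$: (i) $V_{\mathrm{reg}}^{st}\in C(\mathbb R^2)$; (ii) $W_k^s\in L^1(\mathbb R^2)$; (iii) $V^{st}\in C(\mathbb R^2\setminus\{0\})$ is even. Assumption B (on $V_\delta^{st}$, given $V^{st},V_{\mathrm{reg}}^{st},W_k^s,\mathsf K$ as in Assumption A). For every $\delta>0$, $$V_\delta^{st}(x)=\sum_{k=1}^{\mathsf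 K}\big(\overline W_{\delta,k}^s*W_{\delta,k}^t\big)(x)+V_{\mathrm{reg}}^{\delta,st}(x)\quad\text{for a.e. }x\in\mathbb R^2,$$ where, for all $s,t,k$: (i) for all $\delta>0$, $V_\delta^{st}\in C(\mathbb R^2)$ is even, $W_{\delta,k}^s\in L^1(\mathbb R^2)$ and $V_{\mathrm{reg}}^{\delta,st}\in C(\mathbb R^2)$; (ii) for all $0<\varepsilon<1$, $V_\delta^{st}\to V^{st}$ uniformly on $B(0,1/\varepsilon)\setminus B(0,\varepsilon)$ as $\delta\to0$; (iii) as $\delta\to 0$, $W_{\delta,k}^s*\varphi\to W_k^s*\varphi$ in $C_{\mathrm{loc}}(\mathbb R^2)$ for every $\varphi\in C_c^\infty(\mathbb R^2)$, and $V_{\mathrm{reg}}^{\delta,st}\to V_{\mathrm{reg}}^{st}$ in $C_{\mathrm{loc}}(\mathbb R^2)$; (iv) there is a radially symmetric $U^{st}\in L^1_{\mathrm{loc}}(\mathbb R^2)\cap C(\mathbb R^2\setminus\{0\})$, non-increasing in the radial direction, with $U^{st}(x)\ge\sup_{0<\delta<1}|V_\delta^{st}(x)|$ for all $x\in B(0,1)\setminus\{0\}$. Modified narrow topology. $\boldsymbol\mu_n\stackrel{c}{\rightharpoonup}\boldsymbol\mu$ means: for every $s$, $\mu_n^s\rightharpoonup\mu^s$ narrowly, i.e. $\int\varphi\,d\mu_n^s\to\int\varphi\,d\mu^s$ for all bounded continuous $\varphi$ on $\mathbb R^2$; and $\bigcup_{n\ge1}\bigcup_{s=1}^S\operatorname{supp}\mu_n^s$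 is bounded. Energies. $D(E_n)$ is the set of all $\boldsymbol\mu=(\mu^1,\dots,\mu^S)$ of the form $\mu^s=\frac1n\sum_{i=1}^{n_s}\delta_{x_i^s}$ (Dirac masses), with integers $n_s\ge0$, $\sum_{s}n_s=n$, and points $x_i^s\in\mathbb R^2$. For $\boldsymbol\mu_n\in D(E_n)$, $$E_n(\boldsymbol\mu_n)=\sum_{s,t=1}^S\int_{\mathbb R^2}\big(V_{\mathrm{reg}}^{\delta_n,st}*\mu_n^t\big)\,d\mu_n^s+\sum_{k=1}^{\mathsf K}\Big\|\sum_{s=1}^S W_{\delta_n,k}^s*\mu_n^s\Big\|_{L^2(\mathbb R^2)}^2,$$ which equals $\sum_{s,t=1}^S\int\int V_{\delta_n}^{st}(x-y)\,d\mu_n^t(y)\,d\mu_n^s(x)$. Further, $D(E)=\{\boldsymbol\mu\in\mathcal P(\mathbb R^2\times\{1,\dots,S\}):\operatorname{supp}\boldsymbol\mu\text{ bounded}\}$ and, for $\boldsymbol\mu\in D(E)$, $$E(\boldsymbol\mu)=\sum_{s,t=1}^S\int_{\mathbb R^2}\big(V_{\mathrm{reg}}^{st}*\mu^t\big)\,d\mu^s+\sum_{k=1}^{\mathsf K}\Big\|\sum_{s=1}^S W_k^s*\mu^s\Big\|_{L^2(\mathbb R^2)}^2\in(-\infty,\infty],$$ where the $L^2$-norm is $+\infty$ if the (distributional) argument is not in $L^2(\mathbb R^2)$. *)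

theory Defs
  imports "HOL-Probability.Probability"
begin

text \<open>
  Species are indexed by \<open>s, t \<in> {1..S}\<close> and the kernels of the decomposition by
  \<open>k \<in> {1..K}\<close>; values at other indices are never used. A kernel \<open>W k s\<close> stands for
  the paper's \<open>W_k^s\<close>, and \<open>V s t\<close> for \<open>V^{st}\<close>.

  Elements of \<open>L^1\<close> are given by Borel measurable representatives (\<open>integrable lborel\<close>).
  This matters for convolutions with singular measures: for a Borel \<open>f\<close> that is integrable
  with respect to Lebesgue measure and a finite Borel measure \<open>\<mu>\<close>, the integral defining
  \<open>(f * \<mu>)(x)\<close> converges absolutely for almost every \<open>x\<close>, and its class modulo null sets
  depends only on the class of \<open>f\<close>. On the remaining null set of \<open>x\<close> the Bochner integral
  returns \<open>0\<close>.
\<close>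

type_synonym plane = "real ^ 2"

definition reflect :: "(plane \<Rightarrow> real) \<Rightarrow> plane \<Rightarrow> real" where
  "reflect f x = f (- x)"

definition conv :: "(plane \<Rightarrow> real) \<Rightarrow> (plane \<Rightarrow> real) \<Rightarrow> plane \<Rightarrow> real" where
  "conv f g x = (LINT y|lborel. f (x - y) * g y)"

definition conv_measure :: "(plane \<Rightarrow> real) \<Rightarrow> plane measure \<Rightarrow> plane \<Rightarrow> real" where
  "conv_measure f \<mu> x = (LINT y|\<mu>. f (x - y))"

definition even_fun :: "(plane \<Rightarrow> real) \<Rightarrow> bool" where
  "even_fun f \<longleftrightarrow> (\<forall>x. f (- x) = f x)"

primrec Ck_fun :: "nat \<Rightarrow> (plane \<Rightarrow> real) \<Rightarrow> bool" where
  "Ck_fun 0 f \<longleftrightarrow> continuous_on UNIV f"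
| "Ck_fun (Suc k) f \<longleftrightarrow>
     (\<forall>x. f differentiable (at x)) \<and>
     (\<forall>v. Ck_fun k (\<lambda>x. frechet_derivative f (at x) v))"

definition test_function :: "(plane \<Rightarrow> real) \<Rightarrow> bool" where
  "test_function \<phi> \<longleftrightarrow> (\<forall>k. Ck_fun k \<phi>) \<and> compact (closure {x. \<phi> x \<noteq> 0})"

text \<open>Convergence as \<open>\<delta> \<rightarrow> 0\<close> through positive values, uniformly on compact sets.\<close>

definition tendsto_Cloc :: "(real \<Rightarrow> plane \<Rightarrow> real) \<Rightarrow> (plane \<Rightarrow> real) \<Rightarrow> bool" where
  "tendsto_Cloc f g \<longleftrightarrow> (\<forall>C. compact C \<longrightarrow> uniform_limit C f g (at_right 0))"

definition assumption_A ::
  "nat \<Rightarrow> nat \<Rightarrow> (nat \<Rightarrow> nat \<Rightarrow> plane \<Rightarrow> real) \<Rightarrow> (nat \<Rightarrow> nat \<Rightarrow> plane \<Rightarrow> real) \<Rightarrow>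
   (nat \<Rightarrow> nat \<Rightarrow> plane \<Rightarrow> real) \<Rightarrow> bool" where
  "assumption_A S K V Vreg W \<longleftrightarrow>
     (\<forall>s\<in>{1..S}. \<forall>t\<in>{1..S}.
        (AE x in lborel. V s t x = (\<Sum>k=1..K. conv (reflect (W k s)) (W k t) x) + Vreg s t x) \<and>
        continuous_on UNIV (Vreg s t) \<and>
        continuous_on (UNIV - {0}) (V s t) \<and> even_fun (V s t)) \<and>
     (\<forall>s\<in>{1..S}. \<forall>k\<in>{1..K}. integrable lborel (W k s))"

text \<open>
  The majorant \<open>U\<close> in (iv): locally integrable, continuous away from the origin, radially
  symmetric and radially non-increasing. Its value at the origin is irrelevant (in the paper it
  may be undefined or infinite there), so monotonicity is only required away from \<open>0\<close>.
\<close>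

definition radial_majorant :: "(plane \<Rightarrow> real) \<Rightarrow> bool" where
  "radial_majorant U \<longleftrightarrow>
     (\<forall>C. compact C \<longrightarrow> set_integrable lborel C U) \<and>
     continuous_on (UNIV - {0}) U \<and>
     (\<forall>x y. norm x = norm y \<longrightarrow> U x = U y) \<and>
     (\<forall>x y. x \<noteq> 0 \<and> norm x \<le> norm y \<longrightarrow> U y \<le> U x)"

definition assumption_B ::
  "nat \<Rightarrow> nat \<Rightarrow> (nat \<Rightarrow> nat \<Rightarrow> plane \<Rightarrow> real) \<Rightarrow> (nat \<Rightarrow> nat \<Rightarrow> plane \<Rightarrow> real) \<Rightarrow>
   (nat \<Rightarrow> nat \<Rightarrow> plane \<Rightarrow> real) \<Rightarrow>
   (real \<Rightarrow> nat \<Rightarrow> nat \<Rightarrow> plane \<Rightarrow> real) \<Rightarrow> (real \<Rightarrow> nat \<Rightarrow> nat \<Rightarrow> plane \<Rightarrow> real) \<Rightarrow>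
   (real \<Rightarrow> nat \<Rightarrow> nat \<Rightarrow> plane \<Rightarrow> real) \<Rightarrow> bool" where
  "assumption_B S K V Vreg W V\<delta> Vreg\<delta> W\<delta> \<longleftrightarrow>
     (\<forall>\<delta>>0. \<forall>s\<in>{1..S}. \<forall>t\<in>{1..S}.
        (AE x in lborel.
           V\<delta> \<delta> s t x = (\<Sum>k=1..K. conv (reflect (W\<delta> \<delta> k s)) (W\<delta> \<delta> k t) x) + Vreg\<delta> \<delta> s t x) \<and>
        continuous_on UNIV (V\<delta> \<delta> s t) \<and> even_fun (V\<delta> \<delta> s t) \<and>
        continuous_on UNIV (Vreg\<delta> \<delta> s t)) \<and>
     (\<forall>\<delta>>0. \<forall>s\<in>{1..S}. \<forall>k\<in>{1..K}. integrable lborel (W\<delta> \<delta> k s)) \<and>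
     (\<forall>s\<in>{1..S}. \<forall>t\<in>{1..S}. \<forall>\<epsilon>. 0 < \<epsilon> \<and> \<epsilon> < 1 \<longrightarrow>
        uniform_limit (ball 0 (1 / \<epsilon>) - ball 0 \<epsilon>) (\<lambda>\<delta>. V\<delta> \<delta> s t) (V s t) (at_right 0)) \<and>
     (\<forall>s\<in>{1..S}. \<forall>k\<in>{1..K}. \<forall>\<phi>. test_function \<phi> \<longrightarrow>
        tendsto_Cloc (\<lambda>\<delta>. conv (W\<delta> \<delta> k s) \<phi>) (conv (W k s) \<phi>)) \<and>
     (\<forall>s\<in>{1..S}. \<forall>t\<in>{1..S}. tendsto_Cloc (\<lambda>\<delta>. Vreg\<delta> \<delta> s t) (Vreg s t)) \<and>
     (\<forall>s\<in>{1..S}. \<forall>t\<in>{1..S}. \<exists>U. radial_majorant U \<and>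
        (\<forall>x \<in> ball 0 1 - {0}. \<forall>\<delta>. 0 < \<delta> \<and> \<delta> < 1 \<longrightarrow> \<bar>V\<delta> \<delta> s t x\<bar> \<le> U x))"

definition finite_borel_measures :: "plane measure set" where
  "finite_borel_measures = {\<mu>. finite_measure \<mu> \<and> sets \<mu> = sets borel}"

definition msupp :: "plane measure \<Rightarrow> plane set" where
  "msupp \<mu> = {x. \<forall>G. open G \<and> x \<in> G \<longrightarrow> emeasure \<mu> G > 0}"

text \<open>
  A probability measure on \<open>plane \<times> {1..S}\<close> is identified with its tuple of components
  \<open>\<mu> 1, \<dots>, \<mu> S\<close>, finite Borel measures of total mass one.
\<close>

definition prob_tuples :: "nat \<Rightarrow> (nat \<Rightarrow> plane measure) set" where
  "prob_tuples S = {\<mu>. (\<forall>s\<in>{1..S}. \<mu> s \<in> finite_borel_measures) \<and>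
                        (\<Sum>s=1..S. measure (\<mu> s) UNIV) = 1}"

definition D_E :: "nat \<Rightarrow> (nat \<Rightarrow> plane measure) set" where
  "D_E S = {\<mu> \<in> prob_tuples S. bounded (\<Union>s\<in>{1..S}. msupp (\<mu> s))}"

definition D_En :: "nat \<Rightarrow> nat \<Rightarrow> (nat \<Rightarrow> plane measure) set" where
  "D_En S n = {\<mu>. \<exists>(N :: nat \<Rightarrow> nat) (x :: nat \<Rightarrow> nat \<Rightarrow> plane).
     (\<Sum>s=1..S. N s) = n \<and>
     (\<forall>s\<in>{1..S}. sets (\<mu> s) = sets borel \<and>
        (\<forall>A\<in>sets borel. emeasure (\<mu> s) A =
            ennreal (1 / real n) * (\<Sum>i=1..N s. emeasure (return borel (x s i)) A)))}"

definition narrow_conv :: "(nat \<Rightarrow> plane measure) \<Rightarrow> plane measure \<Rightarrow> bool" where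
  "narrow_conv \<nu> \<mu> \<longleftrightarrow>
     (\<forall>\<phi> :: plane \<Rightarrow> real. continuous_on UNIV \<phi> \<and> bounded (range \<phi>) \<longrightarrow>
        (\<lambda>n. LINT x|\<nu> n. \<phi> x) \<longlonglongrightarrow> (LINT x|\<mu>. \<phi> x))"

definition mod_narrow_conv ::
  "nat \<Rightarrow> (nat \<Rightarrow> nat \<Rightarrow> plane measure) \<Rightarrow> (nat \<Rightarrow> plane measure) \<Rightarrow> bool" where
  "mod_narrow_conv S \<mu>n \<mu> \<longleftrightarrow>
     (\<forall>s\<in>{1..S}. narrow_conv (\<lambda>n. \<mu>n n s) (\<mu> s)) \<and>
     bounded (\<Union>n\<in>{1..}. \<Union>s\<in>{1..S}. msupp (\<mu>n n s))"

definition L2_norm :: "(plane \<Rightarrow> real) \<Rightarrow> ereal" where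
  "L2_norm f = (if f \<in> borel_measurable lborel \<and> integrable lborel (\<lambda>x. (f x)\<^sup>2)
                then ereal (sqrt (LINT x|lborel. (f x)\<^sup>2)) else \<infinity>)"

text \<open>
  Since the kernels are in \<open>L^1\<close> and the measures are finite, the argument of the norm is always
  an \<open>L^1\<close> function, so being in \<open>L^2\<close> as a distribution means being square integrable.
  The same formula, with the regularised kernels, gives both energies of the paper.
\<close>

definition energy ::
  "nat \<Rightarrow> nat \<Rightarrow> (nat \<Rightarrow> nat \<Rightarrow> plane \<Rightarrow> real) \<Rightarrow> (nat \<Rightarrow> nat \<Rightarrow> plane \<Rightarrow> real) \<Rightarrow>
   (nat \<Rightarrow> plane measure) \<Rightarrow> ereal" where
  "energy S K Vreg W \<mu> =
     ereal (\<Sum>s=1..S. \<Sum>t=1..S. LINT x|\<mu> s. conv_measure (Vreg s t) (\<mu> t) x) +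
     (\<Sum>k=1..K. (L2_norm (\<lambda>x. \<Sum>s=1..S. conv_measure (W k s) (\<mu> s) x))\<^sup>2)"

end

theory Submission
  imports Defs
begin

text \<open>
  The energy is a continuous part, given by \<open>Vreg\<close>, plus squared \<open>L\<^sup>2\<close> norms of the functions
  \<open>\<Sum>\<^sub>s W\<^sub>k\<^sup>s * \<mu>\<^sup>s\<close>. Both inequalities of the \<open>\<Gamma>\<close>-limit come from looking at these norms in two ways:
  as suprema, for the lower bound, and as double integrals of the potential, for the upper bound.

  Lower bound. For an integrable function \<open>f\<close> the squared norm is the supremum of
  \<open>2 \<integral> f \<phi> - \<integral> \<phi>\<^sup>2\<close> over test functions \<open>\<phi>\<close> (\<open>L2_norm_sq_ge_test\<close>, \<open>L2_norm_sq_le_if_test_le\<close>).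
  By Fubini, \<open>\<integral> (W * \<mu>) \<phi>\<close> is the integral of \<open>W * reflect \<phi>\<close> (up to a reflection) against \<open>\<mu>\<close>. The
  convergence of the convolved kernels and the narrow convergence of the measures therefore make each
  of these functionals converge, and a supremum of convergent quantities is lower semicontinuous
  (\<open>energy_liminf\<close>).

  Energies as double integrals. For measures with a bounded density the energy equals
  \<open>\<Sum>\<^sub>s\<^sub>t \<integral>\<integral> V\<^sup>s\<^sup>t(x - y) d\<mu>\<^sup>t d\<mu>\<^sup>s\<close>, because the decomposition of \<open>V\<close>, valid almost everywhere, may
  be inserted (\<open>energy_eq_interaction\<close>). Averaging a measure over balls of radius \<open>r\<close> gives it a bounded
  density. This has two consequences. By Jensen's inequality averaging does not increase the \<open>L\<^sup>2\<close>
  norms, so the double integral of \<open>V\<close> over the averaged measure is asymptotically at most the energy of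
  the original measure (\<open>interaction_smooth_bound\<close>). And if \<open>V\<close> is continuous, letting \<open>r\<close> tend to \<open>0\<close>
  bounds the energy of any compactly supported measure, atomic or not, by its double integral
  (\<open>energy_le_interaction\<close>); for particles this is an explicit double sum, including a diagonal.

  Upper bound. Fix an average \<open>\<nu>\<close> of \<open>\<mu>\<close>. The radial majorant and the bounded density give
  convergence of the double integrals of \<open>V\<^sub>\<delta>\<close> over \<open>\<nu>\<close> to that of \<open>V\<close>
  (\<open>regularised_interaction_tendsto\<close>). Particles are placed one after the other by the method of
  conditional expectations, which yields a configuration whose off-diagonal double sum is at most its
  mean (\<open>greedy_sampling\<close>); the diagonal vanishes in the limit by the hypothesis on \<open>\<gamma>\<^sub>n\<close>.
  To obtain narrow convergence from the same choice, a multiple \<open>\<surd>n\<close> of a squared distance between the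
  empirical measure and \<open>\<nu>\<close> is added to the energy (\<open>sampling\<close>). This distance comes from a kernel with
  mean zero against \<open>\<nu>\<close>, so the penalty costs nothing on average, while the lower bound
  on the energy forces the distance to \<open>0\<close>. A diagonal choice of the averaging radius finishes the proof
  (\<open>recovery_sequence\<close>).
\<close>

section \<open>Smooth functions with compact support\<close>

lemma Ck_fun_SucI:
  assumes "\<And>x. (f has_derivative f' x) (at x)" "\<And>v. Ck_fun k (\<lambda>x. f' x v)"
  shows "Ck_fun (Suc k) f"
proof -
  have "frechet_derivative f (at x) = f' x" for x
    using assms(1) frechet_derivative_at by metis
  then show ?thesis using assms by (auto simp: differentiable_def)
qed

lemma Ck_fun_SucD:
  assumes "Ck_fun (Suc k) f"
  shows "(f has_derivative frechet_derivative f (at x)) (at x)"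
    and "Ck_fun k (\<lambda>x. frechet_derivative f (at x) v)"
  using assms by (auto simp: frechet_derivative_works)

lemma Ck_fun_Suc_imp: "Ck_fun (Suc k) f \<Longrightarrow> Ck_fun k f"
proof (induction k arbitrary: f)
  case 0
  then show ?case
    by (auto simp: continuous_on_eq_continuous_at differentiable_imp_continuous_within)
next
  case (Suc k)
  show ?case
  proof (rule Ck_fun_SucI)
    show "(f has_derivative frechet_derivative f (at x)) (at x)" for x
      by (rule Ck_fun_SucD(1)[OF Suc.prems])
    show "Ck_fun k (\<lambda>x. frechet_derivative f (at x) v)" for v
      by (rule Suc.IH[OF Ck_fun_SucD(2)[OF Suc.prems]])
  qed
qed

lemma Ck_fun_const: "Ck_fun k (\<lambda>x. c)"
proof (induction k arbitrary: c)
  case (Suc k)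
  show ?case
    by (rule Ck_fun_SucI[where f' = "\<lambda>x v. 0"]) (auto simp: Suc.IH)
qed auto

lemma Ck_fun_add: "Ck_fun k f \<Longrightarrow> Ck_fun k g \<Longrightarrow> Ck_fun k (\<lambda>x. f x + g x)"
proof (induction k arbitrary: f g)
  case (Suc k)
  show ?case
    by (rule Ck_fun_SucI[OF has_derivative_add[OF Ck_fun_SucD(1)[OF Suc.prems(1)] Ck_fun_SucD(1)[OF Suc.prems(2)]]])
       (intro Suc.IH Ck_fun_SucD(2) Suc.prems)
qed (auto intro: continuous_intros)

lemma Ck_fun_mult: "Ck_fun k f \<Longrightarrow> Ck_fun k g \<Longrightarrow> Ck_fun k (\<lambda>x. f x * g x)"
proof (induction k arbitrary: f g)
  case (Suc k)
  show ?case
    by (rule Ck_fun_SucI[OF has_derivative_mult[OF Ck_fun_SucD(1)[OF Suc.prems(1)] Ck_fun_SucD(1)[OF Suc.prems(2)]]])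
       (intro Ck_fun_add Suc.IH Ck_fun_SucD(2) Suc.prems Ck_fun_Suc_imp)
qed (auto intro: continuous_intros)

lemma Ck_fun_prod: "finite I \<Longrightarrow> (\<And>i. i \<in> I \<Longrightarrow> Ck_fun k (f i)) \<Longrightarrow> Ck_fun k (\<lambda>x. \<Prod>i\<in>I. f i x)"
  by (induction I rule: finite_induct) (auto intro: Ck_fun_const Ck_fun_mult)

lemma Ck_fun_reflect: "Ck_fun k f \<Longrightarrow> Ck_fun k (\<lambda>x. f (- x))"
proof (induction k arbitrary: f)
  case 0
  then have "continuous_on UNIV f" by simp
  then have "continuous_on UNIV (\<lambda>x. f (- x))"
    by (rule continuous_on_compose2) (auto intro: continuous_on_minus continuous_on_id)
  then show ?case by simp
next
  case (Suc k)
  show ?case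
  proof (rule Ck_fun_SucI)
    show "((\<lambda>x. f (- x)) has_derivative (\<lambda>v. frechet_derivative f (at (- x)) (- v))) (at x)" for x
      using has_derivative_compose[OF has_derivative_minus[OF has_derivative_ident] Ck_fun_SucD(1)[OF Suc.prems]]
      by simp
    show "Ck_fun k (\<lambda>x. frechet_derivative f (at (- x)) (- v))" for v
      by (rule Suc.IH[OF Ck_fun_SucD(2)[OF Suc.prems]])
  qed
qed

text \<open>
  The function \<open>exp (-1/t)\<close>, flat at the origin, multiplied by a polynomial in \<open>1/t\<close>. The family
  indexed by \<open>p\<close> is closed under differentiation, so one induction proves all its members smooth.
\<close>

definition flat_exp :: "real poly \<Rightarrow> real \<Rightarrow> real" where
  "flat_exp p t = (if t > 0 then poly p (1 / t) * exp (- 1 / t) else 0)"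

lemma flat_exp_tendsto_0: "((\<lambda>t. flat_exp p t) \<longlongrightarrow> 0) (at 0)"
proof -
  have *: "((\<lambda>y::real. poly p y * exp (- y)) \<longlongrightarrow> 0) at_top"
  proof -
    have "((\<lambda>y::real. \<Sum>i\<le>degree p. coeff p i * (y ^ i / exp y)) \<longlongrightarrow> (\<Sum>i\<le>degree p. coeff p i * 0)) at_top"
      by (intro tendsto_intros tendsto_power_div_exp_0)
    then show ?thesis
      by (simp add: poly_altdef sum_distrib_right exp_minus divide_inverse mult.assoc)
  qed
  have "((\<lambda>t::real. poly p (inverse t) * exp (- inverse t)) \<longlongrightarrow> 0) (at_right 0)"
    by (rule filterlim_compose[OF * filterlim_inverse_at_top_right])
  then have 1: "((\<lambda>t. flat_exp p t) \<longlongrightarrow> 0) (at_right 0)"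
    by (rule Lim_transform_eventually)
       (auto simp: flat_exp_def eventually_at_filter divide_inverse)
  have 2: "((\<lambda>t. flat_exp p t) \<longlongrightarrow> 0) (at_left 0)"
    by (rule tendsto_eventually) (auto simp: flat_exp_def eventually_at_filter)
  from 1 2 show ?thesis by (simp add: filterlim_split_at)
qed

text \<open>
  At the origin the difference quotient of the function with polynomial \<open>p\<close> is the function with
  polynomial \<open>pCons 0 p\<close>, and all members of the family tend to \<open>0\<close> there.
\<close>

lemma flat_exp_deriv:
  "(flat_exp p has_real_derivative flat_exp ([:0, 0, 1:] * (p - pderiv p)) t) (at t)"
proof -
  consider "t > 0" | "t < 0" | "t = 0" by linarith
  then show ?thesis
  proof cases
    case 1
    have "((\<lambda>t. poly p (1 / t) * exp (- 1 / t)) has_real_derivative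
            flat_exp ([:0, 0, 1:] * (p - pderiv p)) t) (at t)"
      using 1 by (auto intro!: derivative_eq_intros DERIV_chain2[OF poly_DERIV] simp: flat_exp_def)
                 (simp add: field_simps power2_eq_square)
    then show ?thesis
      by (rule has_field_derivative_transform_within_open[where S = "{0<..}"])
         (use 1 in \<open>auto simp: flat_exp_def\<close>)
  next
    case 2
    have "((\<lambda>t. 0) has_real_derivative flat_exp ([:0, 0, 1:] * (p - pderiv p)) t) (at t)"
      using 2 by (auto simp: flat_exp_def)
    then show ?thesis
      by (rule has_field_derivative_transform_within_open[where S = "{..<0}"])
         (use 2 in \<open>auto simp: flat_exp_def\<close>)
  next
    case 3
    have "((\<lambda>t. flat_exp (pCons 0 p) t) \<longlongrightarrow> 0) (at 0)"
      by (rule flat_exp_tendsto_0)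
    then have "((\<lambda>h. (flat_exp p (0 + h) - flat_exp p 0) / h) \<longlongrightarrow> 0) (at 0)"
      by (rule Lim_transform_eventually)
         (auto simp: flat_exp_def eventually_at_filter)
    then show ?thesis
      using 3 by (simp add: DERIV_def flat_exp_def)
  qed
qed

lemma Ck_fun_flat_exp: "Ck_fun k (\<lambda>x. flat_exp p (c * (x $ i) + d))"
proof (induction k arbitrary: p)
  case 0
  have "continuous_on UNIV (flat_exp p)"
    by (intro continuous_at_imp_continuous_on ballI DERIV_isCont[OF flat_exp_deriv])
  then have "continuous_on UNIV (\<lambda>x::plane. flat_exp p (c * (x $ i) + d))"
    by (rule continuous_on_compose2) (intro continuous_intros, auto)
  then show ?case by simp
next
  case (Suc k)
  let ?q = "[:0, 0, 1:] * (p - pderiv p)"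
  show ?case
  proof (rule Ck_fun_SucI)
    have 1: "((\<lambda>x::plane. c * (x $ i) + d) has_derivative (\<lambda>v. c * (v $ i))) (at x)" for x
      by (auto intro!: derivative_eq_intros bounded_linear_imp_has_derivative bounded_linear_vec_nth)
    show "((\<lambda>x. flat_exp p (c * (x $ i) + d)) has_derivative
            (\<lambda>v. flat_exp ?q (c * (x $ i) + d) * (c * (v $ i)))) (at x)" for x :: plane
      using has_derivative_compose[OF 1 flat_exp_deriv[of p, unfolded has_field_derivative_def]] .
    show "Ck_fun k (\<lambda>x. flat_exp ?q (c * (x $ i) + d) * (c * (v $ i)))" for v :: plane
      by (rule Ck_fun_mult[OF Suc.IH Ck_fun_const])
  qed
qed

text \<open>
  Positive exactly on the open box. Replacing \<open>t\<close> by \<open>m t\<close> in \<open>exp (-1/t)\<close> flattens the graph, so for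
  large \<open>m\<close> the bump approaches the indicator of the box; this takes the place of mollification.
\<close>

definition box_bump :: "plane \<Rightarrow> plane \<Rightarrow> real \<Rightarrow> plane \<Rightarrow> real" where
  "box_bump a b m x =
     (\<Prod>i\<in>UNIV. flat_exp 1 (m * (x $ i) + - m * a $ i) * flat_exp 1 (- m * (x $ i) + m * b $ i))"

lemma Ck_fun_box_bump: "Ck_fun k (box_bump a b m)"
  unfolding box_bump_def by (intro Ck_fun_prod Ck_fun_mult Ck_fun_flat_exp finite)

lemma flat_exp_1_bounds: "0 \<le> flat_exp 1 t" "flat_exp 1 t \<le> 1" 
  by (auto simp: flat_exp_def)

lemma box_bump_bounds: "0 \<le> box_bump a b m x" "box_bump a b m x \<le> 1"
  unfolding box_bump_def
  by (auto intro!: prod_nonneg prod_le_1 mult_le_one simp: flat_exp_1_bounds)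

lemma box_bump_eq_0: "m > 0 \<Longrightarrow> x \<notin> box a b \<Longrightarrow> box_bump a b m x = 0"
proof -
  assume m: "m > 0" and "x \<notin> box a b"
  then obtain i where i: "\<not> (a $ i < x $ i \<and> x $ i < b $ i)" by (auto simp: mem_box_cart)
  then have "m * (x $ i) \<le> m * a $ i \<or> m * b $ i \<le> m * (x $ i)"
    using m by auto
  then have "flat_exp 1 (m * (x $ i) + - m * a $ i) * flat_exp 1 (- m * (x $ i) + m * b $ i) = 0"
    by (auto simp: flat_exp_def)
  then show ?thesis unfolding box_bump_def by (meson finite UNIV_I prod_zero)
qed

lemma flat_exp_1_tendsto_1:
  assumes "t > 0" shows "(\<lambda>n. flat_exp 1 (real (Suc n) * t)) \<longlonglongrightarrow> 1"
proof -
  have "(\<lambda>n. exp (- (1 / t) * (1 / real (Suc n)))) \<longlonglongrightarrow> exp (- (1 / t) * 0)"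
    by (intro tendsto_intros LIMSEQ_Suc[OF lim_1_over_n])
  then show ?thesis using assms by (simp add: flat_exp_def zero_less_mult_iff mult.commute)
qed

lemma box_bump_tendsto_1:
  assumes "x \<in> box a b" shows "(\<lambda>n. box_bump a b (real (Suc n)) x) \<longlonglongrightarrow> 1"
proof -
  have *: "a $ i < x $ i" "x $ i < b $ i" for i using assms by (auto simp: mem_box_cart)
  have "(\<lambda>n. \<Prod>i\<in>UNIV. flat_exp 1 (real (Suc n) * (x $ i - a $ i)) * flat_exp 1 (real (Suc n) * (b $ i - x $ i)))
     \<longlonglongrightarrow> (\<Prod>i\<in>(UNIV::2 set). 1 * 1)"
    by (intro tendsto_prod tendsto_mult flat_exp_1_tendsto_1) (use * in auto)
  moreover have "real (Suc n) * (x $ i - a $ i) = real (Suc n) * (x $ i) + - real (Suc n) * a $ i"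
     "real (Suc n) * (b $ i - x $ i) = - real (Suc n) * (x $ i) + real (Suc n) * b $ i" for n i
    by (simp_all add: algebra_simps)
  ultimately show ?thesis unfolding box_bump_def by simp
qed

lemma test_functionI:
  assumes "\<And>k. Ck_fun k \<phi>" "bounded U" "\<And>x. x \<notin> U \<Longrightarrow> \<phi> x = 0"
  shows "test_function \<phi>"
proof -
  have "closure {x. \<phi> x \<noteq> 0} \<subseteq> closure U" by (rule closure_mono) (use assms in auto)
  then have "bounded (closure {x. \<phi> x \<noteq> 0})" using assms(2) bounded_closure bounded_subset by blast
  then show ?thesis using assms(1) by (auto simp: test_function_def compact_eq_bounded_closed)
qed

lemma test_function_support:
  assumes "test_function \<phi>" obtains R where "R > 0" "\<And>x. x \<notin> cball 0 R \<Longrightarrow> \<phi> x = 0"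
proof -
  have "bounded (closure {x. \<phi> x \<noteq> 0})"
    using assms compact_imp_bounded unfolding test_function_def by blast
  then have "\<exists>R>0. closure {x. \<phi> x \<noteq> 0} \<subseteq> ball 0 R"
    using bounded_subset_ballD by blast
  then obtain R where R: "R > 0" "closure {x. \<phi> x \<noteq> 0} \<subseteq> ball 0 R"
    by (elim exE conjE)
  have "\<phi> x = 0" if "x \<notin> cball 0 R" for x
  proof (rule ccontr)
    assume "\<phi> x \<noteq> 0"
    then have "x \<in> closure {x. \<phi> x \<noteq> 0}" by (intro subsetD[OF closure_subset]) simp
    then have "x \<in> ball 0 R" using R(2) by (rule subsetD[rotated])
    with that show False by simp
  qed
  then show ?thesis using R(1) by (rule that[rotated])
qed

lemma test_function_continuous: "test_function \<phi> \<Longrightarrow> continuous_on UNIV \<phi>"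
  unfolding test_function_def by (metis Ck_fun.simps(1))

lemma test_function_measurable: "test_function \<phi> \<Longrightarrow> \<phi> \<in> borel_measurable borel"
  by (intro borel_measurable_continuous_onI test_function_continuous)

lemma test_function_bounded:
  assumes "test_function \<phi>" obtains B where "B > 0" "\<And>x. \<bar>\<phi> x\<bar> \<le> B"
proof -
  obtain R where R: "R > 0" "\<And>x. x \<notin> cball 0 R \<Longrightarrow> \<phi> x = 0"
    using test_function_support[OF assms] by metis
  have "bounded (\<phi> ` cball 0 R)"
    by (intro compact_imp_bounded compact_continuous_image
        continuous_on_subset[OF test_function_continuous[OF assms]]) auto
  then have "\<exists>B. \<forall>x\<in>cball 0 R. \<bar>\<phi> x\<bar> \<le> B"
    unfolding bounded_iff by simp
  then obtain B where B: "\<And>x. x \<in> cball 0 R \<Longrightarrow> \<bar>\<phi> x\<bar> \<le> B"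
    by blast
  have "\<bar>\<phi> x\<bar> \<le> max B 1" for x
    using B[of x] R(2)[of x] by (cases "x \<in> cball 0 R") auto
  then show ?thesis using that[of "max B 1"] by auto
qed

lemma test_function_reflect: "test_function \<phi> \<Longrightarrow> test_function (reflect \<phi>)"
proof -
  assume a: "test_function \<phi>"
  obtain R where R: "R > 0" "\<And>x. x \<notin> cball 0 R \<Longrightarrow> \<phi> x = 0"
    using test_function_support[OF a] by metis
  have "Ck_fun k (\<lambda>x. \<phi> (- x))" for k
    using a by (intro Ck_fun_reflect[of k \<phi>]) (simp add: test_function_def)
  moreover have "\<phi> (- x) = 0" if "x \<notin> cball 0 R" for x
    using that by (intro R(2)) auto
  ultimately show ?thesis
    unfolding reflect_def[abs_def] by (rule test_functionI[OF _ bounded_cball])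
qed

lemma test_function_add:
  assumes "test_function f" "test_function g" shows "test_function (\<lambda>x. f x + g x)"
proof -
  obtain R where R: "\<And>x. x \<notin> cball 0 R \<Longrightarrow> f x = 0" using test_function_support[OF assms(1)] by metis
  obtain R' where R': "\<And>x. x \<notin> cball 0 R' \<Longrightarrow> g x = 0" using test_function_support[OF assms(2)] by metis
  show ?thesis
    by (rule test_functionI[where U = "cball 0 R \<union> cball 0 R'"])
       (use assms R R' in \<open>auto simp: test_function_def intro: Ck_fun_add\<close>)
qed

lemma test_function_scale:
  assumes "test_function f" shows "test_function (\<lambda>x. c * f x)"
proof -
  obtain R where R: "\<And>x. x \<notin> cball 0 R \<Longrightarrow> f x = 0" using test_function_support[OF assms(1)] by metis
  show ?thesis
    by (rule test_functionI[where U = "cball 0 R"])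
       (use assms R in \<open>auto simp: test_function_def intro: Ck_fun_mult[OF Ck_fun_const]\<close>)
qed

text \<open>
  An open set is a countable union of open boxes. With bumps \<open>p\<^sub>i\<close> of the boxes,
  \<open>1 - \<Prod>\<^sub>i\<^sub><\<^sub>n (1 - p\<^sub>i)\<close> is a smooth substitute for the indicator of the union of the first \<open>n\<close> boxes.
\<close>

lemma test_functions_tendsto_indicator_open:
  assumes "open U" "bounded U"
  obtains \<phi> where "\<And>n::nat. test_function (\<phi> n)" "\<And>n x. 0 \<le> \<phi> n x" "\<And>n x. \<phi> n x \<le> 1"
    "\<And>n x. x \<notin> U \<Longrightarrow> \<phi> n x = 0" "\<And>x. (\<lambda>n. \<phi> n x) \<longlonglongrightarrow> indicator U x"
proof (cases "U = {}")
  case True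
  have "test_function (\<lambda>x. 0)" by (rule test_functionI[where U = "{}"]) (auto intro: Ck_fun_const)
  with True show ?thesis by (intro that[of "\<lambda>n x. 0"]) auto
next
  case False
  obtain D where D: "countable D" "D \<subseteq> Pow U" "\<And>X. X \<in> D \<Longrightarrow> \<exists>a b. X = box a b" "\<Union>D = U"
    using open_countable_Union_open_box[OF assms(1)] by metis
  with False have "D \<noteq> {}" by auto
  then have r: "range (from_nat_into D) = D" using D(1) by simp
  have "\<forall>i. \<exists>a b. from_nat_into D i = box a b" using D(3) r by (metis rangeI)
  then obtain a b where ab: "\<And>i. from_nat_into D i = box (a i) (b i)" by metis
  define p where "p n i = box_bump (a i) (b i) (real (Suc n))" for n i :: nat
  define \<phi> where "\<phi> n x = 1 + (- 1) * (\<Prod>i\<in>{..<n}. 1 + (-1) * p n i x)" for n x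
  have p: "0 \<le> p n i x" "p n i x \<le> 1" for n i x by (auto simp: p_def box_bump_bounds)
  have U: "x \<notin> box (a i) (b i)" if "x \<notin> U" for x i
    using that ab[of i] r D(2) by (metis PowD rangeI subsetD)
  have z: "\<phi> n x = 0" if "x \<notin> U" for n x
    using box_bump_eq_0[OF _ U[OF that]] by (simp add: \<phi>_def p_def del: of_nat_Suc)
  have b: "0 \<le> \<phi> n x" "\<phi> n x \<le> 1" for n x
    using p by (auto simp: \<phi>_def intro!: prod_le_1 prod_nonneg)
  have t: "test_function (\<phi> n)" for n
  proof (rule test_functionI[where U = U])
    show "Ck_fun k (\<phi> n)" for k
      unfolding \<phi>_def p_def
      by (intro Ck_fun_add Ck_fun_mult Ck_fun_const Ck_fun_prod Ck_fun_box_bump) auto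
  qed (use assms z in auto)
  have "(\<lambda>n. \<phi> n x) \<longlonglongrightarrow> indicator U x" for x
  proof (cases "x \<in> U")
    case True
    then obtain i where i: "x \<in> box (a i) (b i)" using D(4) r ab by (metis UnionE rangeE)
    have lim: "(\<lambda>n. p n i x) \<longlonglongrightarrow> 1" unfolding p_def by (rule box_bump_tendsto_1[OF i])
    have ev: "\<forall>\<^sub>F n in sequentially. p n i x \<le> \<phi> n x"
      using eventually_gt_at_top[of i]
    proof eventually_elim
      case (elim n)
      have "(\<Prod>i\<in>{..<n}. 1 + (-1) * p n i x) = (1 - p n i x) * (\<Prod>i\<in>{..<n}-{i}. 1 + (-1) * p n i x)"
        using elim by (subst prod.remove[where x = i]) auto
      also have "\<dots> \<le> (1 - p n i x) * 1"
        by (intro mult_left_mono prod_le_1) (auto simp: p)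
      finally have "(\<Prod>i\<in>{..<n}. 1 + (-1) * p n i x) \<le> 1 - p n i x" by simp
      then show ?case unfolding \<phi>_def by linarith
    qed
    have "(\<lambda>n. \<phi> n x) \<longlonglongrightarrow> 1"
      by (rule tendsto_sandwich[OF ev _ lim tendsto_const]) (simp add: b)
    then show ?thesis using True by simp
  qed (simp add: z)
  then show ?thesis using that[of \<phi>] t b z by blast
qed

section \<open>Approximation by test functions\<close>

lemma integrable_bounded_on_finite_measure:
  fixes f :: "'a \<Rightarrow> real"
  assumes "finite_measure M" "f \<in> borel_measurable M" "AE x in M. \<bar>f x\<bar> \<le> B"
  shows "integrable M f"
  by (rule finite_measure.integrable_const_bound[OF assms(1), where B=B]) (use assms in auto)

text \<open>
  Bounded Borel functions in the \<open>L\<^sup>2(N)\<close>-closure of the test functions that vanish outside \<open>G\<close>.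
  The measure \<open>N\<close> is left open because the application needs control with respect to two measures at
  once; boundedness keeps all squares integrable for a finite \<open>N\<close>.
\<close>

definition test_approximable :: "plane measure \<Rightarrow> plane set \<Rightarrow> (plane \<Rightarrow> real) \<Rightarrow> bool" where
  "test_approximable N G g \<longleftrightarrow> g \<in> borel_measurable borel \<and> (\<exists>b. \<forall>x. \<bar>g x\<bar> \<le> b) \<and>
     (\<forall>e>0. \<exists>\<phi>. test_function \<phi> \<and> (\<forall>x. x \<notin> G \<longrightarrow> \<phi> x = 0) \<and> (LINT x|N. (g x - \<phi> x)\<^sup>2) < e)"

lemma integrable_sq_diff:
  assumes N: "finite_measure N" "sets N = sets borel"
    and g: "g \<in> borel_measurable borel" "\<And>x. \<bar>g x\<bar> \<le> b" and \<phi>: "test_function \<phi>"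
  shows "integrable N (\<lambda>x. (g x - \<phi> x)\<^sup>2)"
proof -
  obtain B where B: "\<And>x. \<bar>\<phi> x\<bar> \<le> B" using test_function_bounded[OF \<phi>] by blast
  have [measurable]: "\<phi> \<in> borel_measurable borel" using test_function_measurable[OF \<phi>] .
  have "\<bar>(g x - \<phi> x)\<^sup>2\<bar> \<le> (b + B)\<^sup>2" for x
  proof -
    have "\<bar>g x - \<phi> x\<bar> \<le> b + B" using g(2)[of x] B[of x] by linarith
    then have "\<bar>g x - \<phi> x\<bar>\<^sup>2 \<le> (b + B)\<^sup>2" by (intro power_mono) auto
    then show ?thesis by simp
  qed
  then show ?thesis
    using g(1) by (intro integrable_bounded_on_finite_measure[OF N(1), where B="(b + B)\<^sup>2"])
      (auto simp: measurable_cong_sets[OF N(2) refl])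
qed

lemma test_approximableD:
  assumes "test_approximable N G g" "e > 0"
  obtains \<phi> where "test_function \<phi>" "\<And>x. x \<notin> G \<Longrightarrow> \<phi> x = 0" "(LINT x|N. (g x - \<phi> x)\<^sup>2) < e"
  using assms unfolding test_approximable_def by blast

lemma test_approximable_uniform:
  assumes N: "finite_measure N" "sets N = sets borel"
    and g: "g \<in> borel_measurable borel" "\<And>x. \<bar>g x\<bar> \<le> b"
    and *: "\<And>e. e > 0 \<Longrightarrow> \<exists>h. test_approximable N G h \<and> (\<forall>x. \<bar>g x - h x\<bar> \<le> e)"
  shows "test_approximable N G g"
  unfolding test_approximable_def
proof (intro conjI allI impI)
  interpret N: finite_measure N by fact
  fix e :: real assume e: "e > 0"
  define \<eta> where "\<eta> = sqrt (e / (4 * (measure N (space N) + 1)))"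
  have m: "measure N (space N) + 1 > 0" using measure_nonneg[of N "space N"] by linarith
  have \<eta>: "\<eta> > 0" "\<eta>\<^sup>2 = e / (4 * (measure N (space N) + 1))"
    using e m by (auto simp: \<eta>_def)
  obtain h where h: "test_approximable N G h" "\<And>x. \<bar>g x - h x\<bar> \<le> \<eta>"
    using *[OF \<eta>(1)] by auto
  obtain b' where h': "h \<in> borel_measurable borel" "\<And>x. \<bar>h x\<bar> \<le> b'"
    using h(1) unfolding test_approximable_def by blast
  obtain \<phi> where \<phi>: "test_function \<phi>" "\<And>x. x \<notin> G \<Longrightarrow> \<phi> x = 0" "(LINT x|N. (h x - \<phi> x)\<^sup>2) < e / 4"
    using test_approximableD[OF h(1), of "e/4"] e by auto
  have "(g x - \<phi> x)\<^sup>2 \<le> 2 * (h x - \<phi> x)\<^sup>2 + 2 * \<eta>\<^sup>2" for x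
  proof -
    have "(g x - \<phi> x)\<^sup>2 \<le> 2 * (h x - \<phi> x)\<^sup>2 + 2 * (g x - h x)\<^sup>2"
      using zero_le_power2[of "(g x - h x) - (h x - \<phi> x)"] by (simp add: power2_eq_square algebra_simps)
    moreover have "(g x - h x)\<^sup>2 \<le> \<eta>\<^sup>2" using power_mono[OF h(2)[of x], of 2] by simp
    ultimately show ?thesis by linarith
  qed
  then have "(LINT x|N. (g x - \<phi> x)\<^sup>2) \<le> (LINT x|N. 2 * (h x - \<phi> x)\<^sup>2 + 2 * \<eta>\<^sup>2)"
    using integrable_sq_diff[OF N g \<phi>(1)] integrable_sq_diff[OF N h' \<phi>(1)]
    by (intro integral_mono) auto
  also have "\<dots> = 2 * (LINT x|N. (h x - \<phi> x)\<^sup>2) + 2 * \<eta>\<^sup>2 * measure N (space N)"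
    using integrable_sq_diff[OF N h' \<phi>(1)] by simp
  also have "2 * \<eta>\<^sup>2 * measure N (space N) \<le> e / 2"
    unfolding \<eta>(2) using e m by (simp add: field_simps)
  finally have "(LINT x|N. (g x - \<phi> x)\<^sup>2) < e" using \<phi>(3) by linarith
  then show "\<exists>\<phi>. test_function \<phi> \<and> (\<forall>x. x \<notin> G \<longrightarrow> \<phi> x = 0) \<and> (LINT x|N. (g x - \<phi> x)\<^sup>2) < e"
    using \<phi> by blast
qed (use g in auto)

lemma test_approximable_lincomb:
  assumes N: "finite_measure N" "sets N = sets borel"
    and g: "test_approximable N G g" and h: "test_approximable N G h"
  shows "test_approximable N G (\<lambda>x. c * g x + h x)"
  unfolding test_approximable_def
proof (intro conjI allI impI)
  obtain b where g': "g \<in> borel_measurable borel" "\<And>x. \<bar>g x\<bar> \<le> b"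
    using g unfolding test_approximable_def by blast
  obtain b' where h': "h \<in> borel_measurable borel" "\<And>x. \<bar>h x\<bar> \<le> b'"
    using h unfolding test_approximable_def by blast
  show gh: "(\<lambda>x. c * g x + h x) \<in> borel_measurable borel" using g'(1) h'(1) by measurable
  have b: "\<bar>c * g x + h x\<bar> \<le> \<bar>c\<bar> * b + b'" for x
  proof -
    have "\<bar>c * g x\<bar> \<le> \<bar>c\<bar> * b" using g'(2)[of x] by (simp add: abs_mult mult_left_mono)
    then show ?thesis using h'(2)[of x] by linarith
  qed
  then show "\<exists>b. \<forall>x. \<bar>c * g x + h x\<bar> \<le> b" by blast
  fix e :: real assume e: "e > 0"
  have c: "c\<^sup>2 + 1 > 0" using zero_le_power2[of c] by linarith
  obtain \<phi> where \<phi>: "test_function \<phi>" "\<And>x. x \<notin> G \<Longrightarrow> \<phi> x = 0" "(LINT x|N. (g x - \<phi> x)\<^sup>2) < e / (4 * (c\<^sup>2 + 1))"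
    using test_approximableD[OF g, of "e / (4 * (c\<^sup>2 + 1))"] e c by auto
  obtain \<psi> where \<psi>: "test_function \<psi>" "\<And>x. x \<notin> G \<Longrightarrow> \<psi> x = 0" "(LINT x|N. (h x - \<psi> x)\<^sup>2) < e / 4"
    using test_approximableD[OF h, of "e/4"] e by auto
  note i = integrable_sq_diff[OF N g' \<phi>(1)] integrable_sq_diff[OF N h' \<psi>(1)]
  note t = test_function_add[OF test_function_scale[OF \<phi>(1), of c] \<psi>(1)]
  have "(c * g x + h x - (c * \<phi> x + \<psi> x))\<^sup>2 \<le> 2 * c\<^sup>2 * (g x - \<phi> x)\<^sup>2 + 2 * (h x - \<psi> x)\<^sup>2" for x
    using zero_le_power2[of "c * (g x - \<phi> x) - (h x - \<psi> x)"] by (simp add: power2_eq_square algebra_simps)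
  then have "(LINT x|N. (c * g x + h x - (c * \<phi> x + \<psi> x))\<^sup>2)
      \<le> (LINT x|N. 2 * c\<^sup>2 * (g x - \<phi> x)\<^sup>2 + 2 * (h x - \<psi> x)\<^sup>2)"
    using i integrable_sq_diff[OF N gh b t] by (intro integral_mono) auto
  also have "\<dots> = 2 * c\<^sup>2 * (LINT x|N. (g x - \<phi> x)\<^sup>2) + 2 * (LINT x|N. (h x - \<psi> x)\<^sup>2)"
    using i by simp
  also have "\<dots> < e"
  proof -
    have "c\<^sup>2 * (LINT x|N. (g x - \<phi> x)\<^sup>2) \<le> (c\<^sup>2 + 1) * (LINT x|N. (g x - \<phi> x)\<^sup>2)"
      by (intro mult_right_mono integral_nonneg_AE) auto
    also have "\<dots> < e / 4" using \<phi>(3) c by (simp add: field_simps)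
    finally show ?thesis using \<psi>(3) by linarith
  qed
  finally show "\<exists>\<phi>. test_function \<phi> \<and> (\<forall>x. x \<notin> G \<longrightarrow> \<phi> x = 0) \<and> (LINT x|N. (c * g x + h x - \<phi> x)\<^sup>2) < e"
    using t \<phi>(2) \<psi>(2) by (intro exI[of _ "\<lambda>x. c * \<phi> x + \<psi> x"]) auto
qed

text \<open>
  Outer regularity of \<open>N\<close> replaces the Borel set by an open set of nearly the same measure, and
  indicators of open sets are limits of test functions.
\<close>

lemma test_approximable_indicator:
  assumes N: "finite_measure N" "sets N = sets borel"
    and A: "A \<in> sets borel" "A \<subseteq> G" and G: "open G" "bounded G"
  shows "test_approximable N G (indicator A)"
  unfolding test_approximable_def
proof (intro conjI allI impI)
  interpret N: finite_measure N by fact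
  show "indicator A \<in> borel_measurable borel" using A(1) by measurable
  show "\<exists>b. \<forall>x. \<bar>indicator A x :: real\<bar> \<le> b" by (intro exI[of _ 1]) (auto simp: indicator_def)
  fix e :: real assume e: "e > 0"
  have "emeasure N A < emeasure N A + ennreal (e / 4)"
    using e by (simp add: N.emeasure_eq_measure ennreal_plus[symmetric] ennreal_less_iff del: ennreal_plus)
  then have "(INF U \<in> {U. A \<subseteq> U \<and> open U}. emeasure N U) < emeasure N A + ennreal (e / 4)"
    using outer_regular[OF N(2) _ A(1)] N.emeasure_finite[of "space N"] by simp
  then obtain U where U: "A \<subseteq> U" "open U" "emeasure N U < emeasure N A + ennreal (e / 4)"
    unfolding INF_less_iff by auto
  define U' where "U' = U \<inter> G"
  have U': "A \<subseteq> U'" "open U'" "bounded U'" "U' \<subseteq> G"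
    using U A G by (auto simp: U'_def intro: bounded_Int)
  have "measure N U < measure N A + e / 4"
    using U(3) e by (simp add: N.emeasure_eq_measure ennreal_plus[symmetric] ennreal_less_iff del: ennreal_plus)
  moreover have "measure N U' \<le> measure N U"
    using U by (intro N.finite_measure_mono) (auto simp: U'_def N(2))
  moreover have "measure N (U' - A) = measure N U' - measure N A"
    using U' A(1) by (intro N.finite_measure_Diff) (auto simp: N(2))
  ultimately have d: "measure N (U' - A) < e / 4" by linarith
  obtain \<phi> where \<phi>: "\<And>n::nat. test_function (\<phi> n)" "\<And>n x. 0 \<le> \<phi> n x" "\<And>n x. \<phi> n x \<le> 1"
    "\<And>n x. x \<notin> U' \<Longrightarrow> \<phi> n x = 0" "\<And>x. (\<lambda>n. \<phi> n x) \<longlonglongrightarrow> indicator U' x"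
    using test_functions_tendsto_indicator_open[OF U'(2,3)] by blast
  have [measurable]: "\<phi> n \<in> borel_measurable N" for n
    using test_function_measurable[OF \<phi>(1)] by (simp add: measurable_cong_sets[OF N(2) refl])
  have [measurable]: "U' \<in> sets N" "A \<in> sets N" using U' A by (auto simp: N(2))
  have s: "\<bar>indicator U' x - \<phi> n x\<bar> \<le> 1" for n x
    using \<phi>(2,3)[of n x] by (auto simp: indicator_def)
  have "(\<lambda>n. LINT x|N. \<bar>indicator U' x - \<phi> n x\<bar>) \<longlonglongrightarrow> (LINT x|N. 0)"
  proof (rule integral_dominated_convergence[where w="\<lambda>_. 1"])
    show "AE x in N. (\<lambda>n. \<bar>indicator U' x - \<phi> n x\<bar>) \<longlonglongrightarrow> 0"
    proof (intro AE_I2)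
      fix x
      have "(\<lambda>n. \<bar>indicator U' x - \<phi> n x\<bar>) \<longlonglongrightarrow> \<bar>indicator U' x - indicator U' x\<bar>"
        by (intro tendsto_intros \<phi>(5))
      then show "(\<lambda>n. \<bar>indicator U' x - \<phi> n x\<bar>) \<longlonglongrightarrow> 0" by simp
    qed
  qed (use s in auto)
  then have "\<forall>\<^sub>F n in sequentially. (LINT x|N. \<bar>indicator U' x - \<phi> n x\<bar>) < e / 4"
    using e by (intro order_tendstoD(2)[of _ 0]) auto
  then obtain n where n: "(LINT x|N. \<bar>indicator U' x - \<phi> n x\<bar>) < e / 4"
    using eventually_happens by force
  have i: "integrable N (\<lambda>x. \<bar>indicator U' x - \<phi> n x\<bar>)"
    by (intro integrable_bounded_on_finite_measure[OF N(1), where B=1]) (use s in auto)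
  have "(indicator A x - \<phi> n x)\<^sup>2 \<le> indicator (U' - A) x + \<bar>indicator U' x - \<phi> n x\<bar>" for x
  proof -
    have "\<bar>indicator A x - \<phi> n x\<bar> \<le> 1" using \<phi>(2,3)[of n x] by (auto simp: indicator_def)
    then have "\<bar>indicator A x - \<phi> n x\<bar>\<^sup>2 \<le> \<bar>indicator A x - \<phi> n x\<bar>"
      using power_decreasing[of 1 2 "\<bar>indicator A x - \<phi> n x\<bar>"] by simp
    also have "\<dots> \<le> indicator (U' - A) x + \<bar>indicator U' x - \<phi> n x\<bar>"
      using U'(1) \<phi>(2,3)[of n x] by (auto simp: indicator_def)
    finally show ?thesis by simp
  qed
  then have "(LINT x|N. (indicator A x - \<phi> n x)\<^sup>2) \<le> (LINT x|N. indicator (U' - A) x + \<bar>indicator U' x - \<phi> n x\<bar>)"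
    using i by (intro integral_mono integrable_sq_diff[OF N _ _ \<phi>(1), where b=1] Bochner_Integration.integrable_add)
      (use A in \<open>auto simp: N.emeasure_eq_measure abs_le_iff\<close>)
  also have "\<dots> = measure N (U' - A) + (LINT x|N. \<bar>indicator U' x - \<phi> n x\<bar>)"
    using i by (subst Bochner_Integration.integral_add) (auto simp: N.emeasure_eq_measure)
  also have "\<dots> < e" using d n e by linarith
  finally show "\<exists>\<phi>. test_function \<phi> \<and> (\<forall>x. x \<notin> G \<longrightarrow> \<phi> x = 0) \<and> (LINT x|N. (indicator A x - \<phi> x)\<^sup>2) < e"
    using \<phi>(1,4) U'(4) by (intro exI[of _ "\<phi> n"]) blast
qed

lemma test_approximable_sum:
  assumes N: "finite_measure N" "sets N = sets borel" and "finite J"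
    "\<And>j. j \<in> J \<Longrightarrow> test_approximable N G (g j)" "test_approximable N G (\<lambda>_. 0)"
  shows "test_approximable N G (\<lambda>x. \<Sum>j\<in>J. g j x)"
  using assms(3,4)
proof (induction J rule: finite_induct)
  case (insert j J)
  then have "test_approximable N G (\<lambda>x. 1 * g j x + (\<Sum>j\<in>J. g j x))"
    by (intro test_approximable_lincomb[OF N]) auto
  then show ?case using insert by simp
qed (simp add: assms(5))

text \<open>
  Rounding \<open>g\<close> down to multiples of \<open>1/m\<close> gives a finite combination of indicators within \<open>1/m\<close> of
  \<open>g\<close>. Outside \<open>G\<close> the rounded value is \<open>0\<close>, so only level sets inside \<open>G\<close> carry a nonzero coefficient.
\<close>

lemma test_approximable_bounded:
  assumes N: "finite_measure N" "sets N = sets borel" and G: "open G" "bounded G"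
    and g: "g \<in> borel_measurable borel" "\<And>x. \<bar>g x\<bar> \<le> b" "\<And>x. x \<notin> G \<Longrightarrow> g x = 0"
  shows "test_approximable N G g"
proof (rule test_approximable_uniform[OF N g(1,2)])
  fix e :: real assume e: "e > 0"
  obtain m :: nat where m: "m > 0" "1 / real m < e" 
    using ex_inverse_of_nat_less[OF e] by (auto simp: inverse_eq_divide)
  define K where "K = \<lceil>real m * b\<rceil> + 1"
  define A where "A j = {x. \<lfloor>real m * g x\<rfloor> = j}" for j :: int
  define h where "h x = (\<Sum>j\<in>{-K..K}. (real_of_int j / m) * indicator (A j) x)" for x
  have A: "A j \<in> sets borel" for j
  proof -
    have "A j = (\<lambda>x. \<lfloor>real m * g x\<rfloor>) -` {j} \<inter> space borel" by (auto simp: A_def)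
    also have "\<dots> \<in> sets borel" by (rule measurable_sets[of _ _ "count_space UNIV"]) (use g(1) in auto)
    finally show ?thesis .
  qed
  have 0: "test_approximable N G (\<lambda>x. 0)"
  proof -
    have "(indicator {} :: plane \<Rightarrow> real) = (\<lambda>x. 0)" by (simp add: fun_eq_iff)
    then show ?thesis using test_approximable_indicator[OF N _ _ G, of "{}"] by (simp only: sets.empty_sets empty_subsetI)
  qed
  have "test_approximable N G h" unfolding h_def
  proof (rule test_approximable_sum[OF N])
    fix j assume "j \<in> {-K..K}"
    show "test_approximable N G (\<lambda>x. (real_of_int j / m) * indicator (A j) x)"
    proof (cases "j = 0")
      case False
      then have "A j \<subseteq> G" using g(3) by (force simp: A_def)
      then show ?thesis
        using test_approximable_lincomb[OF N test_approximable_indicator[OF N A _ G] 0, of j "real_of_int j / m"] by simp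
    qed (simp add: 0)
  qed (auto simp: 0)
  moreover have "\<bar>g x - h x\<bar> \<le> e" for x
  proof -
    let ?j = "\<lfloor>real m * g x\<rfloor>"
    have "\<bar>real m * g x\<bar> \<le> real m * b" using g(2)[of x] by (simp add: abs_mult mult_left_mono)
    then have "?j \<in> {-K..K}" unfolding K_def by (simp add: abs_le_iff) linarith
    have "h x = (\<Sum>j\<in>{-K..K}. if ?j = j then real_of_int j / m else 0)"
      unfolding h_def by (intro sum.cong) (auto simp: A_def)
    also have "\<dots> = real_of_int ?j / m" using \<open>?j \<in> _\<close> by simp
    finally have "h x = real_of_int ?j / m" .
    moreover have "\<bar>g x - real_of_int ?j / m\<bar> \<le> 1 / m"
    proof -
      have "\<bar>m * g x - real_of_int ?j\<bar> \<le> 1" by linarith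
      then have "\<bar>m * g x - real_of_int ?j\<bar> / m \<le> 1 / m" by (intro divide_right_mono) auto
      moreover have "\<bar>m * g x - real_of_int ?j\<bar> / m = \<bar>(m * g x - real_of_int ?j) / m\<bar>" by simp
      moreover have "(m * g x - real_of_int ?j) / m = g x - real_of_int ?j / m"
        using m(1) by (simp add: field_simps)
      ultimately show ?thesis by simp
    qed
    ultimately show ?thesis using m(2) by simp
  qed
  ultimately show "\<exists>h. test_approximable N G h \<and> (\<forall>x. \<bar>g x - h x\<bar> \<le> e)" by blast
qed


section \<open>The squared norm as a supremum over test functions\<close>

lemma L2_norm_sq:
  "(L2_norm f)\<^sup>2 = (if f \<in> borel_measurable borel \<and> integrable lborel (\<lambda>x. (f x)\<^sup>2)
                 then ereal (LINT x|lborel. (f x)\<^sup>2) else \<infinity>)"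
  by (auto simp: L2_norm_def power2_eq_square)

lemma integrable_mult_bounded:
  fixes f g :: "'a \<Rightarrow> real"
  assumes "integrable M f" "g \<in> borel_measurable M" "\<And>x. \<bar>g x\<bar> \<le> B"
  shows "integrable M (\<lambda>x. f x * g x)"
proof (rule Bochner_Integration.integrable_bound)
  show "integrable M (\<lambda>x. B * \<bar>f x\<bar>)" using assms(1) by simp
  show "(\<lambda>x. f x * g x) \<in> borel_measurable M" using assms by measurable
  have B: "0 \<le> B" using assms(3) abs_ge_zero order_trans by blast
  have "\<bar>f x\<bar> * \<bar>g x\<bar> \<le> \<bar>f x\<bar> * B" for x
    by (rule mult_left_mono[OF assms(3)]) simp
  then show "AE x in M. norm (f x * g x) \<le> norm (B * \<bar>f x\<bar>)"
    using B by (simp add: abs_mult mult.commute)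
qed

lemma integrable_lborel_bounded_support:
  fixes g :: "plane \<Rightarrow> real"
  assumes "g \<in> borel_measurable borel" "\<And>x. \<bar>g x\<bar> \<le> B" "\<And>x. x \<notin> G \<Longrightarrow> g x = 0" "bounded G" "G \<in> sets borel"
  shows "integrable lborel g"
proof -
  have "integrable lborel (indicator G :: plane \<Rightarrow> real)"
    using emeasure_bounded_finite[OF assms(4)] assms(5) by simp
  then have "integrable lborel (\<lambda>x. indicator G x * g x)"
    by (rule integrable_mult_bounded) (use assms in auto)
  moreover have "(\<lambda>x. indicator G x * g x) = g" using assms(3) by (intro ext) (metis assms(3) indicator_simps mult_1 mult_zero_left)
  ultimately show ?thesis by simp
qed

lemma test_function_lborel:
  assumes "test_function \<phi>"
  shows "integrable lborel \<phi>" "integrable lborel (\<lambda>x. (\<phi> x)\<^sup>2)"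
proof -
  obtain B where B: "B > 0" "\<And>x. \<bar>\<phi> x\<bar> \<le> B" using test_function_bounded[OF assms] by blast
  obtain R where R: "\<And>x. x \<notin> cball 0 R \<Longrightarrow> \<phi> x = 0" using test_function_support[OF assms] by metis
  have m[measurable]: "\<phi> \<in> borel_measurable borel" using test_function_measurable[OF assms] .
  show 1: "integrable lborel \<phi>"
    by (rule integrable_lborel_bounded_support[OF m B(2), of "cball 0 R"]) (use R in auto)
  show "integrable lborel (\<lambda>x. (\<phi> x)\<^sup>2)"
    unfolding power2_eq_square by (rule integrable_mult_bounded[OF 1 _ B(2)]) simp
qed

lemma L2_norm_sq_ge_test:
  assumes f: "integrable lborel f" and \<phi>: "test_function \<phi>"
  shows "ereal (2 * (LINT x|lborel. f x * \<phi> x) - (LINT x|lborel. (\<phi> x)\<^sup>2)) \<le> (L2_norm f)\<^sup>2"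
proof (cases "integrable lborel (\<lambda>x. (f x)\<^sup>2)")
  case True
  obtain B where B: "\<And>x. \<bar>\<phi> x\<bar> \<le> B" using test_function_bounded[OF \<phi>] by blast
  have i: "integrable lborel (\<lambda>x. f x * \<phi> x)"
    by (rule integrable_mult_bounded[OF f _ B]) (use test_function_measurable[OF \<phi>] in simp)
  have "2 * (LINT x|lborel. f x * \<phi> x) - (LINT x|lborel. (\<phi> x)\<^sup>2)
      = (LINT x|lborel. 2 * (f x * \<phi> x) - (\<phi> x)\<^sup>2)"
    using i test_function_lborel[OF \<phi>] by simp
  also have "\<dots> \<le> (LINT x|lborel. (f x)\<^sup>2)"
  proof (rule integral_mono)
    fix x show "2 * (f x * \<phi> x) - (\<phi> x)\<^sup>2 \<le> (f x)\<^sup>2"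
      using zero_le_power2[of "f x - \<phi> x"] by (simp add: power2_eq_square algebra_simps)
  qed (use i test_function_lborel[OF \<phi>] True in auto)
  finally show ?thesis using True f by (auto simp: L2_norm_sq)
qed (simp add: L2_norm_sq)

text \<open>
  Together with the preceding lemma this identifies the squared norm with the supremum over test
  functions. A truncation \<open>g\<close> of \<open>f\<close> turns \<open>2 \<integral> f g - \<integral> g\<^sup>2\<close> into \<open>\<integral> g\<^sup>2\<close>. Approximating
  \<open>g\<close> in \<open>L\<^sup>2\<close> of the measure with density \<open>\<bar>f\<bar> + 1\<close> on a ball controls the linear and the quadratic
  term simultaneously, and Fatou's lemma removes the truncation.
\<close>

lemma L2_norm_sq_le_if_test_le:
  assumes f: "integrable lborel f"
    and *: "\<And>\<phi>. test_function \<phi> \<Longrightarrow>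
          ereal (2 * (LINT x|lborel. f x * \<phi> x) - (LINT x|lborel. (\<phi> x)\<^sup>2)) \<le> c"
  shows "(L2_norm f)\<^sup>2 \<le> c"
proof -
  have f'[measurable]: "f \<in> borel_measurable borel" using f by auto
  define g where "g n x = (if \<bar>f x\<bar> \<le> real n \<and> norm x < real n then f x else 0)" for n x
  have g[measurable]: "g n \<in> borel_measurable borel" for n unfolding g_def by measurable
  have gb: "\<bar>g n x\<bar> \<le> real n" for n x by (auto simp: g_def)
  have g0: "g n x = 0" if "x \<notin> ball 0 (real n)" for n x using that by (auto simp: g_def)
  have gi: "integrable lborel (g n)" for n
    by (rule integrable_lborel_bounded_support[OF g gb, where G = "ball 0 (real n)"]) (use g0 in auto)
  have gi2: "integrable lborel (\<lambda>x. (g n x)\<^sup>2)" for n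
    unfolding power2_eq_square by (rule integrable_mult_bounded[OF gi _ gb]) simp
  have main: "ereal (LINT x|lborel. (g n x)\<^sup>2) \<le> c" for n
  proof (rule ereal_le_epsilon2)
    fix e :: real assume e: "e > 0"
    \<comment> \<open>one measure dominating both the density \<open>\<bar>f\<bar>\<close> and Lebesgue measure on the ball\<close>
    define N where "N = density lborel (\<lambda>x. ennreal (\<bar>f x\<bar> + indicator (ball 0 (real n)) x))"
    have setsN: "sets N = sets borel" by (simp add: N_def)
    have iw: "integrable lborel (\<lambda>x. \<bar>f x\<bar> + indicator (ball 0 (real n)) x)"
      using f emeasure_bounded_finite[OF bounded_ball]
      by (intro Bochner_Integration.integrable_add integrable_abs integrable_real_indicator) auto
    have wm[measurable]: "(\<lambda>x. \<bar>f x\<bar> + indicator (ball 0 (real n)) x) \<in> borel_measurable borel"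
      using borel_measurable_integrable[OF iw] by simp
    have fin: "finite_measure N"
    proof
      have "emeasure N (space N) = (\<integral>\<^sup>+x. ennreal (\<bar>f x\<bar> + indicator (ball 0 (real n)) x) \<partial>lborel)"
      proof -
        have "(\<lambda>x. ennreal (\<bar>f x\<bar> + indicator (ball 0 (real n)) x)) \<in> borel_measurable lborel"
          using iw by (intro measurable_compose[OF _ measurable_ennreal]) auto
        from emeasure_density[OF this, of UNIV] show ?thesis by (simp add: N_def del: ennreal_plus)
      qed
      also have "\<dots> < \<infinity>" using iw by (subst nn_integral_eq_integral) auto
      finally show "emeasure N (space N) \<noteq> \<infinity>" by simp
    qed
    interpret N: finite_measure N by fact
    have int_N: "(LINT x|N. h x) = (LINT x|lborel. (\<bar>f x\<bar> + indicator (ball 0 (real n)) x) * h x)"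
      if "h \<in> borel_measurable borel" for h :: "plane \<Rightarrow> real"
      unfolding N_def using that by (subst integral_density) (auto intro: wm)
    have intble_N: "integrable N h \<longleftrightarrow> integrable lborel (\<lambda>x. (\<bar>f x\<bar> + indicator (ball 0 (real n)) x) * h x)"
      if "h \<in> borel_measurable borel" for h :: "plane \<Rightarrow> real"
      unfolding N_def using that by (subst integrable_density) (auto intro: wm)
    define M where "M = measure N (space N)"
    have M: "M \<ge> 0" by (simp add: M_def)
    \<comment> \<open>\<open>\<eta>\<close> makes the constant part of the error at most \<open>e/2\<close>, then \<open>\<epsilon>\<close> the quadratic part\<close>
    define \<eta> where "\<eta> = e / (2 * (2 + 2 * real n) * (M + 1))"
    have \<eta>: "\<eta> > 0" using e M by (simp add: \<eta>_def)
    define \<epsilon> where "\<epsilon> = e / (2 * (1 + (2 + 2 * real n) / \<eta>))"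
    have \<epsilon>: "\<epsilon> > 0" using e \<eta> by (simp add: \<epsilon>_def add_pos_nonneg)
    have "test_approximable N (ball 0 (real n)) (g n)"
      by (rule test_approximable_bounded[OF fin setsN _ _ g gb g0]) auto
    then obtain \<phi> where \<phi>: "test_function \<phi>" "\<And>x. x \<notin> ball 0 (real n) \<Longrightarrow> \<phi> x = 0"
        "(LINT x|N. (g n x - \<phi> x)\<^sup>2) < \<epsilon>"
      using test_approximableD \<epsilon> by blast
    have [measurable]: "\<phi> \<in> borel_measurable borel" using test_function_measurable[OF \<phi>(1)] .
    obtain B where B: "\<And>x. \<bar>\<phi> x\<bar> \<le> B" using test_function_bounded[OF \<phi>(1)] by blast
    have isq: "integrable N (\<lambda>x. (g n x - \<phi> x)\<^sup>2)" by (rule integrable_sq_diff[OF fin setsN g gb \<phi>(1)])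
    have iab: "integrable lborel (\<lambda>x. f x * \<phi> x)" "integrable lborel (\<lambda>x. f x * g n x)"
      by (rule integrable_mult_bounded[OF f _ B] integrable_mult_bounded[OF f _ gb], simp)+
    let ?d = "\<lambda>x. (2 * (f x * g n x) - (g n x)\<^sup>2) - (2 * (f x * \<phi> x) - (\<phi> x)\<^sup>2)"
    let ?h = "\<lambda>x. (1 + (2 + 2 * real n) / \<eta>) * (g n x - \<phi> x)\<^sup>2 + (2 + 2 * real n) * \<eta>"
    have le: "?d x \<le> (\<bar>f x\<bar> + indicator (ball 0 (real n)) x) * ?h x" for x
    proof (cases "x \<in> ball 0 (real n)")
      case True
      define t where "t = \<bar>g n x - \<phi> x\<bar>"
      have t: "t \<ge> 0" by (simp add: t_def)
      \<comment> \<open>bounds the linear error by the quadratic one, at the price of a small constant\<close>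
      have "t \<le> t\<^sup>2 / \<eta> + \<eta>"
      proof -
        have "0 \<le> (t - \<eta>)\<^sup>2 + t * \<eta>" using t \<eta> by (intro add_nonneg_nonneg mult_nonneg_nonneg) auto
        then have "t * \<eta> \<le> t\<^sup>2 + \<eta> * \<eta>" by (simp add: power2_eq_square algebra_simps)
        then have "t \<le> (t\<^sup>2 + \<eta> * \<eta>) / \<eta>" using \<eta> by (simp add: pos_le_divide_eq)
        then show ?thesis using \<eta> by (simp add: add_divide_distrib)
      qed
      have "f x * (g n x - \<phi> x) \<le> \<bar>f x\<bar> * t"
        unfolding t_def abs_mult[symmetric] by simp
      then have 1: "2 * (f x * g n x) - 2 * (f x * \<phi> x) \<le> \<bar>f x\<bar> * (2 * t)" by (simp add: algebra_simps)
      have "(\<phi> x)\<^sup>2 - (g n x)\<^sup>2 = (\<phi> x - g n x)\<^sup>2 + 2 * (g n x) * (\<phi> x - g n x)"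
        by (simp add: power2_eq_square algebra_simps)
      also have "(\<phi> x - g n x)\<^sup>2 = t\<^sup>2" by (simp add: t_def power2_commute)
      also have "2 * (g n x) * (\<phi> x - g n x) \<le> 2 * \<bar>g n x\<bar> * t"
      proof -
        have "g n x * (\<phi> x - g n x) \<le> \<bar>g n x\<bar> * t" 
          unfolding t_def abs_minus_commute[of "g n x" "\<phi> x"] abs_mult[symmetric] by simp
        then show ?thesis by simp
      qed
      also have "2 * \<bar>g n x\<bar> * t \<le> 2 * real n * t" using gb[of n x] t by (simp add: mult_right_mono)
      finally have 2: "(\<phi> x)\<^sup>2 - (g n x)\<^sup>2 \<le> t\<^sup>2 + 2 * real n * t" by simp
      have h: "t\<^sup>2 + (2 + 2 * real n) * t \<le> ?h x"
      proof -
        have "(2 + 2 * real n) * t \<le> (2 + 2 * real n) * (t\<^sup>2 / \<eta> + \<eta>)"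
          using \<open>t \<le> t\<^sup>2 / \<eta> + \<eta>\<close> by (intro mult_left_mono) auto
        moreover have "(g n x - \<phi> x)\<^sup>2 = t\<^sup>2" by (simp add: t_def)
        ultimately show ?thesis by (simp add: algebra_simps add_divide_distrib)
      qed
      have a: "2 * t \<le> ?h x" "t\<^sup>2 + 2 * real n * t \<le> ?h x"
      proof -
        have "(2 + 2 * real n) * t = 2 * t + 2 * real n * t" by (simp add: algebra_simps)
        moreover have "0 \<le> 2 * real n * t" using t by simp
        moreover have "0 \<le> t\<^sup>2" by simp
        ultimately show "2 * t \<le> ?h x" "t\<^sup>2 + 2 * real n * t \<le> ?h x" using h t by linarith+
      qed
      have "?d x \<le> \<bar>f x\<bar> * (2 * t) + (t\<^sup>2 + 2 * real n * t)" using 1 2 by linarith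
      also have "\<dots> \<le> \<bar>f x\<bar> * ?h x + ?h x" by (intro add_mono mult_left_mono a) auto
      also have "\<dots> = (\<bar>f x\<bar> + 1) * ?h x" by (simp only: distrib_right mult_1)
      finally show ?thesis by (simp only: indicator_simps(1)[OF True])
    next
      case False
      then show ?thesis using \<phi>(2)[OF False] g0[OF False] \<eta> by simp
    qed
    have ih: "integrable N ?h" using isq by auto
    have id: "integrable lborel ?d" using iab gi2[of n] test_function_lborel[OF \<phi>(1)] by auto
    have "(LINT x|lborel. ?d x) \<le> (LINT x|N. ?h x)"
      using le id ih by (subst int_N, simp, intro integral_mono) (auto simp: intble_N)
    also have "\<dots> = (1 + (2 + 2 * real n) / \<eta>) * (LINT x|N. (g n x - \<phi> x)\<^sup>2) + (2 + 2 * real n) * \<eta> * M"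
      using isq by (simp add: M_def)
    also have "\<dots> \<le> e / 2 + e / 2"
    proof (rule add_mono)
      define P where "P = 1 + (2 + 2 * real n) / \<eta>"
      have p: "P > 0" unfolding P_def using \<eta> by (intro add_pos_nonneg) auto
      have "P * (LINT x|N. (g n x - \<phi> x)\<^sup>2) \<le> P * \<epsilon>" using \<phi>(3) p by (intro mult_left_mono) auto
      also have "\<dots> = e / 2" unfolding \<epsilon>_def P_def[symmetric] using p by simp
      finally show "(1 + (2 + 2 * real n) / \<eta>) * (LINT x|N. (g n x - \<phi> x)\<^sup>2) \<le> e / 2"
        unfolding P_def .
      have "(2 + 2 * real n) * \<eta> * M \<le> (2 + 2 * real n) * \<eta> * (M + 1)"
        using \<eta> by (intro mult_left_mono) auto
      also have "\<dots> = e / 2"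
      proof -
        have "(2 + 2 * real n) * (M + 1) \<noteq> 0" using M by auto
        then show ?thesis by (simp add: \<eta>_def divide_simps)
      qed
      finally show "(2 + 2 * real n) * \<eta> * M \<le> e / 2" .
    qed
    finally have d: "(LINT x|lborel. ?d x) \<le> e" by simp
    have "(LINT x|lborel. ?d x) = (LINT x|lborel. (g n x)\<^sup>2) - (2 * (LINT x|lborel. f x * \<phi> x) - (LINT x|lborel. (\<phi> x)\<^sup>2))"
    proof -
      have "f x * g n x = (g n x)\<^sup>2" for x by (auto simp: g_def power2_eq_square)
      then have "?d = (\<lambda>x. (g n x)\<^sup>2 - (2 * (f x * \<phi> x) - (\<phi> x)\<^sup>2))" by (intro ext) (simp only:)
      then show ?thesis using iab gi2[of n] test_function_lborel[OF \<phi>(1)] by simp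
    qed
    with d have "(LINT x|lborel. (g n x)\<^sup>2) \<le> (2 * (LINT x|lborel. f x * \<phi> x) - (LINT x|lborel. (\<phi> x)\<^sup>2)) + e"
      by linarith
    then have "ereal (LINT x|lborel. (g n x)\<^sup>2) \<le> ereal (2 * (LINT x|lborel. f x * \<phi> x) - (LINT x|lborel. (\<phi> x)\<^sup>2)) + ereal e"
      by simp
    also have "\<dots> \<le> c + ereal e" by (intro add_right_mono *[OF \<phi>(1)])
    finally show "ereal (LINT x|lborel. (g n x)\<^sup>2) \<le> c + ereal e" .
  qed
  show ?thesis
  proof (cases c)
    case (real r)
    have "(\<integral>\<^sup>+x. ennreal ((f x)\<^sup>2) \<partial>lborel) \<le> ennreal r"
    proof -
      have "(\<integral>\<^sup>+x. ennreal ((f x)\<^sup>2) \<partial>lborel) = (\<integral>\<^sup>+x. liminf (\<lambda>n. ennreal ((g n x)\<^sup>2)) \<partial>lborel)"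
      proof (rule nn_integral_cong)
        fix x
        have "eventually (\<lambda>n. g n x = f x) sequentially"
          using eventually_gt_at_top[of "nat \<lceil>max (\<bar>f x\<bar>) (norm x)\<rceil>"]
        proof eventually_elim
          case (elim n)
          then have "max (\<bar>f x\<bar>) (norm x) < real n" by linarith
          then show ?case by (auto simp: g_def)
        qed
        then have "(\<lambda>n. ennreal ((g n x)\<^sup>2)) \<longlonglongrightarrow> ennreal ((f x)\<^sup>2)"
          by (intro tendsto_eventually) (auto elim: eventually_mono)
        then show "ennreal ((f x)\<^sup>2) = liminf (\<lambda>n. ennreal ((g n x)\<^sup>2))"
          by (rule lim_imp_Liminf[symmetric, OF trivial_limit_sequentially])
      qed
      also have "\<dots> \<le> liminf (\<lambda>n. \<integral>\<^sup>+x. ennreal ((g n x)\<^sup>2) \<partial>lborel)"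
        by (rule nn_integral_liminf) simp
      also have "\<dots> \<le> liminf (\<lambda>n::nat. ennreal r)"
      proof (intro Liminf_mono always_eventually allI)
        fix n
        have "(LINT x|lborel. (g n x)\<^sup>2) \<le> r" using main[of n] real by simp
        then show "(\<integral>\<^sup>+x. ennreal ((g n x)\<^sup>2) \<partial>lborel) \<le> ennreal r"
          using gi2[of n] by (subst nn_integral_eq_integral) (auto intro: ennreal_leI)
      qed
      finally show ?thesis by (simp add: Liminf_const)
    qed
    moreover have r: "r \<ge> 0"
    proof -
      have "0 \<le> (LINT x|lborel. (g 0 x)\<^sup>2)" by (rule integral_nonneg_AE) auto
      also have "\<dots> \<le> r" using main[of 0] real by simp
      finally show ?thesis .
    qed
    ultimately have i: "integrable lborel (\<lambda>x. (f x)\<^sup>2)"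
      by (intro integrableI_bounded) (auto simp: top_unique less_top[symmetric])
    then have "ennreal (LINT x|lborel. (f x)\<^sup>2) \<le> ennreal r"
      using \<open>(\<integral>\<^sup>+x. ennreal ((f x)\<^sup>2) \<partial>lborel) \<le> ennreal r\<close> by (subst nn_integral_eq_integral[symmetric]) auto
    then have "(LINT x|lborel. (f x)\<^sup>2) \<le> r" using r by simp
    then show ?thesis using i real by (simp add: L2_norm_sq)
  next
    case MInf
    then show ?thesis using main[of 0] by simp
  qed simp
qed

section \<open>Compactly supported measures and products of narrow limits\<close>

lemma sum_list_product_mult:
  fixes f :: "'a \<Rightarrow> real"
  shows "(\<Sum>p\<leftarrow>List.product l m. f (fst p) * g (snd p)) = (\<Sum>a\<leftarrow>l. f a) * (\<Sum>b\<leftarrow>m. g b)"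
  by (induction l) (simp_all add: o_def sum_list_const_mult distrib_right)

text \<open>
  The linear span of a family closed under products is an algebra, to which the Stone-Weierstrass
  theorem applies. Elements of the span are lists of pairs of a coefficient and a member.
\<close>

lemma multiplicative_family_dense:
  fixes Q :: "('a::t2_space \<Rightarrow> real) set"
  assumes Z: "compact Z" and cont: "\<And>q. q \<in> Q \<Longrightarrow> continuous_on Z q"
    and one: "(\<lambda>_. 1) \<in> Q" and mult: "\<And>q r. q \<in> Q \<Longrightarrow> r \<in> Q \<Longrightarrow> (\<lambda>x. q x * r x) \<in> Q"
    and sep: "\<And>x y. x \<in> Z \<Longrightarrow> y \<in> Z \<Longrightarrow> x \<noteq> y \<Longrightarrow> \<exists>q\<in>Q. q x \<noteq> q y"
    and f: "continuous_on Z f" and e: "e > 0"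
  obtains l where "snd ` set l \<subseteq> Q" "\<And>x. x \<in> Z \<Longrightarrow> \<bar>f x - (\<Sum>p\<leftarrow>l. fst p * snd p x)\<bar> < e"
proof -
  define P where "P f \<longleftrightarrow> (\<exists>l. snd ` set l \<subseteq> Q \<and> f = (\<lambda>x. \<Sum>p\<leftarrow>l. fst p * snd p x))" for f
  have PI: "P (\<lambda>x. \<Sum>p\<leftarrow>l. fst p * snd p x)" if "snd ` set l \<subseteq> Q" for l
    unfolding P_def using that by blast
  have Pc: "P (\<lambda>x. c)" for c
    using PI[of "[(c, \<lambda>_. 1)]"] one by simp
  have Pq: "P q" if "q \<in> Q" for q
    using PI[of "[(1, q)]"] that by simp
  have Padd: "P (\<lambda>x. f x + g x)" if "P f" "P g" for f g
  proof -
    obtain l m where "snd ` set l \<subseteq> Q" "f = (\<lambda>x. \<Sum>p\<leftarrow>l. fst p * snd p x)"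
      "snd ` set m \<subseteq> Q" "g = (\<lambda>x. \<Sum>p\<leftarrow>m. fst p * snd p x)"
      using \<open>P f\<close> \<open>P g\<close> unfolding P_def by (elim exE conjE)
    then show ?thesis using PI[of "l @ m"] by (simp add: image_Un)
  qed
  have Pmult: "P (\<lambda>x. f x * g x)" if "P f" "P g" for f g
  proof -
    obtain l m where lm: "snd ` set l \<subseteq> Q" "f = (\<lambda>x. \<Sum>p\<leftarrow>l. fst p * snd p x)"
      "snd ` set m \<subseteq> Q" "g = (\<lambda>x. \<Sum>p\<leftarrow>m. fst p * snd p x)"
      using \<open>P f\<close> \<open>P g\<close> unfolding P_def by (elim exE conjE)
    let ?h = "\<lambda>(p, r). (fst p * fst r, \<lambda>x. snd p x * snd r x)"
    have "(\<Sum>p\<leftarrow>map ?h (List.product l m). fst p * snd p x) = f x * g x" for x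
      unfolding lm(2,4) sum_list_product_mult[symmetric]
      by (simp add: o_def case_prod_unfold ac_simps)
    moreover have "snd ` set (map ?h (List.product l m)) \<subseteq> Q"
    proof (intro subsetI)
      fix q assume "q \<in> snd ` set (map ?h (List.product l m))"
      then obtain p r where pr: "p \<in> set l" "r \<in> set m" "q = (\<lambda>x. snd p x * snd r x)" by auto
      show "q \<in> Q" unfolding pr(3) by (rule mult) (use pr lm in auto)
    qed
    ultimately show ?thesis using PI[of "map ?h (List.product l m)"] by simp
  qed
  have "\<exists>g. P g \<and> (\<forall>x\<in>Z. \<bar>f x - g x\<bar> < e)"
  proof (rule Stone_Weierstrass_HOL[OF Z])
    show "continuous_on Z f" if Pf: "P f" for f
    proof -
      obtain l where l: "snd ` set l \<subseteq> Q" "f = (\<lambda>x. \<Sum>p\<leftarrow>l. fst p * snd p x)"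
        using Pf unfolding P_def by (elim exE conjE)
      have "continuous_on Z (\<lambda>x. \<Sum>p\<leftarrow>l. fst p * snd p x)" using l(1)
        by (induction l) (auto intro!: continuous_on_add continuous_on_mult continuous_on_const intro: cont)
      then show ?thesis using l(2) by simp
    qed
    show "\<exists>f. P f \<and> f x \<noteq> f y" if "x \<in> Z \<and> y \<in> Z \<and> x \<noteq> y" for x y
      using sep[of x y] that Pq by auto
  qed (use Pc Padd Pmult f e in auto)
  then obtain g where g: "P g" "\<forall>x\<in>Z. \<bar>f x - g x\<bar> < e" by (elim exE conjE)
  obtain l where "snd ` set l \<subseteq> Q" "g = (\<lambda>x. \<Sum>p\<leftarrow>l. fst p * snd p x)"
    using g(1) unfolding P_def by (elim exE conjE)
  then show ?thesis using that[of l] g(2) by simp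
qed

text \<open>
  A finite Borel measure with support in a closed ball, in the almost-everywhere form in which the
  support enters estimates of integrals.
\<close>

definition carried :: "real \<Rightarrow> plane measure \<Rightarrow> bool" where
  "carried R \<nu> \<longleftrightarrow> finite_measure \<nu> \<and> sets \<nu> = sets borel \<and> (AE x in \<nu>. x \<in> cball 0 R)"

lemma carriedD:
  assumes "carried R \<nu>"
  shows "finite_measure \<nu>" "sets \<nu> = sets borel" "space \<nu> = UNIV" "AE x in \<nu>. x \<in> cball 0 R"
  using assms sets_eq_imp_space_eq[of \<nu> borel] by (auto simp: carried_def)

lemma carried_measurable: "carried R \<nu> \<Longrightarrow> borel_measurable \<nu> = borel_measurable borel"
  using measurable_cong_sets[OF carriedD(2) refl] .

lemma integral_abs_le_mass:
  assumes "finite_measure M" "AE x in M. \<bar>f x\<bar> \<le> B" "B \<ge> 0"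
  shows "\<bar>LINT x|M. f x\<bar> \<le> B * measure M (space M)"
proof (cases "integrable M f")
  case True
  interpret finite_measure M by fact
  have "\<bar>LINT x|M. f x\<bar> \<le> (LINT x|M. \<bar>f x\<bar>)" by simp
  also have "\<dots> \<le> (LINT x|M. B)" using True assms by (intro integral_mono_AE) auto
  also have "\<dots> = B * measure M (space M)" by simp
  finally show ?thesis .
next
  case False
  then show ?thesis using assms by (simp add: not_integrable_integral_eq)
qed

lemma continuous_bounded_on_cball:
  fixes f :: "plane \<Rightarrow> real"
  assumes "continuous_on (cball 0 R) f"
  obtains B where "B \<ge> 0" "\<And>x. x \<in> cball 0 R \<Longrightarrow> \<bar>f x\<bar> \<le> B"
proof -
  have "bounded (f ` cball 0 R)"
    by (intro compact_imp_bounded compact_continuous_image assms) auto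
  then have "\<exists>B. \<forall>x\<in>cball 0 R. \<bar>f x\<bar> \<le> B" unfolding bounded_iff by simp
  then obtain B where B: "\<forall>x\<in>cball 0 R. \<bar>f x\<bar> \<le> B" by (elim exE)
  have "\<bar>f x\<bar> \<le> max B 0" if "x \<in> cball 0 R" for x using B that by (simp add: le_max_iff_disj)
  then show ?thesis using that[of "max B 0"] by simp
qed

lemma carried_integrable:
  fixes f :: "plane \<Rightarrow> real"
  assumes "carried R \<nu>" "f \<in> borel_measurable borel" "\<And>x. x \<in> cball 0 R \<Longrightarrow> \<bar>f x\<bar> \<le> B"
  shows "integrable \<nu> f"
proof (rule finite_measure.integrable_const_bound[where B=B])
  show "finite_measure \<nu>" using carriedD[OF assms(1)] by simp
  show "f \<in> borel_measurable \<nu>" using assms(2) by (simp add: carried_measurable[OF assms(1)])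
  show "AE x in \<nu>. norm (f x) \<le> B" using carriedD(4)[OF assms(1)] assms(3) by auto
qed

lemma carried_integrable_continuous:
  fixes f :: "plane \<Rightarrow> real"
  assumes "carried R \<nu>" "continuous_on UNIV f"
  shows "integrable \<nu> f"
proof -
  obtain B where "\<And>x. x \<in> cball 0 R \<Longrightarrow> \<bar>f x\<bar> \<le> B"
    using continuous_bounded_on_cball[OF continuous_on_subset[OF assms(2)], of R] by auto
  then show ?thesis
    using assms by (intro carried_integrable[OF assms(1)] borel_measurable_continuous_onI) auto
qed

lemma carried_sigma_finite: "carried R \<nu> \<Longrightarrow> sigma_finite_measure \<nu>"
  using carriedD(1) finite_measure.sigma_finite_measure by blast

lemma inner_integral_measurable:
  fixes f :: "plane \<Rightarrow> plane \<Rightarrow> real"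
  assumes "carried R \<nu>" "case_prod f \<in> borel_measurable (borel \<Otimes>\<^sub>M borel)"
  shows "(\<lambda>x. LINT y|\<nu>. f x y) \<in> borel_measurable borel"
proof -
  interpret sigma_finite_measure \<nu> by (rule carried_sigma_finite[OF assms(1)])
  have "borel_measurable ((borel :: plane measure) \<Otimes>\<^sub>M \<nu>)
      = (borel_measurable (borel \<Otimes>\<^sub>M (borel :: plane measure)) :: (plane \<times> plane \<Rightarrow> real) set)"
    by (intro measurable_cong_sets sets_pair_measure_cong) (auto simp: carriedD(2)[OF assms(1)])
  then have "(\<lambda>(x, y). f x y) \<in> borel_measurable ((borel :: plane measure) \<Otimes>\<^sub>M \<nu>)"
    using assms(2) by simp
  then show ?thesis by (rule borel_measurable_lebesgue_integral)
qed

lemma diff_measurable: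
  fixes G :: "plane \<Rightarrow> real"
  assumes "G \<in> borel_measurable borel"
  shows "(\<lambda>(x, y). G (x - y)) \<in> borel_measurable (borel \<Otimes>\<^sub>M borel)"
  using assms by measurable

lemma carried_iterated_bound:
  fixes f g :: "plane \<Rightarrow> plane \<Rightarrow> real"
  assumes \<nu>: "carried R \<nu>" and \<mu>: "carried R \<mu>" and d: "d \<ge> 0"
    and f: "case_prod f \<in> borel_measurable (borel \<Otimes>\<^sub>M borel)"
    and g: "case_prod g \<in> borel_measurable (borel \<Otimes>\<^sub>M borel)"
    and gB: "\<And>x y. x \<in> cball 0 R \<Longrightarrow> y \<in> cball 0 R \<Longrightarrow> \<bar>g x y\<bar> \<le> B"
    and fg: "\<And>x y. x \<in> cball 0 R \<Longrightarrow> y \<in> cball 0 R \<Longrightarrow> \<bar>f x y - g x y\<bar> \<le> d"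
  shows "\<bar>(LINT x|\<nu>. LINT y|\<mu>. f x y) - (LINT x|\<nu>. LINT y|\<mu>. g x y)\<bar>
           \<le> d * measure \<mu> UNIV * measure \<nu> UNIV"
proof -
  define B' where "B' = max B 0"
  have gB': "\<bar>g x y\<bar> \<le> B'" if "x \<in> cball 0 R" "y \<in> cball 0 R" for x y
    using gB[OF that] by (simp add: B'_def)
  have fB': "\<bar>f x y\<bar> \<le> B' + d" if "x \<in> cball 0 R" "y \<in> cball 0 R" for x y
    using gB'[OF that] fg[OF that] by linarith
  have B'0: "B' \<ge> 0" by (simp add: B'_def)
  have [measurable]: "(\<lambda>y. f x y) \<in> borel_measurable borel" "(\<lambda>y. g x y) \<in> borel_measurable borel" for x
    using f g by (auto dest: measurable_Pair2[of _ _ _ _ x])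
  have sp: "space \<mu> = UNIV" "space \<nu> = UNIV" using carriedD(3) \<mu> \<nu> by auto
  have i: "integrable \<mu> (f x)" "integrable \<mu> (g x)" if "x \<in> cball 0 R" for x
  proof -
    show "integrable \<mu> (f x)" by (rule carried_integrable[OF \<mu> _ fB'[OF that]]) auto
    show "integrable \<mu> (g x)" by (rule carried_integrable[OF \<mu> _ gB'[OF that]]) auto
  qed
  have in_ae: "AE y in \<mu>. y \<in> cball 0 R" "AE x in \<nu>. x \<in> cball 0 R"
    using carriedD(4) \<mu> \<nu> by auto
  have b: "\<bar>LINT y|\<mu>. f x y\<bar> \<le> (B' + d) * measure \<mu> UNIV" "\<bar>LINT y|\<mu>. g x y\<bar> \<le> B' * measure \<mu> UNIV"
    if "x \<in> cball 0 R" for x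
  proof -
    have "AE y in \<mu>. \<bar>f x y\<bar> \<le> B' + d" "AE y in \<mu>. \<bar>g x y\<bar> \<le> B'"
      using in_ae(1) fB'[OF that] gB'[OF that] by auto
    then show "\<bar>LINT y|\<mu>. f x y\<bar> \<le> (B' + d) * measure \<mu> UNIV" "\<bar>LINT y|\<mu>. g x y\<bar> \<le> B' * measure \<mu> UNIV"
      using integral_abs_le_mass[OF carriedD(1)[OF \<mu>], of "f x" "B' + d"]
        integral_abs_le_mass[OF carriedD(1)[OF \<mu>], of "g x" "B'"] d B'0 sp by auto
  qed
  have io: "integrable \<nu> (\<lambda>x. LINT y|\<mu>. f x y)" "integrable \<nu> (\<lambda>x. LINT y|\<mu>. g x y)"
    by (rule carried_integrable[OF \<nu> inner_integral_measurable[OF \<mu> f] b(1)], assumption)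
       (rule carried_integrable[OF \<nu> inner_integral_measurable[OF \<mu> g] b(2)], assumption)
  have "\<bar>(LINT y|\<mu>. f x y) - (LINT y|\<mu>. g x y)\<bar> \<le> d * measure \<mu> UNIV" if x: "x \<in> cball 0 R" for x
  proof -
    have "(LINT y|\<mu>. f x y) - (LINT y|\<mu>. g x y) = (LINT y|\<mu>. f x y - g x y)"
      using i[OF x] by simp
    moreover have "AE y in \<mu>. \<bar>f x y - g x y\<bar> \<le> d" using in_ae(1) fg[OF x] by auto
    ultimately show ?thesis
      using integral_abs_le_mass[OF carriedD(1)[OF \<mu>], of "\<lambda>y. f x y - g x y" d] d sp by simp
  qed
  then have "AE x in \<nu>. \<bar>(LINT y|\<mu>. f x y) - (LINT y|\<mu>. g x y)\<bar> \<le> d * measure \<mu> UNIV"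
    using in_ae(2) by auto
  then have "\<bar>LINT x|\<nu>. (LINT y|\<mu>. f x y) - (LINT y|\<mu>. g x y)\<bar> \<le> d * measure \<mu> UNIV * measure \<nu> UNIV"
    using integral_abs_le_mass[OF carriedD(1)[OF \<nu>], of "\<lambda>x. (LINT y|\<mu>. f x y) - (LINT y|\<mu>. g x y)" "d * measure \<mu> UNIV"] d sp
    by simp
  then show ?thesis using io by simp
qed

lemma continuous_pair_integrable:
  fixes G :: "plane \<Rightarrow> real"
  assumes \<nu>: "carried R \<nu>" and \<mu>: "carried R \<mu>" and G: "continuous_on UNIV G"
  shows "integrable \<nu> (\<lambda>x. LINT y|\<mu>. G (x - y))"
    "(LINT x|\<nu>. LINT y|\<mu>. G (x - y)) = (LINT y|\<mu>. LINT x|\<nu>. G (x - y))"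
proof -
  interpret \<nu>: sigma_finite_measure \<nu> by (rule carried_sigma_finite[OF \<nu>])
  interpret \<mu>: sigma_finite_measure \<mu> by (rule carried_sigma_finite[OF \<mu>])
  interpret pair_sigma_finite \<nu> \<mu> ..
  have [measurable_cong]: "sets \<nu> = sets borel" "sets \<mu> = sets borel" using carriedD(2) \<nu> \<mu> by auto
  have Gm[measurable]: "G \<in> borel_measurable borel" using G by (rule borel_measurable_continuous_onI)
  obtain B where B: "B \<ge> 0" "\<And>z. z \<in> cball 0 (2 * R) \<Longrightarrow> \<bar>G z\<bar> \<le> B"
    using continuous_bounded_on_cball[OF continuous_on_subset[OF G], of "2 * R"] by auto
  have b: "\<bar>LINT y|\<mu>. \<bar>G (x - y)\<bar>\<bar> \<le> B * measure \<mu> (space \<mu>)" if x: "x \<in> cball 0 R" for x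
  proof (rule integral_abs_le_mass[OF carriedD(1)[OF \<mu>] _ B(1)])
    show "AE y in \<mu>. \<bar>\<bar>G (x - y)\<bar>\<bar> \<le> B"
      using carriedD(4)[OF \<mu>]
    proof eventually_elim
      case (elim y)
      then have "x - y \<in> cball 0 (2 * R)" using x norm_triangle_ineq4[of x y] by simp
      then show ?case using B(2) by simp
    qed
  qed
  have Gc: "continuous_on UNIV (\<lambda>y. G (x - y))" for x
    by (rule continuous_on_compose2[OF G]) (auto intro: continuous_intros)
  have i: "integrable (\<nu> \<Otimes>\<^sub>M \<mu>) (\<lambda>(x, y). G (x - y))"
  proof (rule Fubini_integrable)
    show "(\<lambda>(x, y). G (x - y)) \<in> borel_measurable (\<nu> \<Otimes>\<^sub>M \<mu>)" by measurable
    have m: "(\<lambda>x. LINT y|\<mu>. \<bar>G (x - y)\<bar>) \<in> borel_measurable borel"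
      by (rule inner_integral_measurable[OF \<mu>]) measurable
    show "integrable \<nu> (\<lambda>x. LINT y|\<mu>. norm (case (x, y) of (x, y) \<Rightarrow> G (x - y)))"
      using carried_integrable[OF \<nu> m b] by simp
    show "AE x in \<nu>. integrable \<mu> (\<lambda>y. case (x, y) of (x, y) \<Rightarrow> G (x - y))"
      using carried_integrable_continuous[OF \<mu> Gc] by simp
  qed
  show "integrable \<nu> (\<lambda>x. LINT y|\<mu>. G (x - y))" using integrable_fst[OF i] .
  show "(LINT x|\<nu>. LINT y|\<mu>. G (x - y)) = (LINT y|\<mu>. LINT x|\<nu>. G (x - y))"
    using Fubini_integral[OF i] by simp
qed

lemma narrow_conv_mass:
  assumes "narrow_conv \<nu> \<nu>'" "\<And>n. space (\<nu> n) = UNIV" "space \<nu>' = UNIV"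
  shows "(\<lambda>n. measure (\<nu> n) UNIV) \<longlonglongrightarrow> measure \<nu>' UNIV"
proof -
  have "continuous_on UNIV (\<lambda>x::plane. 1::real) \<and> bounded (range (\<lambda>x::plane. 1::real))" by simp
  then have "(\<lambda>n. LINT x|\<nu> n. (1::real)) \<longlonglongrightarrow> (LINT x|\<nu>'. 1)"
    using assms(1) unfolding narrow_conv_def by blast
  then show ?thesis using assms by simp
qed

text \<open>
  Finite sums of products \<open>a(x) b(y)\<close> are uniformly dense in the continuous functions on a compact
  square. For a product the double integral factorises, and each factor converges by hypothesis. The
  kernels are allowed to vary with \<open>n\<close> because the regular part of the energy does.
\<close>

lemma narrow_conv_pair:
  fixes G :: "plane \<Rightarrow> real" and Gn :: "nat \<Rightarrow> plane \<Rightarrow> real"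
  assumes \<nu>: "\<And>n. carried R (\<nu> n)" "carried R \<nu>'" "narrow_conv \<nu> \<nu>'"
    and \<mu>: "\<And>n. carried R (\<mu> n)" "carried R \<mu>'" "narrow_conv \<mu> \<mu>'"
    and G: "continuous_on UNIV G" "\<And>n. Gn n \<in> borel_measurable borel"
    and lim: "uniform_limit (cball 0 (2 * R)) Gn G sequentially"
  shows "(\<lambda>n. LINT x|\<nu> n. LINT y|\<mu> n. Gn n (x - y)) \<longlonglongrightarrow> (LINT x|\<nu>'. LINT y|\<mu>'. G (x - y))"
proof (rule LIMSEQ_I)
  fix r :: real assume r: "r > 0"
  let ?Z = "cball 0 R :: plane set"
  have Gm: "G \<in> borel_measurable borel" using G(1) by (rule borel_measurable_continuous_onI)
  have sp: "space (\<nu> n) = UNIV" "space \<nu>' = UNIV" "space (\<mu> n) = UNIV" "space \<mu>' = UNIV" for n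
    using carriedD(3)[OF \<nu>(1)] carriedD(3)[OF \<nu>(2)] carriedD(3)[OF \<mu>(1)] carriedD(3)[OF \<mu>(2)] by auto
  have mass: "(\<lambda>n. measure (\<mu> n) UNIV * measure (\<nu> n) UNIV) \<longlonglongrightarrow> measure \<mu>' UNIV * measure \<nu>' UNIV"
    by (intro tendsto_mult narrow_conv_mass \<nu> \<mu> sp)
  define K where "K = measure \<mu>' UNIV * measure \<nu>' UNIV + 1"
  have K: "K > 0" unfolding K_def by (intro add_nonneg_pos mult_nonneg_nonneg) auto
  define e where "e = r / (4 * K)"
  have e: "e > 0" using r K by (simp add: e_def)
  define BC where "BC = {a :: plane \<Rightarrow> real. continuous_on UNIV a \<and> bounded (range a)}"
  define Q where "Q = {q. \<exists>a\<in>BC. \<exists>b\<in>BC. q = (\<lambda>z :: plane \<times> plane. a (fst z) * b (snd z))}"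
  have BC1: "(\<lambda>x. 1) \<in> BC" by (simp add: BC_def)
  have BCmult: "(\<lambda>x. a x * b x) \<in> BC" if ab: "a \<in> BC" "b \<in> BC" for a b
  proof -
    obtain A where A: "\<And>x. \<bar>a x\<bar> \<le> A" using ab(1) unfolding BC_def bounded_iff by auto
    obtain B where B: "\<And>x. \<bar>b x\<bar> \<le> B" using ab(2) unfolding BC_def bounded_iff by auto
    have "\<bar>a x * b x\<bar> \<le> A * B" for x
      unfolding abs_mult using A[of x] B[of x] by (intro mult_mono) auto
    then have "bounded (range (\<lambda>x. a x * b x))" unfolding bounded_iff by auto
    then show ?thesis using ab by (auto simp: BC_def intro: continuous_on_mult)
  qed
  obtain l where l: "snd ` set l \<subseteq> Q"
    "\<And>z. z \<in> ?Z \<times> ?Z \<Longrightarrow> \<bar>G (fst z - snd z) - (\<Sum>p\<leftarrow>l. fst p * snd p z)\<bar> < e"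
  proof (rule multiplicative_family_dense[of "?Z \<times> ?Z" Q "\<lambda>z. G (fst z - snd z)" e])
    show "compact (?Z \<times> ?Z)" by (intro compact_Times) auto
    show "continuous_on (?Z \<times> ?Z) q" if q: "q \<in> Q" for q
    proof -
      obtain a b where ab: "a \<in> BC" "b \<in> BC" "q = (\<lambda>z. a (fst z) * b (snd z))"
        using q unfolding Q_def by blast
      have "continuous_on UNIV a" "continuous_on UNIV b" using ab by (auto simp: BC_def)
      then have "continuous_on (?Z \<times> ?Z) (\<lambda>z. a (fst z))" "continuous_on (?Z \<times> ?Z) (\<lambda>z. b (snd z))"
        using continuous_on_compose2[of UNIV a "?Z \<times> ?Z" fst] continuous_on_compose2[of UNIV b "?Z \<times> ?Z" snd]
          continuous_on_fst[OF continuous_on_id, of "?Z \<times> ?Z"] continuous_on_snd[OF continuous_on_id, of "?Z \<times> ?Z"]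
        by simp_all
      then show ?thesis unfolding ab(3) by (rule continuous_on_mult)
    qed
    show "(\<lambda>_. 1) \<in> Q" unfolding Q_def using BC1 by force
    show "(\<lambda>x. q x * r x) \<in> Q" if qr: "q \<in> Q" "r \<in> Q" for q r
    proof -
      obtain a b where ab: "a \<in> BC" "b \<in> BC" "q = (\<lambda>z. a (fst z) * b (snd z))"
        using qr(1) unfolding Q_def by blast
      obtain c d where cd: "c \<in> BC" "d \<in> BC" "r = (\<lambda>z. c (fst z) * d (snd z))"
        using qr(2) unfolding Q_def by blast
      show ?thesis unfolding Q_def mem_Collect_eq
        by (rule bexI[OF _ BCmult[OF ab(1) cd(1)]], rule bexI[OF _ BCmult[OF ab(2) cd(2)]])
           (simp add: ab(3) cd(3) fun_eq_iff)
    qed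
    show "\<exists>q\<in>Q. q z \<noteq> q w" if "z \<noteq> w" for z w
    proof -
      \<comment> \<open>a bounded continuous function that vanishes only at \<open>x0\<close> separates \<open>x0\<close> from all other points\<close>
      have d: "(\<lambda>x. min 1 (dist x x0)) \<in> BC" for x0
      proof -
        have "bounded (range (\<lambda>x. min 1 (dist x x0)))"
          unfolding bounded_iff by (intro exI[of _ 1]) auto
        then show ?thesis by (auto simp: BC_def intro!: continuous_intros)
      qed
      from that consider "fst z \<noteq> fst w" | "snd z \<noteq> snd w" by (metis prod.expand)
      then show ?thesis
      proof cases
        case 1
        have "(\<lambda>x. min 1 (dist (fst x) (fst w)) * 1) \<in> Q"
          unfolding Q_def mem_Collect_eq by (rule bexI[OF _ d], rule bexI[OF _ BC1]) simp
        then show ?thesis by (rule bexI[rotated]) (use 1 zero_less_dist_iff[of "fst z" "fst w"] in \<open>auto simp: min_def\<close>)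
      next
        case 2
        have "(\<lambda>x. 1 * min 1 (dist (snd x) (snd w))) \<in> Q"
          unfolding Q_def mem_Collect_eq by (rule bexI[OF _ BC1], rule bexI[OF _ d]) simp
        then show ?thesis by (rule bexI[rotated]) (use 2 zero_less_dist_iff[of "snd z" "snd w"] in \<open>auto simp: min_def\<close>)
      qed
    qed
    show "continuous_on (?Z \<times> ?Z) (\<lambda>z. G (fst z - snd z))"
      by (rule continuous_on_compose2[OF G(1)]) (auto intro!: continuous_intros)
  qed (use e in auto)
  define g where "g x y = (\<Sum>p\<leftarrow>l. fst p * snd p (x, y))" for x y
  have Qm: "(\<lambda>(x, y). q (x, y)) \<in> borel_measurable (borel \<Otimes>\<^sub>M borel)" if q: "q \<in> Q" for q
  proof -
    obtain a b where ab: "a \<in> BC" "b \<in> BC" "q = (\<lambda>z. a (fst z) * b (snd z))"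
      using q unfolding Q_def by blast
    have [measurable]: "a \<in> borel_measurable borel" "b \<in> borel_measurable borel"
      using ab by (auto simp: BC_def intro: borel_measurable_continuous_onI)
    show ?thesis unfolding ab(3) by simp
  qed
  have gm: "case_prod g \<in> borel_measurable (borel \<Otimes>\<^sub>M borel)"
    using l(1) unfolding g_def by (induction l) (auto simp: case_prod_unfold intro!: borel_measurable_add borel_measurable_times dest: Qm)
  have Qi: "(LINT x|\<nu>. LINT y|\<mu>. q (x, y)) = (LINT x|\<nu>. a x) * (LINT y|\<mu>. b y)"
    if "q = (\<lambda>z. a (fst z) * b (snd z))" for q and a b :: "plane \<Rightarrow> real" and \<nu> \<mu> :: "plane measure"
    using that by simp
  have gint: "(LINT x|\<nu>. LINT y|\<mu>. g x y) = (\<Sum>p\<leftarrow>l. fst p * (LINT x|\<nu>. LINT y|\<mu>. snd p (x, y)))"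
    if c: "carried R \<nu>" "carried R \<mu>" for \<nu> \<mu>
  proof -
    have "(LINT x|\<nu>. LINT y|\<mu>. g x y) = (\<Sum>p\<leftarrow>l. fst p * (LINT x|\<nu>. LINT y|\<mu>. snd p (x, y)))
       \<and> integrable \<nu> (\<lambda>x. LINT y|\<mu>. g x y) \<and> (\<forall>x. integrable \<mu> (g x))"
      using l(1) unfolding g_def
    proof (induction l)
      case (Cons p l)
      obtain a b where ab: "a \<in> BC" "b \<in> BC" "snd p = (\<lambda>z. a (fst z) * b (snd z))"
        using Cons.prems unfolding Q_def by auto
      have i: "integrable \<mu> b" "integrable \<nu> a"
        using ab c by (auto simp: BC_def intro: carried_integrable_continuous)
      then show ?case using Cons by (auto simp: ab(3))
    qed simp
    then show ?thesis by simp
  qed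
  have "(\<lambda>n. \<Sum>p\<leftarrow>l. fst p * (LINT x|\<nu> n. LINT y|\<mu> n. snd p (x, y)))
     \<longlonglongrightarrow> (\<Sum>p\<leftarrow>l. fst p * (LINT x|\<nu>'. LINT y|\<mu>'. snd p (x, y)))"
    using l(1)
  proof (induction l)
    case (Cons p l)
    obtain a b where ab: "a \<in> BC" "b \<in> BC" "snd p = (\<lambda>z. a (fst z) * b (snd z))"
      using Cons.prems unfolding Q_def by auto
    have "(\<lambda>n. LINT x|\<nu> n. a x) \<longlonglongrightarrow> (LINT x|\<nu>'. a x)" "(\<lambda>n. LINT x|\<mu> n. b x) \<longlonglongrightarrow> (LINT x|\<mu>'. b x)"
      using \<nu>(3) \<mu>(3) ab(1,2) unfolding narrow_conv_def BC_def by auto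
    then have "(\<lambda>n. LINT x|\<nu> n. LINT y|\<mu> n. snd p (x, y)) \<longlonglongrightarrow> (LINT x|\<nu>'. LINT y|\<mu>'. snd p (x, y))"
      unfolding ab(3) by (simp add: tendsto_mult)
    then show ?case using Cons by (auto intro!: tendsto_intros)
  qed simp
  then have glim: "(\<lambda>n. LINT x|\<nu> n. LINT y|\<mu> n. g x y) \<longlonglongrightarrow> (LINT x|\<nu>'. LINT y|\<mu>'. g x y)"
    using gint[OF \<nu>(1) \<mu>(1)] gint[OF \<nu>(2) \<mu>(2)] by simp
  obtain B where B: "\<And>x y. x \<in> ?Z \<Longrightarrow> y \<in> ?Z \<Longrightarrow> \<bar>g x y\<bar> \<le> B"
  proof -
    obtain B where B: "\<And>z. z \<in> cball 0 (2 * R) \<Longrightarrow> \<bar>G z\<bar> \<le> B"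
      using continuous_bounded_on_cball[OF continuous_on_subset[OF G(1)], of "2 * R"] by auto
    have "\<bar>g x y\<bar> \<le> B + e" if "x \<in> ?Z" "y \<in> ?Z" for x y
    proof -
      have "norm (x - y) \<le> 2 * R" using that norm_triangle_ineq4[of x y] by simp
      then have "\<bar>G (x - y)\<bar> \<le> B" by (intro B) simp
      moreover have "\<bar>G (x - y) - g x y\<bar> < e" using l(2)[of "(x, y)"] that by (simp add: g_def)
      ultimately show ?thesis by linarith
    qed
    then show ?thesis by (rule that)
  qed
  have ev1: "\<forall>\<^sub>F n in sequentially. \<forall>z\<in>cball 0 (2 * R). dist (Gn n z) (G z) < e"
    using lim e unfolding uniform_limit_iff by blast
  have ev2: "\<forall>\<^sub>F n in sequentially. dist (LINT x|\<nu> n. LINT y|\<mu> n. g x y) (LINT x|\<nu>'. LINT y|\<mu>'. g x y) < r / 4"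
    using tendstoD[OF glim, of "r / 4"] r by simp
  have ev3: "\<forall>\<^sub>F n in sequentially. measure (\<mu> n) UNIV * measure (\<nu> n) UNIV < K"
    using mass by (rule order_tendstoD) (simp add: K_def)
  have "\<forall>\<^sub>F n in sequentially. norm ((LINT x|\<nu> n. LINT y|\<mu> n. Gn n (x - y)) - (LINT x|\<nu>'. LINT y|\<mu>'. G (x - y))) < r"
    using ev1 ev2 ev3
  proof eventually_elim
    case (elim n)
    have nx: "x - y \<in> cball 0 (2 * R)" if "x \<in> ?Z" "y \<in> ?Z" for x y :: plane
      using that norm_triangle_ineq4[of x y] by simp
    have "\<bar>Gn n (x - y) - g x y\<bar> \<le> 2 * e" if "x \<in> ?Z" "y \<in> ?Z" for x y
    proof -
      have "\<bar>G (x - y) - g x y\<bar> < e" using l(2)[of "(x, y)"] that by (simp add: g_def)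
      moreover have "\<bar>Gn n (x - y) - G (x - y)\<bar> < e" using elim(1) nx[OF that] by (simp add: dist_real_def)
      ultimately show ?thesis by linarith
    qed
    then have "\<bar>(LINT x|\<nu> n. LINT y|\<mu> n. Gn n (x - y)) - (LINT x|\<nu> n. LINT y|\<mu> n. g x y)\<bar>
         \<le> 2 * e * measure (\<mu> n) UNIV * measure (\<nu> n) UNIV"
      using e by (intro carried_iterated_bound[OF \<nu>(1) \<mu>(1) _ diff_measurable[OF G(2)] gm B]) auto
    also have "\<dots> = 2 * e * (measure (\<mu> n) UNIV * measure (\<nu> n) UNIV)" by simp
    also have "\<dots> \<le> 2 * e * K" using elim(3) e by (intro mult_left_mono) auto
    also have "\<dots> = r / 2" using K by (simp add: e_def)
    finally have 1: "\<bar>(LINT x|\<nu> n. LINT y|\<mu> n. Gn n (x - y)) - (LINT x|\<nu> n. LINT y|\<mu> n. g x y)\<bar> \<le> r / 2" .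
    have "\<bar>G (x - y) - g x y\<bar> \<le> e" if "x \<in> ?Z" "y \<in> ?Z" for x y
      using l(2)[of "(x, y)"] that by (simp add: g_def less_imp_le)
    then have "\<bar>(LINT x|\<nu>'. LINT y|\<mu>'. G (x - y)) - (LINT x|\<nu>'. LINT y|\<mu>'. g x y)\<bar>
         \<le> e * measure \<mu>' UNIV * measure \<nu>' UNIV"
      using e by (intro carried_iterated_bound[OF \<nu>(2) \<mu>(2) _ diff_measurable[OF Gm] gm B]) auto
    also have "\<dots> = e * (measure \<mu>' UNIV * measure \<nu>' UNIV)" by simp
    also have "\<dots> \<le> e * K" using e by (intro mult_left_mono) (auto simp: K_def)
    also have "\<dots> = r / 4" using K by (simp add: e_def)
    finally have 2: "\<bar>(LINT x|\<nu>'. LINT y|\<mu>'. G (x - y)) - (LINT x|\<nu>'. LINT y|\<mu>'. g x y)\<bar> \<le> r / 4" .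
    show ?case using 1 2 elim(2) unfolding dist_real_def real_norm_def by linarith
  qed
  then show "\<exists>no. \<forall>n\<ge>no. norm ((LINT x|\<nu> n. LINT y|\<mu> n. Gn n (x - y)) - (LINT x|\<nu>'. LINT y|\<mu>'. G (x - y))) < r"
    by (simp add: eventually_sequentially)
qed

section \<open>Lower semicontinuity of the energy\<close>

lemma conv_measure_measurable:
  assumes "carried R \<nu>" "W \<in> borel_measurable borel"
  shows "conv_measure W \<nu> \<in> borel_measurable borel"
  unfolding conv_measure_def[abs_def]
  by (rule inner_integral_measurable[OF assms(1) diff_measurable[OF assms(2)]])

lemma lborel_translate:
  fixes f :: "plane \<Rightarrow> real"
  assumes "f \<in> borel_measurable borel"
  shows "(LINT u|lborel. f (u - y)) = (LINT u|lborel. f u)"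
    and "integrable lborel (\<lambda>u. f (u - y)) \<longleftrightarrow> integrable lborel f"
    and "(\<integral>\<^sup>+u. ennreal (f (u - y)) \<partial>lborel) = (\<integral>\<^sup>+u. ennreal (f u) \<partial>lborel)"
proof -
  have d: "distr lborel borel (\<lambda>u. u - y) = lborel"
  proof -
    have "(\<lambda>u::plane. u - y) = (+) (- y)" by (simp add: fun_eq_iff)
    then show ?thesis using lborel_distr_plus[of "- y"] by simp
  qed
  show "(LINT u|lborel. f (u - y)) = (LINT u|lborel. f u)"
    using integral_distr[of "\<lambda>u. u - y" lborel borel f] assms by (simp add: d)
  show "integrable lborel (\<lambda>u. f (u - y)) \<longleftrightarrow> integrable lborel f"
    using integrable_distr_eq[of "\<lambda>u. u - y" lborel borel f] assms by (simp add: d)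
  show "(\<integral>\<^sup>+u. ennreal (f (u - y)) \<partial>lborel) = (\<integral>\<^sup>+u. ennreal (f u) \<partial>lborel)"
    using nn_integral_distr[of "\<lambda>u. u - y" lborel borel "\<lambda>u. ennreal (f u)"] assms by (simp add: d)
qed

lemma lborel_reflect:
  fixes f :: "plane \<Rightarrow> real"
  assumes "f \<in> borel_measurable borel"
  shows "(LINT u|lborel. f (y - u)) = (LINT u|lborel. f u)"
    and "integrable lborel (\<lambda>u. f (y - u)) \<longleftrightarrow> integrable lborel f"
    and "(\<integral>\<^sup>+u. ennreal (f (y - u)) \<partial>lborel) = (\<integral>\<^sup>+u. ennreal (f u) \<partial>lborel)"
proof -
  have d: "distr lborel borel (\<lambda>u. y - u) = lborel"
    using lborel_affine[of "-1" y] by (simp add: density_1)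
  show "(LINT u|lborel. f (y - u)) = (LINT u|lborel. f u)"
    using integral_distr[of "\<lambda>u. y - u" lborel borel f] assms by (simp add: d)
  show "integrable lborel (\<lambda>u. f (y - u)) \<longleftrightarrow> integrable lborel f"
    using integrable_distr_eq[of "\<lambda>u. y - u" lborel borel f] assms by (simp add: d)
  show "(\<integral>\<^sup>+u. ennreal (f (y - u)) \<partial>lborel) = (\<integral>\<^sup>+u. ennreal (f u) \<partial>lborel)"
    using nn_integral_distr[of "\<lambda>u. y - u" lborel borel "\<lambda>u. ennreal (f u)"] assms by (simp add: d)
qed

lemma conv_measure_pairing_integrable:
  fixes W \<phi> :: "plane \<Rightarrow> real"
  assumes \<nu>: "carried R \<nu>" and W: "integrable lborel W"
    and \<phi>: "\<phi> \<in> borel_measurable borel" "\<And>x. \<bar>\<phi> x\<bar> \<le> B"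
  shows "integrable (\<nu> \<Otimes>\<^sub>M lborel) (\<lambda>(y, u). W (u - y) * \<phi> u)"
proof -
  interpret \<nu>: sigma_finite_measure \<nu> by (rule carried_sigma_finite[OF \<nu>])
  interpret pair_sigma_finite \<nu> lborel ..
  have Wm[measurable]: "W \<in> borel_measurable borel" using W by auto
  have [measurable_cong]: "sets \<nu> = sets borel" using carriedD(2)[OF \<nu>] .
  have [measurable]: "\<phi> \<in> borel_measurable borel" by fact
  have iy: "integrable lborel (\<lambda>u. W (u - y) * \<phi> u)" for y
    by (rule integrable_mult_bounded[OF _ _ \<phi>(2)]) (use lborel_translate(2)[OF Wm] W in auto)
  have bd: "(LINT u|lborel. norm (W (u - y) * \<phi> u)) \<le> B * (LINT u|lborel. \<bar>W u\<bar>)" for y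
  proof -
    have "(LINT u|lborel. norm (W (u - y) * \<phi> u)) \<le> (LINT u|lborel. B * \<bar>W (u - y)\<bar>)"
    proof (rule integral_mono)
      show "integrable lborel (\<lambda>u. norm (W (u - y) * \<phi> u))" using iy by (rule integrable_norm)
      show "integrable lborel (\<lambda>u. B * \<bar>W (u - y)\<bar>)"
        using lborel_translate(2)[OF Wm, of y] W by auto
      show "norm (W (u - y) * \<phi> u) \<le> B * \<bar>W (u - y)\<bar>" for u
        using mult_left_mono[OF \<phi>(2)[of u], of "\<bar>W (u - y)\<bar>"] by (simp add: abs_mult mult.commute)
    qed
    also have "\<dots> = B * (LINT u|lborel. \<bar>W u\<bar>)"
      using lborel_translate(1)[of "\<lambda>u. \<bar>W u\<bar>" y] by simp
    finally show ?thesis .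
  qed
  show ?thesis
  proof (rule Fubini_integrable)
    show "(\<lambda>(y, u). W (u - y) * \<phi> u) \<in> borel_measurable (\<nu> \<Otimes>\<^sub>M lborel)" by measurable
    have m: "(\<lambda>y. LINT u|lborel. norm (W (u - y) * \<phi> u)) \<in> borel_measurable \<nu>" by measurable
    show "integrable \<nu> (\<lambda>y. LINT u|lborel. norm (case (y, u) of (y, u) \<Rightarrow> W (u - y) * \<phi> u))"
      unfolding prod.case
    proof (rule finite_measure.integrable_const_bound[OF carriedD(1)[OF \<nu>] _ m])
      show "AE y in \<nu>. norm (LINT u|lborel. norm (W (u - y) * \<phi> u)) \<le> B * (LINT u|lborel. \<bar>W u\<bar>)"
        using bd by simp
    qed
    show "AE y in \<nu>. integrable lborel (\<lambda>u. case (y, u) of (y, u) \<Rightarrow> W (u - y) * \<phi> u)"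
      using iy by simp
  qed
qed

text \<open>
  Fubini's theorem moves the convolution from the measure to the function it is paired with.
\<close>

lemma conv_measure_pairing:
  fixes W \<phi> :: "plane \<Rightarrow> real"
  assumes \<nu>: "carried R \<nu>" and W: "integrable lborel W"
    and \<phi>: "\<phi> \<in> borel_measurable borel" "\<And>x. \<bar>\<phi> x\<bar> \<le> B"
  shows "(LINT u|lborel. conv_measure W \<nu> u * \<phi> u) = (LINT y|\<nu>. LINT u|lborel. W (u - y) * \<phi> u)"
    and "integrable lborel (\<lambda>u. conv_measure W \<nu> u * \<phi> u)"
proof -
  interpret \<nu>: sigma_finite_measure \<nu> by (rule carried_sigma_finite[OF \<nu>])
  interpret pair_sigma_finite \<nu> lborel ..
  note i = conv_measure_pairing_integrable[OF assms]
  have e: "(LINT y|\<nu>. W (u - y) * \<phi> u) = conv_measure W \<nu> u * \<phi> u" for u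
    by (simp add: conv_measure_def)
  show "(LINT u|lborel. conv_measure W \<nu> u * \<phi> u) = (LINT y|\<nu>. LINT u|lborel. W (u - y) * \<phi> u)"
    using Fubini_integral[OF i] by (simp only: e)
  show "integrable lborel (\<lambda>u. conv_measure W \<nu> u * \<phi> u)"
    using integrable_snd[OF i] by (simp only: e)
qed

lemma conv_measure_integrable:
  fixes W :: "plane \<Rightarrow> real"
  assumes "carried R \<nu>" "integrable lborel W"
  shows "integrable lborel (conv_measure W \<nu>)"
  using conv_measure_pairing(2)[OF assms, of "\<lambda>_. 1" 1] by simp

lemma conv_eq_translate:
  assumes "W \<in> borel_measurable borel" "\<phi> \<in> borel_measurable borel"
  shows "conv W \<phi> x = (LINT u|lborel. W u * \<phi> (x - u))"
proof -
  have [measurable]: "W \<in> borel_measurable borel" "\<phi> \<in> borel_measurable borel" by fact+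
  show ?thesis unfolding conv_def
    using lborel_reflect(1)[of "\<lambda>u. W u * \<phi> (x - u)" x] by simp
qed

lemma conv_reflect:
  assumes "W \<in> borel_measurable borel" "\<phi> \<in> borel_measurable borel"
  shows "conv W (reflect \<phi>) (- y) = (LINT u|lborel. W (u - y) * \<phi> u)"
proof -
  have [measurable]: "W \<in> borel_measurable borel" "\<phi> \<in> borel_measurable borel" by fact+
  show ?thesis unfolding conv_def reflect_def
    using lborel_reflect(1)[of "\<lambda>u. W (u - y) * \<phi> u" 0] by (simp add: minus_diff_commute[of y])
qed

lemma conv_bounded_continuous:
  fixes W \<phi> :: "plane \<Rightarrow> real"
  assumes W: "integrable lborel W" and \<phi>: "continuous_on UNIV \<phi>" "\<And>x. \<bar>\<phi> x\<bar> \<le> B"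
  shows "continuous_on UNIV (conv W \<phi>)" "\<bar>conv W \<phi> x\<bar> \<le> B * (LINT u|lborel. \<bar>W u\<bar>)"
proof -
  have Wm: "W \<in> borel_measurable borel" using W by auto
  have \<phi>m[measurable]: "\<phi> \<in> borel_measurable borel" using \<phi>(1) by (rule borel_measurable_continuous_onI)
  have eq: "conv W \<phi> = (\<lambda>x. LINT u|lborel. W u * \<phi> (x - u))"
    using conv_eq_translate[OF Wm \<phi>m] by (intro ext)
  have i: "integrable lborel (\<lambda>u. W u * \<phi> (x - u))" for x
    by (rule integrable_mult_bounded[OF W _ \<phi>(2)]) measurable
  have b: "norm (W u * \<phi> (x - u)) \<le> B * \<bar>W u\<bar>" for u x
    using mult_left_mono[OF \<phi>(2)[of "x - u"], of "\<bar>W u\<bar>"] by (simp add: abs_mult mult.commute)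
  have iB: "integrable lborel (\<lambda>u. B * \<bar>W u\<bar>)" using W by auto
  have "\<bar>conv W \<phi> x\<bar> \<le> (LINT u|lborel. norm (W u * \<phi> (x - u)))"
    unfolding eq using integral_norm_bound[of lborel "\<lambda>u. W u * \<phi> (x - u)"] by simp
  also have "\<dots> \<le> (LINT u|lborel. B * \<bar>W u\<bar>)"
    by (intro integral_mono integrable_norm i iB b)
  finally show "\<bar>conv W \<phi> x\<bar> \<le> B * (LINT u|lborel. \<bar>W u\<bar>)" by simp
  show "continuous_on UNIV (conv W \<phi>)"
    unfolding continuous_on_eq_continuous_at[OF open_UNIV] eq
  proof (intro ballI continuous_at_sequentiallyI)
    fix x and xs :: "nat \<Rightarrow> plane" assume x: "xs \<longlonglongrightarrow> x"
    show "(\<lambda>n. LINT u|lborel. W u * \<phi> (xs n - u)) \<longlonglongrightarrow> (LINT u|lborel. W u * \<phi> (x - u))"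
    proof (rule integral_dominated_convergence[where w="\<lambda>u. B * \<bar>W u\<bar>"])
      show "AE u in lborel. (\<lambda>n. W u * \<phi> (xs n - u)) \<longlonglongrightarrow> W u * \<phi> (x - u)"
      proof (intro AE_I2 tendsto_mult tendsto_const)
        fix u
        have "(\<lambda>n. xs n - u) \<longlonglongrightarrow> x - u" by (intro tendsto_diff x tendsto_const)
        then show "(\<lambda>n. \<phi> (xs n - u)) \<longlonglongrightarrow> \<phi> (x - u)"
          by (rule continuous_on_tendsto_compose[OF \<phi>(1)]) auto
      qed
    qed (use i iB b in auto)
  qed
qed

text \<open>
  After Fubini, the kernels enter only through their convolutions with a fixed test function, which
  converge uniformly on the ball carrying all the measures. The limit is bounded and continuous, as
  narrow convergence requires.
\<close>

lemma pairing_tendsto: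
  assumes \<nu>: "\<And>n. carried R (\<nu> n)" "carried R \<nu>'" "narrow_conv \<nu> \<nu>'"
    and W: "\<And>n. integrable lborel (Wn n)" "integrable lborel W"
    and \<phi>: "test_function \<phi>"
    and lim: "uniform_limit (cball 0 R) (\<lambda>n. conv (Wn n) (reflect \<phi>)) (conv W (reflect \<phi>)) sequentially"
  shows "(\<lambda>n. LINT u|lborel. conv_measure (Wn n) (\<nu> n) u * \<phi> u)
            \<longlonglongrightarrow> (LINT u|lborel. conv_measure W \<nu>' u * \<phi> u)"
proof -
  have \<phi>m: "\<phi> \<in> borel_measurable borel" using test_function_measurable[OF \<phi>] .
  obtain B where B: "\<And>x. \<bar>\<phi> x\<bar> \<le> B" using test_function_bounded[OF \<phi>] by blast
  have rB: "\<bar>reflect \<phi> x\<bar> \<le> B" for x using B by (simp add: reflect_def)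
  have rc: "continuous_on UNIV (reflect \<phi>)"
    using test_function_continuous[OF test_function_reflect[OF \<phi>]] .
  define h where "h n y = conv (Wn n) (reflect \<phi>) (- y)" for n y
  define h' where "h' y = conv W (reflect \<phi>) (- y)" for y
  have hc: "continuous_on UNIV (h n)" for n unfolding h_def
    by (rule continuous_on_compose2[OF conv_bounded_continuous(1)[OF W(1) rc rB]]) (auto intro: continuous_intros)
  have hc': "continuous_on UNIV h'" unfolding h'_def
    by (rule continuous_on_compose2[OF conv_bounded_continuous(1)[OF W(2) rc rB]]) (auto intro: continuous_intros)
  have hb': "bounded (range h')" unfolding bounded_iff h'_def
    using conv_bounded_continuous(2)[OF W(2) rc rB] by auto
  have e: "(LINT u|lborel. conv_measure (Wn n) (\<nu> n) u * \<phi> u) = (LINT y|\<nu> n. h n y)" for n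
    unfolding h_def conv_reflect[OF borel_measurable_integrable[OF W(1), simplified] \<phi>m]
    by (rule conv_measure_pairing(1)[OF \<nu>(1) W(1) \<phi>m B])
  have e': "(LINT u|lborel. conv_measure W \<nu>' u * \<phi> u) = (LINT y|\<nu>'. h' y)"
    unfolding h'_def conv_reflect[OF borel_measurable_integrable[OF W(2), simplified] \<phi>m]
    by (rule conv_measure_pairing(1)[OF \<nu>(2) W(2) \<phi>m B])
  have 1: "(\<lambda>n. LINT y|\<nu> n. h' y) \<longlonglongrightarrow> (LINT y|\<nu>'. h' y)"
    using \<nu>(3) hc' hb' unfolding narrow_conv_def by blast
  have 2: "(\<lambda>n. (LINT y|\<nu> n. h n y) - (LINT y|\<nu> n. h' y)) \<longlonglongrightarrow> 0"
  proof (rule LIMSEQ_I)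
    fix r :: real assume r: "r > 0"
    define K where "K = measure \<nu>' UNIV + 1"
    have K: "K > 0" by (simp add: K_def add_nonneg_pos)
    have m: "(\<lambda>n. measure (\<nu> n) UNIV) \<longlonglongrightarrow> measure \<nu>' UNIV"
      using narrow_conv_mass[OF \<nu>(3)] carriedD(3)[OF \<nu>(1)] carriedD(3)[OF \<nu>(2)] by simp
    have "\<forall>\<^sub>F n in sequentially. \<forall>z\<in>cball 0 R. dist (conv (Wn n) (reflect \<phi>) z) (conv W (reflect \<phi>) z) < r / (2 * K)"
      using lim r K unfolding uniform_limit_iff by simp
    moreover have "\<forall>\<^sub>F n in sequentially. measure (\<nu> n) UNIV < K"
      using m by (rule order_tendstoD) (simp add: K_def)
    ultimately have "\<forall>\<^sub>F n in sequentially. norm ((LINT y|\<nu> n. h n y) - (LINT y|\<nu> n. h' y) - 0) < r"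
    proof eventually_elim
      case (elim n)
      have "AE y in \<nu> n. \<bar>h n y - h' y\<bar> \<le> r / (2 * K)"
        using carriedD(4)[OF \<nu>(1)[of n]]
      proof eventually_elim
        case (elim y)
        then have "- y \<in> cball 0 R" by simp
        then show ?case using \<open>\<forall>z\<in>cball 0 R. _\<close> unfolding h_def h'_def dist_real_def by (auto intro: less_imp_le)
      qed
      then have "\<bar>LINT y|\<nu> n. h n y - h' y\<bar> \<le> r / (2 * K) * measure (\<nu> n) UNIV"
        using integral_abs_le_mass[OF carriedD(1)[OF \<nu>(1)[of n]], of "\<lambda>y. h n y - h' y" "r / (2 * K)"] r K
          carriedD(3)[OF \<nu>(1)] by simp
      also have "\<dots> \<le> r / (2 * K) * K" using elim(2) r K by (intro mult_left_mono) auto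
      also have "\<dots> < r" using r K by simp
      finally show ?case
        using carried_integrable_continuous[OF \<nu>(1) hc, of n n] carried_integrable_continuous[OF \<nu>(1) hc', of n] by simp
    qed
    then show "\<exists>no. \<forall>n\<ge>no. norm ((LINT y|\<nu> n. h n y) - (LINT y|\<nu> n. h' y) - 0) < r"
      by (simp add: eventually_sequentially)
  qed
  have "(\<lambda>n. ((LINT y|\<nu> n. h n y) - (LINT y|\<nu> n. h' y)) + (LINT y|\<nu> n. h' y)) \<longlonglongrightarrow> 0 + (LINT y|\<nu>'. h' y)"
    by (intro tendsto_add 1 2)
  then show ?thesis unfolding e e' by simp
qed

lemma ereal_liminf_sum:
  fixes f :: "'i \<Rightarrow> nat \<Rightarrow> ereal"
  assumes "finite I" "\<And>i n. i \<in> I \<Longrightarrow> f i n \<ge> 0"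
  shows "(\<Sum>i\<in>I. liminf (f i)) \<le> liminf (\<lambda>n. \<Sum>i\<in>I. f i n)"
  using assms
proof (induction I rule: finite_induct)
  case (insert i I)
  have n: "liminf (f i) \<ge> 0" "liminf (\<lambda>n. \<Sum>i\<in>I. f i n) \<ge> 0"
    using insert.prems by (auto intro!: Liminf_bounded always_eventually sum_nonneg)
  have "(\<Sum>i\<in>insert i I. liminf (f i)) \<le> liminf (f i) + liminf (\<lambda>n. \<Sum>i\<in>I. f i n)"
    using insert by (auto intro!: add_left_mono)
  also have "\<dots> \<le> liminf (\<lambda>n. f i n + (\<Sum>i\<in>I. f i n))"
    by (rule ereal_liminf_add_mono) (use n in auto)
  finally show ?case using insert by simp
qed (simp add: Liminf_const)

text \<open>
  For a fixed test function the functional in the dual formula converges along the sequence, and the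
  supremum over test functions can only drop in the limit. Besides the lower bound of the
  \<open>\<Gamma>\<close>-limit, the case of constant kernels serves to remove an averaging of measures.
\<close>

lemma energy_liminf:
  fixes \<nu> :: "nat \<Rightarrow> nat \<Rightarrow> plane measure"
  assumes \<nu>: "\<And>n s. s \<in> {1..S} \<Longrightarrow> carried R (\<nu> n s)" "\<And>s. s \<in> {1..S} \<Longrightarrow> carried R (\<mu> s)"
      "\<And>s. s \<in> {1..S} \<Longrightarrow> narrow_conv (\<lambda>n. \<nu> n s) (\<mu> s)"
    and V: "\<And>s t. s \<in> {1..S} \<Longrightarrow> t \<in> {1..S} \<Longrightarrow> continuous_on UNIV (Vr s t)"
      "\<And>n s t. s \<in> {1..S} \<Longrightarrow> t \<in> {1..S} \<Longrightarrow> Vrn n s t \<in> borel_measurable borel"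
      "\<And>s t. s \<in> {1..S} \<Longrightarrow> t \<in> {1..S} \<Longrightarrow> uniform_limit (cball 0 (2 * R)) (\<lambda>n. Vrn n s t) (Vr s t) sequentially"
    and W: "\<And>n k s. k \<in> {1..K} \<Longrightarrow> s \<in> {1..S} \<Longrightarrow> integrable lborel (Wn n k s)"
      "\<And>k s. k \<in> {1..K} \<Longrightarrow> s \<in> {1..S} \<Longrightarrow> integrable lborel (W k s)"
      "\<And>k s \<phi>. k \<in> {1..K} \<Longrightarrow> s \<in> {1..S} \<Longrightarrow> test_function \<phi> \<Longrightarrow>
         uniform_limit (cball 0 R) (\<lambda>n. conv (Wn n k s) \<phi>) (conv (W k s) \<phi>) sequentially"
  shows "energy S K Vr W \<mu> \<le> liminf (\<lambda>n. energy S K (Vrn n) (Wn n) (\<nu> n))"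
proof -
  define r where "r n = (\<Sum>s=1..S. \<Sum>t=1..S. LINT x|\<nu> n s. conv_measure (Vrn n s t) (\<nu> n t) x)" for n
  define r' where "r' = (\<Sum>s=1..S. \<Sum>t=1..S. LINT x|\<mu> s. conv_measure (Vr s t) (\<mu> t) x)"
  define F where "F n k u = (\<Sum>s=1..S. conv_measure (Wn n k s) (\<nu> n s) u)" for n k u
  define F' where "F' k u = (\<Sum>s=1..S. conv_measure (W k s) (\<mu> s) u)" for k u
  have "r \<longlonglongrightarrow> r'" unfolding r_def r'_def conv_measure_def
    by (intro tendsto_sum narrow_conv_pair[where R = R] \<nu> V)
  then have rl: "liminf (\<lambda>n. ereal (r n)) = ereal r'"
    by (intro lim_imp_Liminf) auto
  have Fi: "integrable lborel (F n k)" if "k \<in> {1..K}" for n k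
    unfolding F_def using that by (intro Bochner_Integration.integrable_sum conv_measure_integrable[OF \<nu>(1) W(1)]) auto
  have Fi': "integrable lborel (F' k)" if "k \<in> {1..K}" for k
    unfolding F'_def using that by (intro Bochner_Integration.integrable_sum conv_measure_integrable[OF \<nu>(2) W(2)]) auto
  have main: "(L2_norm (F' k))\<^sup>2 \<le> liminf (\<lambda>n. (L2_norm (F n k))\<^sup>2)" if k: "k \<in> {1..K}" for k
  proof (rule L2_norm_sq_le_if_test_le[OF Fi'[OF k]])
    fix \<phi> :: "plane \<Rightarrow> real" assume \<phi>: "test_function \<phi>"
    obtain B where B: "\<And>x. \<bar>\<phi> x\<bar> \<le> B" using test_function_bounded[OF \<phi>] by blast
    note \<phi>m = test_function_measurable[OF \<phi>]
    have eF: "(LINT u|lborel. F n k u * \<phi> u) = (\<Sum>s=1..S. LINT u|lborel. conv_measure (Wn n k s) (\<nu> n s) u * \<phi> u)" for n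
      unfolding F_def sum_distrib_right
      by (intro Bochner_Integration.integral_sum conv_measure_pairing(2)[OF \<nu>(1) W(1)[OF k] \<phi>m B]) auto
    have eF': "(LINT u|lborel. F' k u * \<phi> u) = (\<Sum>s=1..S. LINT u|lborel. conv_measure (W k s) (\<mu> s) u * \<phi> u)"
      unfolding F'_def sum_distrib_right
      by (intro Bochner_Integration.integral_sum conv_measure_pairing(2)[OF \<nu>(2) W(2)[OF k] \<phi>m B]) auto
    have "(\<lambda>n. LINT u|lborel. F n k u * \<phi> u) \<longlonglongrightarrow> (LINT u|lborel. F' k u * \<phi> u)"
      unfolding eF eF'
      by (intro tendsto_sum pairing_tendsto[where R = R] \<nu> W k \<phi> test_function_reflect)
    then have "(\<lambda>n. ereal (2 * (LINT u|lborel. F n k u * \<phi> u) - (LINT x|lborel. (\<phi> x)\<^sup>2)))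
        \<longlonglongrightarrow> ereal (2 * (LINT u|lborel. F' k u * \<phi> u) - (LINT x|lborel. (\<phi> x)\<^sup>2))"
      by (intro tendsto_intros)
    then have "ereal (2 * (LINT u|lborel. F' k u * \<phi> u) - (LINT x|lborel. (\<phi> x)\<^sup>2))
       = liminf (\<lambda>n. ereal (2 * (LINT u|lborel. F n k u * \<phi> u) - (LINT x|lborel. (\<phi> x)\<^sup>2)))"
      by (intro lim_imp_Liminf[symmetric]) auto
    also have "\<dots> \<le> liminf (\<lambda>n. (L2_norm (F n k))\<^sup>2)"
      by (intro Liminf_mono always_eventually allI L2_norm_sq_ge_test Fi k \<phi>)
    finally show "ereal (2 * (LINT u|lborel. F' k u * \<phi> u) - (LINT x|lborel. (\<phi> x)\<^sup>2)) \<le> liminf (\<lambda>n. (L2_norm (F n k))\<^sup>2)" .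
  qed
  have nn: "(L2_norm f)\<^sup>2 \<ge> 0" for f by (simp add: L2_norm_sq integral_nonneg_AE)
  have "energy S K Vr W \<mu> = ereal r' + (\<Sum>k=1..K. (L2_norm (F' k))\<^sup>2)"
    by (simp add: energy_def r'_def F'_def[abs_def])
  also have "\<dots> \<le> liminf (\<lambda>n. ereal (r n)) + (\<Sum>k=1..K. liminf (\<lambda>n. (L2_norm (F n k))\<^sup>2))"
    unfolding rl by (intro add_left_mono sum_mono main)
  also have "\<dots> \<le> liminf (\<lambda>n. ereal (r n)) + liminf (\<lambda>n. \<Sum>k=1..K. (L2_norm (F n k))\<^sup>2)"
    by (intro add_left_mono ereal_liminf_sum nn) auto
  also have "\<dots> \<le> liminf (\<lambda>n. ereal (r n) + (\<Sum>k=1..K. (L2_norm (F n k))\<^sup>2))"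
    by (rule ereal_liminf_add_mono) (simp add: rl)
  also have "\<dots> = liminf (\<lambda>n. energy S K (Vrn n) (Wn n) (\<nu> n))"
    by (simp add: energy_def r_def F_def[abs_def])
  finally show ?thesis .
qed

section \<open>The energy as a double integral\<close>

text \<open>
  Measures with Lebesgue density at most \<open>c\<close>; comparing the measures of sets avoids the choice of
  a density.
\<close>

definition dominated :: "real \<Rightarrow> plane measure \<Rightarrow> bool" where
  "dominated c \<nu> \<longleftrightarrow> c \<ge> 0 \<and> (\<forall>A\<in>sets borel. emeasure \<nu> A \<le> ennreal c * emeasure lborel A)"

lemma dominated_nn_integral:
  assumes "dominated c \<nu>" "carried R \<nu>" "f \<in> borel_measurable borel"
  shows "(\<integral>\<^sup>+x. f x \<partial>\<nu>) \<le> ennreal c * (\<integral>\<^sup>+x. f x \<partial>lborel)"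
proof -
  have s: "sets \<nu> = sets (scale_measure (ennreal c) lborel)" using carriedD(2)[OF assms(2)] by simp
  have "\<nu> \<le> scale_measure (ennreal c) lborel"
    unfolding le_measure[OF s] using assms(1) carriedD(2)[OF assms(2)] by (auto simp: dominated_def)
  from nn_integral_mono_measure[OF s this, of f] show ?thesis
    using assms(3) by (simp add: nn_integral_scale_measure)
qed

lemma dominated_AE:
  assumes "dominated c \<nu>" "carried R \<nu>" "AE x in lborel. P x"
  shows "AE x in \<nu>. P x"
proof -
  obtain N where N: "{x \<in> space lborel. \<not> P x} \<subseteq> N" "emeasure lborel N = 0" "N \<in> sets lborel"
    using assms(3) by (rule AE_E)
  have "emeasure \<nu> N \<le> ennreal c * emeasure lborel N"
    using assms(1) N(3) by (auto simp: dominated_def)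
  then have "N \<in> null_sets \<nu>" using N carriedD(2)[OF assms(2)] by (auto simp: null_sets_def)
  then show ?thesis by (rule AE_I') (use N(1) carriedD(3)[OF assms(2)] in auto)
qed

lemma dominated_integrable:
  fixes f :: "plane \<Rightarrow> real"
  assumes "dominated c \<nu>" "carried R \<nu>" "integrable lborel f"
  shows "integrable \<nu> f" "\<bar>LINT x|\<nu>. f x\<bar> \<le> c * (LINT x|lborel. \<bar>f x\<bar>)"
proof -
  have c: "c \<ge> 0" using assms(1) by (simp add: dominated_def)
  have fm: "f \<in> borel_measurable borel" using assms(3) by auto
  then have fn: "(\<lambda>x. ennreal \<bar>f x\<bar>) \<in> borel_measurable borel" by measurable
  have b: "(\<integral>\<^sup>+x. ennreal \<bar>f x\<bar> \<partial>\<nu>) \<le> ennreal (c * (LINT x|lborel. \<bar>f x\<bar>))"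
  proof -
    have "(\<integral>\<^sup>+x. ennreal \<bar>f x\<bar> \<partial>\<nu>) \<le> ennreal c * (\<integral>\<^sup>+x. ennreal \<bar>f x\<bar> \<partial>lborel)"
      by (rule dominated_nn_integral[OF assms(1,2) fn])
    also have "(\<integral>\<^sup>+x. ennreal \<bar>f x\<bar> \<partial>lborel) = ennreal (LINT x|lborel. \<bar>f x\<bar>)"
      using assms(3) by (intro nn_integral_eq_integral) auto
    finally show ?thesis using c by (simp add: ennreal_mult)
  qed
  show i: "integrable \<nu> f"
  proof (rule integrableI_bounded)
    show "f \<in> borel_measurable \<nu>" using fm by (simp add: carried_measurable[OF assms(2)])
    have "(\<integral>\<^sup>+x. ennreal (norm (f x)) \<partial>\<nu>) \<le> ennreal (c * (LINT x|lborel. \<bar>f x\<bar>))" using b by simp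
    also have "\<dots> < \<infinity>" by simp
    finally show "(\<integral>\<^sup>+x. ennreal (norm (f x)) \<partial>\<nu>) < \<infinity>" .
  qed
  have "ennreal (LINT x|\<nu>. \<bar>f x\<bar>) \<le> ennreal (c * (LINT x|lborel. \<bar>f x\<bar>))"
    using b nn_integral_eq_integral[of \<nu> "\<lambda>x. \<bar>f x\<bar>"] i by auto
  then have "(LINT x|\<nu>. \<bar>f x\<bar>) \<le> c * (LINT x|lborel. \<bar>f x\<bar>)"
    using c by (subst (asm) ennreal_le_iff) (auto intro!: mult_nonneg_nonneg integral_nonneg_AE)
  then show "\<bar>LINT x|\<nu>. f x\<bar> \<le> c * (LINT x|lborel. \<bar>f x\<bar>)"
    using integral_norm_bound[of \<nu> f] unfolding real_norm_def by linarith
qed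

lemma dominated_reflect_integrable:
  fixes W :: "plane \<Rightarrow> real"
  assumes "dominated c \<nu>" "carried R \<nu>" "integrable lborel W"
  shows "integrable \<nu> (\<lambda>y. W (u - y))" "\<bar>conv_measure W \<nu> u\<bar> \<le> c * (LINT x|lborel. \<bar>W x\<bar>)"
proof -
  have Wm: "W \<in> borel_measurable borel" using assms(3) by auto
  have i: "integrable lborel (\<lambda>y. W (u - y))" using lborel_reflect(2)[OF Wm] assms(3) by simp
  show "integrable \<nu> (\<lambda>y. W (u - y))" by (rule dominated_integrable(1)[OF assms(1,2) i])
  have "(LINT y|lborel. \<bar>W (u - y)\<bar>) = (LINT x|lborel. \<bar>W x\<bar>)"
    using lborel_reflect(1)[of "\<lambda>x. \<bar>W x\<bar>" u] Wm by simp
  then show "\<bar>conv_measure W \<nu> u\<bar> \<le> c * (LINT x|lborel. \<bar>W x\<bar>)"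
    using dominated_integrable(2)[OF assms(1,2) i] by (simp add: conv_measure_def)
qed

lemma conv_borel_measurable:
  assumes [measurable]: "f \<in> borel_measurable borel" "g \<in> borel_measurable borel"
  shows "conv f g \<in> borel_measurable borel"
  unfolding conv_def[abs_def] by measurable

lemma reflect_measurable:
  assumes [measurable]: "f \<in> borel_measurable borel"
  shows "reflect f \<in> borel_measurable borel"
  unfolding reflect_def[abs_def] by measurable

lemma autocorrelation_eq:
  assumes "Ws \<in> borel_measurable borel" "Wt \<in> borel_measurable borel"
  shows "conv (reflect Ws) Wt (x - y) = (LINT u|lborel. Wt (u - y) * Ws (u - x))"
proof -
  have [measurable]: "Ws \<in> borel_measurable borel" "Wt \<in> borel_measurable borel" by fact+
  have "(LINT u|lborel. Wt (u - y) * Ws (u - x)) = (LINT z|lborel. Ws (z + y - x) * Wt z)"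
    using lborel_translate(1)[of "\<lambda>z. Ws (z + y - x) * Wt z" y] by (simp add: mult.commute)
  also have "\<dots> = conv (reflect Ws) Wt (x - y)"
    unfolding conv_def reflect_def by (simp add: algebra_simps)
  finally show ?thesis ..
qed

text \<open>
  Fubini's theorem, twice. The bound on the density makes \<open>Wt * \<nu>t\<close> a bounded function, and this gives
  absolute convergence although the kernels are merely integrable.
\<close>

lemma autocorrelation_pairing:
  fixes Ws Wt :: "plane \<Rightarrow> real"
  assumes \<nu>s: "carried R \<nu>s" and \<nu>t: "carried R \<nu>t" "dominated c \<nu>t"
    and W: "integrable lborel Ws" "integrable lborel Wt"
  shows "integrable \<nu>t (\<lambda>y. conv (reflect Ws) Wt (x - y))"
    "integrable \<nu>s (\<lambda>x. LINT y|\<nu>t. conv (reflect Ws) Wt (x - y))"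
    "(LINT x|\<nu>s. LINT y|\<nu>t. conv (reflect Ws) Wt (x - y))
       = (LINT u|lborel. conv_measure Ws \<nu>s u * conv_measure Wt \<nu>t u)"
proof -
  have [measurable]: "Ws \<in> borel_measurable borel" "Wt \<in> borel_measurable borel" using W by auto
  have [measurable_cong]: "sets \<nu>t = sets borel" using carriedD(2)[OF \<nu>t(1)] .
  interpret \<nu>t: sigma_finite_measure \<nu>t by (rule carried_sigma_finite[OF \<nu>t(1)])
  interpret pair_sigma_finite \<nu>t lborel ..
  define g where "g = conv_measure Wt \<nu>t"
  have gm: "g \<in> borel_measurable borel" unfolding g_def by (rule conv_measure_measurable[OF \<nu>t(1)]) measurable
  have gb: "\<bar>g u\<bar> \<le> c * (LINT x|lborel. \<bar>Wt x\<bar>)" for u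
    unfolding g_def by (rule dominated_reflect_integrable(2)[OF \<nu>t(2,1) W(2)])
  have c: "c \<ge> 0" using \<nu>t(2) by (simp add: dominated_def)
  have i: "integrable (\<nu>t \<Otimes>\<^sub>M lborel) (\<lambda>(y, u). Wt (u - y) * Ws (u - x))" for x
  proof (rule integrableI_bounded)
    show "(\<lambda>(y, u). Wt (u - y) * Ws (u - x)) \<in> borel_measurable (\<nu>t \<Otimes>\<^sub>M lborel)" by measurable
    have "(\<integral>\<^sup>+z. ennreal (norm (case z of (y, u) \<Rightarrow> Wt (u - y) * Ws (u - x))) \<partial>(\<nu>t \<Otimes>\<^sub>M lborel))
        = (\<integral>\<^sup>+u. \<integral>\<^sup>+y. ennreal (norm (case (y, u) of (y, u) \<Rightarrow> Wt (u - y) * Ws (u - x))) \<partial>\<nu>t \<partial>lborel)"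
      by (rule nn_integral_snd[symmetric]) measurable
    also have "\<dots> \<le> (\<integral>\<^sup>+u. ennreal (c * (LINT x|lborel. \<bar>Wt x\<bar>)) * ennreal \<bar>Ws (u - x)\<bar> \<partial>lborel)"
    proof (rule nn_integral_mono)
      fix u
      have "(\<integral>\<^sup>+y. ennreal (norm (case (y, u) of (y, u) \<Rightarrow> Wt (u - y) * Ws (u - x))) \<partial>\<nu>t)
          = (\<integral>\<^sup>+y. ennreal \<bar>Wt (u - y)\<bar> * ennreal \<bar>Ws (u - x)\<bar> \<partial>\<nu>t)"
        by (simp add: abs_mult ennreal_mult)
      also have "\<dots> = (\<integral>\<^sup>+y. ennreal \<bar>Wt (u - y)\<bar> \<partial>\<nu>t) * ennreal \<bar>Ws (u - x)\<bar>"
        by (rule nn_integral_multc) measurable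
      also have "(\<integral>\<^sup>+y. ennreal \<bar>Wt (u - y)\<bar> \<partial>\<nu>t) \<le> ennreal c * (\<integral>\<^sup>+y. ennreal \<bar>Wt (u - y)\<bar> \<partial>lborel)"
        by (rule dominated_nn_integral[OF \<nu>t(2,1)]) measurable
      also have "(\<integral>\<^sup>+y. ennreal \<bar>Wt (u - y)\<bar> \<partial>lborel) = (\<integral>\<^sup>+y. ennreal \<bar>Wt y\<bar> \<partial>lborel)"
        by (rule lborel_reflect(3)) measurable
      also have "\<dots> = ennreal (LINT x|lborel. \<bar>Wt x\<bar>)"
        using W(2) by (intro nn_integral_eq_integral) auto
      finally show "(\<integral>\<^sup>+y. ennreal (norm (case (y, u) of (y, u) \<Rightarrow> Wt (u - y) * Ws (u - x))) \<partial>\<nu>t)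
         \<le> ennreal (c * (LINT x|lborel. \<bar>Wt x\<bar>)) * ennreal \<bar>Ws (u - x)\<bar>"
        using c by (simp add: ennreal_mult mult_right_mono)
    qed
    also have "\<dots> = ennreal (c * (LINT x|lborel. \<bar>Wt x\<bar>)) * (\<integral>\<^sup>+u. ennreal \<bar>Ws (u - x)\<bar> \<partial>lborel)"
      by (rule nn_integral_cmult) measurable
    also have "(\<integral>\<^sup>+u. ennreal \<bar>Ws (u - x)\<bar> \<partial>lborel) = (\<integral>\<^sup>+u. ennreal \<bar>Ws u\<bar> \<partial>lborel)"
      by (rule lborel_translate(3)) measurable
    also have "\<dots> = ennreal (LINT x|lborel. \<bar>Ws x\<bar>)"
      using W(1) by (intro nn_integral_eq_integral) auto
    also have "ennreal (c * (LINT x|lborel. \<bar>Wt x\<bar>)) * ennreal (LINT x|lborel. \<bar>Ws x\<bar>) < \<infinity>"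
      by (simp add: ennreal_mult_less_top)
    finally show "(\<integral>\<^sup>+z. ennreal (norm (case z of (y, u) \<Rightarrow> Wt (u - y) * Ws (u - x))) \<partial>(\<nu>t \<Otimes>\<^sub>M lborel)) < \<infinity>" .
  qed
  have ac: "conv (reflect Ws) Wt (x - y) = (LINT u|lborel. Wt (u - y) * Ws (u - x))" for x y
    by (rule autocorrelation_eq) measurable
  show "integrable \<nu>t (\<lambda>y. conv (reflect Ws) Wt (x - y))"
    unfolding ac by (rule integrable_fst[OF i])
  have inner: "(LINT y|\<nu>t. conv (reflect Ws) Wt (x - y)) = (LINT u|lborel. Ws (u - x) * g u)" for x
    unfolding ac using Fubini_integral[OF i[of x]] unfolding g_def conv_measure_def
    by (simp add: mult.commute)
  interpret \<nu>s: sigma_finite_measure \<nu>s by (rule carried_sigma_finite[OF \<nu>s])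
  interpret Q: pair_sigma_finite \<nu>s lborel ..
  show "integrable \<nu>s (\<lambda>x. LINT y|\<nu>t. conv (reflect Ws) Wt (x - y))"
    unfolding inner by (rule Q.integrable_fst[OF conv_measure_pairing_integrable[OF \<nu>s W(1) gm gb]])
  show "(LINT x|\<nu>s. LINT y|\<nu>t. conv (reflect Ws) Wt (x - y))
       = (LINT u|lborel. conv_measure Ws \<nu>s u * conv_measure Wt \<nu>t u)"
    unfolding inner by (subst conv_measure_pairing(1)[OF \<nu>s W(1) gm gb, symmetric]) (simp add: g_def)
qed

text \<open>
  For atomic measures the double integral includes the diagonal, with the values \<open>V s s 0\<close>.
\<close>

definition interaction :: "nat \<Rightarrow> (nat \<Rightarrow> nat \<Rightarrow> plane \<Rightarrow> real) \<Rightarrow> (nat \<Rightarrow> plane measure) \<Rightarrow> real" where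
  "interaction S V \<nu> = (\<Sum>s=1..S. \<Sum>t=1..S. LINT x|\<nu> s. LINT y|\<nu> t. V s t (x - y))"

lemma AE_lborel_reflect:
  assumes "AE z in lborel. P (z :: plane)"
  shows "AE y in lborel. P (x - y)"
proof -
  have d: "distr lborel borel (\<lambda>u. x - u) = lborel"
    using lborel_affine[of "-1" x] by (simp add: density_1)
  have "AE z in distr lborel borel (\<lambda>u. x - u). P z" unfolding d by (rule assms)
  then show ?thesis by (rule AE_distrD[rotated]) simp
qed

lemma L2_norm_sum_sq:
  fixes A :: "nat \<Rightarrow> plane \<Rightarrow> real"
  assumes A: "\<And>s. s \<in> I \<Longrightarrow> integrable lborel (A s)" "\<And>s u. s \<in> I \<Longrightarrow> \<bar>A s u\<bar> \<le> B s"
  shows "(L2_norm (\<lambda>u. \<Sum>s\<in>I. A s u))\<^sup>2 = ereal (\<Sum>s\<in>I. \<Sum>t\<in>I. LINT u|lborel. A s u * A t u)"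
proof -
  have i: "integrable lborel (\<lambda>u. A s u * A t u)" if "s \<in> I" "t \<in> I" for s t
    by (rule integrable_mult_bounded[OF A(1)[OF that(1)] _ A(2)[OF that(2)]]) (use A(1)[OF that(2)] in auto)
  have e: "(\<Sum>s\<in>I. A s u)\<^sup>2 = (\<Sum>s\<in>I. \<Sum>t\<in>I. A s u * A t u)" for u
    by (simp add: power2_eq_square sum_product)
  have m: "(\<lambda>u. \<Sum>s\<in>I. A s u) \<in> borel_measurable borel"
    using A(1) by (intro borel_measurable_sum) auto
  have "integrable lborel (\<lambda>u. (\<Sum>s\<in>I. A s u)\<^sup>2)" unfolding e
    by (intro Bochner_Integration.integrable_sum i)
  moreover have "(LINT u|lborel. (\<Sum>s\<in>I. A s u)\<^sup>2) = (\<Sum>s\<in>I. \<Sum>t\<in>I. LINT u|lborel. A s u * A t u)"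
    unfolding e using i by (simp add: Bochner_Integration.integral_sum Bochner_Integration.integrable_sum)
  ultimately show ?thesis using m by (simp add: L2_norm_sq)
qed

text \<open>
  The decomposition of the potential holds only almost everywhere, which measures with a bounded
  density cannot see. Expanding the squared norm then gives the double sum over the species.
\<close>

lemma energy_eq_interaction:
  fixes \<nu> :: "nat \<Rightarrow> plane measure"
  assumes \<nu>: "\<And>s. s \<in> {1..S} \<Longrightarrow> carried R (\<nu> s)" "\<And>s. s \<in> {1..S} \<Longrightarrow> dominated c (\<nu> s)"
    and V: "\<And>s t. s \<in> {1..S} \<Longrightarrow> t \<in> {1..S} \<Longrightarrow> V s t \<in> borel_measurable borel"
      "\<And>s t. s \<in> {1..S} \<Longrightarrow> t \<in> {1..S} \<Longrightarrow>
         AE x in lborel. V s t x = (\<Sum>k=1..K. conv (reflect (W k s)) (W k t) x) + Vr s t x"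
      "\<And>s t. s \<in> {1..S} \<Longrightarrow> t \<in> {1..S} \<Longrightarrow> continuous_on UNIV (Vr s t)"
    and W: "\<And>k s. k \<in> {1..K} \<Longrightarrow> s \<in> {1..S} \<Longrightarrow> integrable lborel (W k s)"
  shows "energy S K Vr W \<nu> = ereal (interaction S V \<nu>)"
proof -
  have Wm: "W k s \<in> borel_measurable borel" if "k \<in> {1..K}" "s \<in> {1..S}" for k s
    using W[OF that] by auto
  have Vrm: "Vr s t \<in> borel_measurable borel" if "s \<in> {1..S}" "t \<in> {1..S}" for s t
    using V(3)[OF that] by (rule borel_measurable_continuous_onI)
  let ?C = "\<lambda>k s t. conv (reflect (W k s)) (W k t)"
  have Cm: "?C k s t \<in> borel_measurable borel" if "k \<in> {1..K}" "s \<in> {1..S}" "t \<in> {1..S}" for k s t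
    using that by (intro conv_borel_measurable reflect_measurable Wm)
  have st: "(LINT x|\<nu> s. LINT y|\<nu> t. V s t (x - y)) =
      (\<Sum>k=1..K. LINT u|lborel. conv_measure (W k s) (\<nu> s) u * conv_measure (W k t) (\<nu> t) u)
      + (LINT x|\<nu> s. conv_measure (Vr s t) (\<nu> t) x)"
    if s: "s \<in> {1..S}" and t: "t \<in> {1..S}" for s t
  proof -
    note P = autocorrelation_pairing[OF \<nu>(1)[OF s] \<nu>(1)[OF t] \<nu>(2)[OF t] W[OF _ s] W[OF _ t]]
    have msh: "(\<lambda>y. f (x - y)) \<in> borel_measurable (\<nu> t)" if "f \<in> borel_measurable borel" for f :: "plane \<Rightarrow> real" and x
      using that unfolding carried_measurable[OF \<nu>(1)[OF t]] by measurable
    have Vri: "integrable (\<nu> t) (\<lambda>y. Vr s t (x - y))" for x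
      by (intro carried_integrable_continuous[OF \<nu>(1)[OF t]] continuous_on_compose2[OF V(3)[OF s t]])
         (auto intro: continuous_intros)
    have Vro: "integrable (\<nu> s) (\<lambda>x. LINT y|\<nu> t. Vr s t (x - y))"
      by (rule continuous_pair_integrable(1)[OF \<nu>(1)[OF s] \<nu>(1)[OF t] V(3)[OF s t]])
    have inner: "(LINT y|\<nu> t. V s t (x - y)) =
       (\<Sum>k=1..K. LINT y|\<nu> t. ?C k s t (x - y)) + (LINT y|\<nu> t. Vr s t (x - y))" for x
    proof -
      have "(LINT y|\<nu> t. V s t (x - y)) = (LINT y|\<nu> t. (\<Sum>k=1..K. ?C k s t (x - y)) + Vr s t (x - y))"
      proof (rule integral_cong_AE)
        show "(\<lambda>y. V s t (x - y)) \<in> borel_measurable (\<nu> t)" by (rule msh[OF V(1)[OF s t]])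
        show "(\<lambda>y. (\<Sum>k=1..K. ?C k s t (x - y)) + Vr s t (x - y)) \<in> borel_measurable (\<nu> t)"
          by (intro borel_measurable_add borel_measurable_sum msh Cm Vrm s t) auto
        show "AE y in \<nu> t. V s t (x - y) = (\<Sum>k=1..K. ?C k s t (x - y)) + Vr s t (x - y)"
          by (rule dominated_AE[OF \<nu>(2)[OF t] \<nu>(1)[OF t] AE_lborel_reflect[OF V(2)[OF s t]]])
      qed
      also have "\<dots> = (\<Sum>k=1..K. LINT y|\<nu> t. ?C k s t (x - y)) + (LINT y|\<nu> t. Vr s t (x - y))"
        by (subst Bochner_Integration.integral_add)
           (auto intro!: Bochner_Integration.integrable_sum Bochner_Integration.integral_sum P(1) Vri)
      finally show ?thesis .
    qed
    have "(LINT x|\<nu> s. LINT y|\<nu> t. V s t (x - y)) =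
       (\<Sum>k=1..K. LINT x|\<nu> s. LINT y|\<nu> t. ?C k s t (x - y)) + (LINT x|\<nu> s. LINT y|\<nu> t. Vr s t (x - y))"
      unfolding inner
      by (subst Bochner_Integration.integral_add)
         (auto intro!: Bochner_Integration.integrable_sum Bochner_Integration.integral_sum P(2) Vro)
    also have "(\<Sum>k=1..K. LINT x|\<nu> s. LINT y|\<nu> t. ?C k s t (x - y)) =
        (\<Sum>k=1..K. LINT u|lborel. conv_measure (W k s) (\<nu> s) u * conv_measure (W k t) (\<nu> t) u)"
      by (intro sum.cong refl P(3))
    finally show ?thesis by (simp add: conv_measure_def)
  qed
  have L2: "(L2_norm (\<lambda>x. \<Sum>s=1..S. conv_measure (W k s) (\<nu> s) x))\<^sup>2 =
      ereal (\<Sum>s=1..S. \<Sum>t=1..S. LINT u|lborel. conv_measure (W k s) (\<nu> s) u * conv_measure (W k t) (\<nu> t) u)"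
    if "k \<in> {1..K}" for k
    using that by (intro L2_norm_sum_sq[where B = "\<lambda>s. c * (LINT x|lborel. \<bar>W k s x\<bar>)"]
        conv_measure_integrable[OF \<nu>(1) W] dominated_reflect_integrable(2)[OF \<nu>(2) \<nu>(1) W])
  have "interaction S V \<nu> = (\<Sum>s=1..S. \<Sum>t=1..S.
      (\<Sum>k=1..K. LINT u|lborel. conv_measure (W k s) (\<nu> s) u * conv_measure (W k t) (\<nu> t) u)
      + (LINT x|\<nu> s. conv_measure (Vr s t) (\<nu> t) x))"
    unfolding interaction_def by (intro sum.cong refl st)
  also have "\<dots> = (\<Sum>s=1..S. \<Sum>t=1..S. LINT x|\<nu> s. conv_measure (Vr s t) (\<nu> t) x) +
      (\<Sum>s=1..S. \<Sum>t=1..S. \<Sum>k=1..K. LINT u|lborel. conv_measure (W k s) (\<nu> s) u * conv_measure (W k t) (\<nu> t) u)"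
    by (simp add: sum.distrib add.commute)
  also have "(\<Sum>s=1..S. \<Sum>t=1..S. \<Sum>k=1..K. LINT u|lborel. conv_measure (W k s) (\<nu> s) u * conv_measure (W k t) (\<nu> t) u)
     = (\<Sum>k=1..K. \<Sum>s=1..S. \<Sum>t=1..S. LINT u|lborel. conv_measure (W k s) (\<nu> s) u * conv_measure (W k t) (\<nu> t) u)"
    by (rule trans[OF sum.cong[OF refl sum.swap] sum.swap])
  finally have "ereal (interaction S V \<nu>) = ereal (\<Sum>s=1..S. \<Sum>t=1..S. LINT x|\<nu> s. conv_measure (Vr s t) (\<nu> t) x) +
     ereal (\<Sum>k=1..K. \<Sum>s=1..S. \<Sum>t=1..S. LINT u|lborel. conv_measure (W k s) (\<nu> s) u * conv_measure (W k t) (\<nu> t) u)"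
    by simp
  also have "ereal (\<Sum>k=1..K. \<Sum>s=1..S. \<Sum>t=1..S. LINT u|lborel. conv_measure (W k s) (\<nu> s) u * conv_measure (W k t) (\<nu> t) u)
     = (\<Sum>k=1..K. (L2_norm (\<lambda>x. \<Sum>s=1..S. conv_measure (W k s) (\<nu> s) x))\<^sup>2)"
    by (rule trans[OF sum_ereal[symmetric] sum.cong[OF refl L2[symmetric]]])
  finally show ?thesis by (simp add: energy_def)
qed

section \<open>Averaging over small balls\<close>

abbreviation ball_avg :: "real \<Rightarrow> plane measure" where
  "ball_avg r \<equiv> uniform_measure lborel (ball 0 r)"

text \<open>
  Replaces every point mass by the uniform distribution on a ball, which produces a bounded density.
\<close>

definition smooth :: "real \<Rightarrow> plane measure \<Rightarrow> plane measure" where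
  "smooth r \<mu> = (\<mu> \<star> ball_avg r)"

lemma emeasure_ball_pos:
  assumes "r > 0"
  shows "emeasure lborel (ball (0::plane) r) = ennreal (measure lborel (ball (0::plane) r))"
    "measure lborel (ball (0::plane) r) > 0"
proof -
  have f: "emeasure lborel (ball (0::plane) r) < \<infinity>" using emeasure_bounded_finite[OF bounded_ball] by simp
  then show e: "emeasure lborel (ball (0::plane) r) = ennreal (measure lborel (ball (0::plane) r))"
    by (intro emeasure_eq_ennreal_measure) auto
  show "measure lborel (ball (0::plane) r) > 0"
    using content_ball_pos[OF assms, of "0::plane"] by simp
qed

lemma ball_avg_props:
  assumes r: "r > 0"
  shows "prob_space (ball_avg r)" "carried r (ball_avg r)"
    "dominated (1 / measure lborel (ball (0::plane) r)) (ball_avg r)"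
proof -
  note e = emeasure_ball_pos[OF r]
  show p: "prob_space (ball_avg r)"
    by (rule prob_space_uniform_measure) (use e in auto)
  have "AE x in ball_avg r. x \<in> cball 0 r"
    by (rule AE_uniform_measureI) auto
  then show "carried r (ball_avg r)"
    using prob_space.finite_measure[OF p] by (simp add: carried_def)
  show "dominated (1 / measure lborel (ball (0::plane) r)) (ball_avg r)"
    unfolding dominated_def
  proof (intro conjI ballI)
    fix A :: "plane set" assume A: "A \<in> sets borel"
    have "emeasure (ball_avg r) A = emeasure lborel (ball 0 r \<inter> A) / emeasure lborel (ball (0::plane) r)"
      using A by (intro emeasure_uniform_measure) auto
    also have "\<dots> \<le> emeasure lborel A / emeasure lborel (ball (0::plane) r)"
      using A by (intro divide_right_mono_ennreal emeasure_mono) auto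
    also have "\<dots> = ennreal (1 / measure lborel (ball (0::plane) r)) * emeasure lborel A"
      unfolding e(1) using e(2)
      by (simp add: divide_ennreal_def inverse_ennreal inverse_eq_divide mult.commute)
    finally show "emeasure (ball_avg r) A \<le> ennreal (1 / measure lborel (ball (0::plane) r)) * emeasure lborel A" .
  qed (use e in auto)
qed

lemma smooth_sets: "sets (smooth r \<mu>) = sets borel" "space (smooth r \<mu>) = UNIV"
  by (simp_all add: smooth_def)

lemma smooth_finite:
  assumes "carried R \<mu>" "r > 0" shows "finite_measure (smooth r \<mu>)"
  unfolding smooth_def
  using carriedD[OF assms(1)] carriedD[OF ball_avg_props(2)[OF assms(2)]]
  by (intro convolution_finite) auto

lemma smooth_nn_integral:
  assumes "carried R \<mu>" "r > 0" "f \<in> borel_measurable borel"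
  shows "(\<integral>\<^sup>+x. f x \<partial>smooth r \<mu>) = (\<integral>\<^sup>+x. \<integral>\<^sup>+y. f (x + y) \<partial>ball_avg r \<partial>\<mu>)"
  unfolding smooth_def
  using carriedD[OF assms(1)] carriedD[OF ball_avg_props(2)[OF assms(2)]] assms(3)
  by (intro nn_integral_convolution) auto

lemma smooth_carried:
  assumes \<mu>: "carried R \<mu>" and r: "r > 0"
  shows "carried (R + r) (smooth r \<mu>)"
proof -
  let ?A = "- cball (0::plane) (R + r)"
  have m: "(indicator ?A :: plane \<Rightarrow> ennreal) \<in> borel_measurable borel" by (intro borel_measurable_indicator) auto
  have "emeasure (smooth r \<mu>) ?A = (\<integral>\<^sup>+x. indicator ?A x \<partial>smooth r \<mu>)"
    by (simp add: smooth_sets)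
  also have "\<dots> = (\<integral>\<^sup>+x. \<integral>\<^sup>+y. indicator ?A (x + y) \<partial>ball_avg r \<partial>\<mu>)"
    by (rule smooth_nn_integral[OF \<mu> r m])
  also have "\<dots> = (\<integral>\<^sup>+x. 0 \<partial>\<mu>)"
  proof (rule nn_integral_cong_AE)
    show "AE x in \<mu>. (\<integral>\<^sup>+y. indicator ?A (x + y) \<partial>ball_avg r) = 0"
      using carriedD(4)[OF \<mu>]
    proof eventually_elim
      case (elim x)
      have "(\<integral>\<^sup>+y. indicator ?A (x + y) \<partial>ball_avg r) = (\<integral>\<^sup>+y. 0 \<partial>ball_avg r)"
      proof (rule nn_integral_cong_AE)
        show "AE y in ball_avg r. indicator ?A (x + y) = (0::ennreal)"
          using carriedD(4)[OF ball_avg_props(2)[OF r]]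
        proof eventually_elim
          case (elim y)
          then show ?case using \<open>x \<in> cball 0 R\<close> norm_triangle_ineq[of x y] by (simp add: indicator_def)
        qed
      qed
      then show ?case by simp
    qed
  qed
  finally have "emeasure (smooth r \<mu>) ?A = 0" by simp
  then have "?A \<in> null_sets (smooth r \<mu>)" by (auto simp: null_sets_def smooth_sets)
  then have "AE x in smooth r \<mu>. x \<in> cball 0 (R + r)" by (rule AE_I') auto
  then show ?thesis using smooth_finite[OF assms] by (simp add: carried_def smooth_sets)
qed

text \<open>
  By translation invariance each averaged point mass has density at most the reciprocal of the area of
  the ball, and \<open>\<mu>\<close> superposes them.
\<close>

lemma smooth_dominated:
  assumes \<mu>: "carried R \<mu>" and r: "r > 0"
  shows "dominated (measure \<mu> UNIV / measure lborel (ball (0::plane) r)) (smooth r \<mu>)"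
  unfolding dominated_def
proof (intro conjI ballI)
  note e = emeasure_ball_pos[OF r]
  let ?c = "1 / measure lborel (ball (0::plane) r)"
  interpret \<mu>: finite_measure \<mu> by (rule carriedD(1)[OF \<mu>])
  fix A :: "plane set" assume A: "A \<in> sets borel"
  have [measurable]: "A \<in> sets borel" by (rule A)
  have m: "(indicator A :: plane \<Rightarrow> ennreal) \<in> borel_measurable borel" by measurable
  have "emeasure (smooth r \<mu>) A = (\<integral>\<^sup>+x. indicator A x \<partial>smooth r \<mu>)"
    using A by (simp add: smooth_sets)
  also have "\<dots> = (\<integral>\<^sup>+x. \<integral>\<^sup>+y. indicator A (x + y) \<partial>ball_avg r \<partial>\<mu>)"
    by (rule smooth_nn_integral[OF \<mu> r m])
  also have "\<dots> \<le> (\<integral>\<^sup>+x. ennreal ?c * emeasure lborel A \<partial>\<mu>)"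
  proof (rule nn_integral_mono)
    fix x
    have "(\<integral>\<^sup>+y. indicator A (x + y) \<partial>ball_avg r) \<le> ennreal ?c * (\<integral>\<^sup>+y. indicator A (x + y) \<partial>lborel)"
      by (rule dominated_nn_integral[OF ball_avg_props(3,2)[OF r]]) measurable
    also have "(\<integral>\<^sup>+y. indicator A (x + y) \<partial>lborel) = (\<integral>\<^sup>+y. indicator A y \<partial>distr lborel borel ((+) x))"
      by (subst nn_integral_distr) auto
    also have "\<dots> = emeasure lborel A" unfolding lborel_distr_plus using A by simp
    finally show "(\<integral>\<^sup>+y. indicator A (x + y) \<partial>ball_avg r) \<le> ennreal ?c * emeasure lborel A" .
  qed
  also have "\<dots> = ennreal (measure \<mu> UNIV / measure lborel (ball (0::plane) r)) * emeasure lborel A"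
  proof -
    have c: "ennreal (measure \<mu> UNIV / measure lborel (ball (0::plane) r)) = ennreal ?c * ennreal (measure \<mu> UNIV)"
      using e(2) by (subst ennreal_mult[symmetric]) auto
    have "(\<integral>\<^sup>+x. ennreal ?c * emeasure lborel A \<partial>\<mu>) = ennreal ?c * emeasure lborel A * emeasure \<mu> (space \<mu>)"
      by (rule nn_integral_const)
    also have "emeasure \<mu> (space \<mu>) = ennreal (measure \<mu> UNIV)"
      unfolding carriedD(3)[OF \<mu>] by (rule \<mu>.emeasure_eq_measure)
    finally show ?thesis unfolding c by (simp only: mult_ac)
  qed
  finally show "emeasure (smooth r \<mu>) A \<le> ennreal (measure \<mu> UNIV / measure lborel (ball (0::plane) r)) * emeasure lborel A" .
qed (use emeasure_ball_pos[OF r] in auto)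

lemma smooth_mass:
  assumes \<mu>: "carried R \<mu>" and r: "r > 0"
  shows "measure (smooth r \<mu>) UNIV = measure \<mu> UNIV"
proof -
  interpret \<mu>: finite_measure \<mu> by (rule carriedD(1)[OF \<mu>])
  interpret L: prob_space "ball_avg r" by (rule ball_avg_props(1)[OF r])
  have "emeasure (smooth r \<mu>) UNIV = (\<integral>\<^sup>+x. 1 \<partial>smooth r \<mu>)"
    by (simp add: smooth_sets)
  also have "\<dots> = (\<integral>\<^sup>+x. \<integral>\<^sup>+y. 1 \<partial>ball_avg r \<partial>\<mu>)"
    by (rule smooth_nn_integral[OF \<mu> r]) simp
  also have "\<dots> = emeasure \<mu> UNIV"
    using L.emeasure_space_1 carriedD(3)[OF \<mu>] by simp
  finally show ?thesis by (simp add: measure_def)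
qed

lemma smooth_integral:
  fixes f :: "plane \<Rightarrow> real"
  assumes \<mu>: "carried R \<mu>" and r: "r > 0" and f: "f \<in> borel_measurable borel" "integrable (smooth r \<mu>) f"
  shows "(LINT x|smooth r \<mu>. f x) = (LINT x|\<mu>. LINT y|ball_avg r. f (x + y))"
    "(LINT x|smooth r \<mu>. f x) = (LINT y|ball_avg r. LINT x|\<mu>. f (x + y))"
    "integrable (ball_avg r) (\<lambda>y. LINT x|\<mu>. f (x + y))"
proof -
  interpret \<mu>: sigma_finite_measure \<mu> by (rule carried_sigma_finite[OF \<mu>])
  interpret L: sigma_finite_measure "ball_avg r" by (rule carried_sigma_finite[OF ball_avg_props(2)[OF r]])
  interpret pair_sigma_finite \<mu> "ball_avg r" ..
  have [measurable_cong]: "sets \<mu> = sets borel" "sets (ball_avg r) = sets borel"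
    using carriedD(2)[OF \<mu>] by auto
  have m: "(\<lambda>(x, y). x + y) \<in> measurable (\<mu> \<Otimes>\<^sub>M ball_avg r) (borel :: plane measure)" by measurable
  have i: "integrable (\<mu> \<Otimes>\<^sub>M ball_avg r) (\<lambda>(x, y). f (x + y))"
    using f(2) unfolding smooth_def convolution_def
    by (subst (asm) integrable_distr_eq[OF m]) (use f(1) in \<open>auto simp: case_prod_unfold\<close>)
  have e: "(LINT x|smooth r \<mu>. f x) = (LINT z|(\<mu> \<Otimes>\<^sub>M ball_avg r). (\<lambda>(x, y). f (x + y)) z)"
    unfolding smooth_def convolution_def
    by (subst integral_distr[OF m]) (use f(1) in \<open>auto simp: case_prod_unfold\<close>)
  show "(LINT x|smooth r \<mu>. f x) = (LINT x|\<mu>. LINT y|ball_avg r. f (x + y))"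
    unfolding e using integral_fst'[OF i] by simp
  show "(LINT x|smooth r \<mu>. f x) = (LINT y|ball_avg r. LINT x|\<mu>. f (x + y))"
    unfolding e using integral_snd[OF i] by simp
  show "integrable (ball_avg r) (\<lambda>y. LINT x|\<mu>. f (x + y))"
    using integrable_snd[OF i] by simp
qed

lemma smooth_narrow:
  assumes \<mu>: "carried R \<mu>" and r: "\<And>n. r n > 0" "r \<longlonglongrightarrow> 0"
  shows "narrow_conv (\<lambda>n. smooth (r n) \<mu>) \<mu>"
  unfolding narrow_conv_def
proof (intro allI impI)
  fix \<phi> :: "plane \<Rightarrow> real" assume \<phi>: "continuous_on UNIV \<phi> \<and> bounded (range \<phi>)"
  interpret \<mu>: finite_measure \<mu> by (rule carriedD(1)[OF \<mu>])
  have [measurable_cong]: "sets \<mu> = sets borel" using carriedD(2)[OF \<mu>] .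
  have m[measurable]: "\<phi> \<in> borel_measurable borel" using \<phi> by (intro borel_measurable_continuous_onI) auto
  obtain B where B: "\<And>x. \<bar>\<phi> x\<bar> \<le> B" using \<phi> unfolding bounded_iff by auto
  have B0: "B \<ge> 0" using B[of 0] by linarith
  have "(LINT x|smooth (r n) \<mu>. \<phi> x) = (LINT x|\<mu>. LINT y|ball_avg (r n). \<phi> (x + y))" for n
    by (rule smooth_integral(1)[OF \<mu> r(1) m carried_integrable_continuous[OF smooth_carried[OF \<mu> r(1)]]])
       (use \<phi> in auto)
  moreover have "(\<lambda>n. LINT x|\<mu>. LINT y|ball_avg (r n). \<phi> (x + y)) \<longlonglongrightarrow> (LINT x|\<mu>. \<phi> x)"
  proof (rule integral_dominated_convergence[where w = "\<lambda>_. B"])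
    show "(\<lambda>x. LINT y|ball_avg (r n). \<phi> (x + y)) \<in> borel_measurable \<mu>" for n
    proof -
      have "(\<lambda>x. LINT y|ball_avg (r n). \<phi> (x + y)) \<in> borel_measurable borel"
        by (rule inner_integral_measurable[OF ball_avg_props(2)[OF r(1)]]) measurable
      then show ?thesis by simp
    qed
    show "AE x in \<mu>. (\<lambda>n. LINT y|ball_avg (r n). \<phi> (x + y)) \<longlonglongrightarrow> \<phi> x"
    proof (intro AE_I2 LIMSEQ_I)
      fix x and e :: real assume e: "e > 0"
      have "isCont \<phi> x" using \<phi> continuous_on_eq_continuous_at[OF open_UNIV] by blast
      then have "\<exists>d>0. \<forall>z. dist z x < d \<longrightarrow> dist (\<phi> z) (\<phi> x) < e / 2"
        unfolding continuous_at_eps_delta using half_gt_zero[OF e] by blast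
      then obtain d where d: "d > 0" "\<And>z. dist z x < d \<Longrightarrow> dist (\<phi> z) (\<phi> x) < e / 2"
        by blast
      have "\<forall>\<^sub>F n in sequentially. r n < d" using r(2) d(1) by (rule order_tendstoD)
      then have "\<forall>\<^sub>F n in sequentially. norm ((LINT y|ball_avg (r n). \<phi> (x + y)) - \<phi> x) < e"
      proof eventually_elim
        case (elim n)
        interpret L: prob_space "ball_avg (r n)" by (rule ball_avg_props(1)[OF r(1)])
        note c = ball_avg_props(2)[OF r(1)[of n]]
        have i: "integrable (ball_avg (r n)) (\<lambda>y. \<phi> (x + y))"
          by (rule carried_integrable[OF c _ B]) measurable
        have "AE y in ball_avg (r n). \<bar>\<phi> (x + y) - \<phi> x\<bar> \<le> e / 2"
          using carriedD(4)[OF c]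
        proof eventually_elim
          case (elim y)
          then have "dist (x + y) x < d" using \<open>r n < d\<close> by (simp add: dist_norm)
          then show ?case using d(2)[of "x + y"] by (simp add: dist_real_def)
        qed
        then have "\<bar>LINT y|ball_avg (r n). \<phi> (x + y) - \<phi> x\<bar> \<le> e / 2 * measure (ball_avg (r n)) (space (ball_avg (r n)))"
          by (rule integral_abs_le_mass[OF L.finite_measure_axioms]) (use e in auto)
        then show ?case using i e L.prob_space by simp
      qed
      then show "\<exists>no. \<forall>n\<ge>no. norm ((LINT y|ball_avg (r n). \<phi> (x + y)) - \<phi> x) < e"
        by (simp add: eventually_sequentially)
    qed
    show "AE x in \<mu>. norm (LINT y|ball_avg (r n). \<phi> (x + y)) \<le> B" for n
    proof (intro AE_I2)
      fix x
      interpret L: prob_space "ball_avg (r n)" by (rule ball_avg_props(1)[OF r(1)])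
      show "norm (LINT y|ball_avg (r n). \<phi> (x + y)) \<le> B"
        using integral_abs_le_mass[OF L.finite_measure_axioms, of "\<lambda>y. \<phi> (x + y)" B] B B0 L.prob_space by simp
    qed
  qed auto
  ultimately show "(\<lambda>n. LINT x|smooth (r n) \<mu>. \<phi> x) \<longlonglongrightarrow> (LINT x|\<mu>. \<phi> x)" by simp
qed

text \<open>
  Averaging commutes with convolution by \<open>W\<close>. The bounded density of the averaged measure makes
  this identity hold at every point rather than almost everywhere.
\<close>

lemma smooth_conv_measure:
  assumes \<mu>: "carried R \<mu>" and r: "r > 0" and W: "integrable lborel W"
  shows "conv_measure W (smooth r \<mu>) u = (LINT y|ball_avg r. conv_measure W \<mu> (u - y))"
    "integrable (ball_avg r) (\<lambda>y. conv_measure W \<mu> (u - y))"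
proof -
  have [measurable]: "W \<in> borel_measurable borel" using W by auto
  have m: "(\<lambda>x. W (u - x)) \<in> borel_measurable borel" by measurable
  have i: "integrable (smooth r \<mu>) (\<lambda>x. W (u - x))"
    by (rule dominated_reflect_integrable(1)[OF smooth_dominated[OF \<mu> r] smooth_carried[OF \<mu> r] W])
  have e: "u - (x + y) = u - y - x" for x y by (simp add: algebra_simps)
  show "conv_measure W (smooth r \<mu>) u = (LINT y|ball_avg r. conv_measure W \<mu> (u - y))"
    using smooth_integral(2)[OF \<mu> r m i] unfolding conv_measure_def e .
  show "integrable (ball_avg r) (\<lambda>y. conv_measure W \<mu> (u - y))"
    using smooth_integral(3)[OF \<mu> r m i] unfolding conv_measure_def e .
qed

text \<open>
  Jensen's inequality bounds the square of an average over a ball by the average of the square, whose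
  integral is translation invariant.
\<close>

lemma L2_norm_smooth_le:
  assumes \<mu>: "\<And>s. s \<in> {1..S} \<Longrightarrow> carried R (\<mu> s)" and r: "r > 0"
    and W: "\<And>s. s \<in> {1..S} \<Longrightarrow> integrable lborel (W s)"
  shows "(L2_norm (\<lambda>x. \<Sum>s=1..S. conv_measure (W s) (smooth r (\<mu> s)) x))\<^sup>2
           \<le> (L2_norm (\<lambda>x. \<Sum>s=1..S. conv_measure (W s) (\<mu> s) x))\<^sup>2"
proof -
  define F where "F x = (\<Sum>s=1..S. conv_measure (W s) (\<mu> s) x)" for x
  define G where "G x = (\<Sum>s=1..S. conv_measure (W s) (smooth r (\<mu> s)) x)" for x
  have Fi: "integrable lborel F" unfolding F_def
    by (intro Bochner_Integration.integrable_sum conv_measure_integrable[OF \<mu> W])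
  have Gi: "integrable lborel G" unfolding G_def
    by (intro Bochner_Integration.integrable_sum conv_measure_integrable[OF smooth_carried[OF \<mu> r] W])
  have "(L2_norm G)\<^sup>2 \<le> (L2_norm F)\<^sup>2"
  proof (cases "integrable lborel (\<lambda>x. (F x)\<^sup>2)")
    case True
    interpret L: prob_space "ball_avg r" by (rule ball_avg_props(1)[OF r])
    note c = ball_avg_props(2)[OF r]
    define H where "H = conv_measure (\<lambda>x. (F x)\<^sup>2) (ball_avg r)"
    have Hi: "integrable lborel H" unfolding H_def by (rule conv_measure_integrable[OF c True])
    have le: "(G u)\<^sup>2 \<le> H u" for u
    proof -
      have G: "G u = (LINT y|ball_avg r. F (u - y))"
        unfolding G_def F_def
        by (subst Bochner_Integration.integral_sum) (auto intro!: sum.cong smooth_conv_measure[OF \<mu> r W])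
      have i1: "integrable (ball_avg r) (\<lambda>y. F (u - y))" unfolding F_def
        by (intro Bochner_Integration.integrable_sum smooth_conv_measure(2)[OF \<mu> r W])
      have i2: "integrable (ball_avg r) (\<lambda>y. (F (u - y))\<^sup>2)"
        using dominated_reflect_integrable(1)[OF ball_avg_props(3)[OF r] c True, of u] .
      have "0 \<le> L.variance (\<lambda>y. F (u - y))" by (rule L.variance_positive)
      also have "\<dots> = (LINT y|ball_avg r. (F (u - y))\<^sup>2) - (LINT y|ball_avg r. F (u - y))\<^sup>2"
        by (rule L.variance_eq[OF i1 i2])
      finally show ?thesis by (simp add: G H_def conv_measure_def)
    qed
    have "integrable lborel (\<lambda>u. (G u)\<^sup>2)"
      by (rule Bochner_Integration.integrable_bound[OF Hi]) (use Gi le in \<open>auto intro: order_trans[OF _ abs_ge_self]\<close>)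
    moreover have "(LINT u|lborel. (G u)\<^sup>2) \<le> (LINT u|lborel. (F u)\<^sup>2)"
    proof -
      have "(LINT u|lborel. (G u)\<^sup>2) \<le> (LINT u|lborel. H u)"
        using calculation Hi le by (rule integral_mono)
      also have "\<dots> = (LINT y|ball_avg r. LINT u|lborel. (F (u - y))\<^sup>2 * 1)"
        using conv_measure_pairing(1)[OF c True, of "\<lambda>_. 1" 1] by (simp add: H_def)
      also have "\<dots> = (LINT y|ball_avg r. LINT u|lborel. (F u)\<^sup>2)"
        using lborel_translate(1)[of "\<lambda>u. (F u)\<^sup>2"] Fi by simp
      also have "\<dots> = (LINT u|lborel. (F u)\<^sup>2)" using L.prob_space by simp
      finally show ?thesis .
    qed
    ultimately show ?thesis using Fi Gi True by (simp add: L2_norm_sq)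
  qed (simp add: L2_norm_sq)
  then show ?thesis by (simp add: F_def[abs_def] G_def[abs_def])
qed

lemma energy_alt:
  "energy S K Vr W \<mu> = ereal (interaction S Vr \<mu>) +
     (\<Sum>k=1..K. (L2_norm (\<lambda>x. \<Sum>s=1..S. conv_measure (W k s) (\<mu> s) x))\<^sup>2)"
  unfolding energy_def interaction_def conv_measure_def[abs_def] by (rule refl)

lemma energy_smooth_le:
  assumes \<mu>: "\<And>s. s \<in> {1..S} \<Longrightarrow> carried R (\<mu> s)" and r: "r > 0"
    and W: "\<And>k s. k \<in> {1..K} \<Longrightarrow> s \<in> {1..S} \<Longrightarrow> integrable lborel (W k s)"
  shows "energy S K Vr W (\<lambda>s. smooth r (\<mu> s)) \<le>
     ereal (interaction S Vr (\<lambda>s. smooth r (\<mu> s))) + (\<Sum>k=1..K. (L2_norm (\<lambda>x. \<Sum>s=1..S. conv_measure (W k s) (\<mu> s) x))\<^sup>2)"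
proof -
  have le: "(\<Sum>k=1..K. (L2_norm (\<lambda>x. \<Sum>s=1..S. conv_measure (W k s) (smooth r (\<mu> s)) x))\<^sup>2)
      \<le> (\<Sum>k=1..K. (L2_norm (\<lambda>x. \<Sum>s=1..S. conv_measure (W k s) (\<mu> s) x))\<^sup>2)"
  proof (rule sum_mono)
    fix k assume k: "k \<in> {1..K}"
    show "(L2_norm (\<lambda>x. \<Sum>s=1..S. conv_measure (W k s) (smooth r (\<mu> s)) x))\<^sup>2
        \<le> (L2_norm (\<lambda>x. \<Sum>s=1..S. conv_measure (W k s) (\<mu> s) x))\<^sup>2"
      by (rule L2_norm_smooth_le[OF \<mu> r W[OF k]])
  qed
  show ?thesis unfolding energy_alt by (rule add_left_mono[OF le])
qed

lemma interaction_tendsto: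
  assumes \<nu>: "\<And>n s. s \<in> {1..S} \<Longrightarrow> carried R (\<nu> n s)" "\<And>s. s \<in> {1..S} \<Longrightarrow> carried R (\<mu> s)"
      "\<And>s. s \<in> {1..S} \<Longrightarrow> narrow_conv (\<lambda>n. \<nu> n s) (\<mu> s)"
    and V: "\<And>s t. s \<in> {1..S} \<Longrightarrow> t \<in> {1..S} \<Longrightarrow> continuous_on UNIV (V s t)"
  shows "(\<lambda>n. interaction S V (\<nu> n)) \<longlonglongrightarrow> interaction S V \<mu>"
proof -
  have "V s t \<in> borel_measurable borel" if "s \<in> {1..S}" "t \<in> {1..S}" for s t
    using V[OF that] by (rule borel_measurable_continuous_onI)
  moreover have "uniform_limit (cball 0 (2 * R)) (\<lambda>n. V s t) (V s t) sequentially" for s t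
    by (rule uniform_limit_const)
  ultimately show ?thesis unfolding interaction_def
    by (intro tendsto_sum narrow_conv_pair[where R = R] \<nu> V)
qed

lemma carried_mono: "carried R \<mu> \<Longrightarrow> R \<le> R' \<Longrightarrow> carried R' \<mu>"
  unfolding carried_def by (auto elim!: eventually_mono)

lemma dominated_mono:
  assumes "dominated c \<nu>" "c \<le> c'" shows "dominated c' \<nu>"
  unfolding dominated_def
proof (intro conjI ballI)
  fix A :: "plane set" assume "A \<in> sets borel"
  then have "emeasure \<nu> A \<le> ennreal c * emeasure lborel A" using assms(1) by (simp add: dominated_def)
  also have "\<dots> \<le> ennreal c' * emeasure lborel A" by (intro mult_right_mono ennreal_leI assms(2)) simp
  finally show "emeasure \<nu> A \<le> ennreal c' * emeasure lborel A" .
qed (use assms in \<open>simp add: dominated_def\<close>)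

lemma smooth_dominated_family:
  fixes S :: nat and \<mu> :: "nat \<Rightarrow> plane measure"
  assumes \<mu>: "\<And>s. s \<in> {1..S} \<Longrightarrow> carried R (\<mu> s)" and r: "r > 0" and s: "s \<in> {1..S}"
  shows "dominated (\<Sum>s=1..S. measure (\<mu> s) UNIV / measure lborel (ball (0::plane) r)) (smooth r (\<mu> s))"
proof (rule dominated_mono[OF smooth_dominated[OF \<mu>[OF s] r]])
  show "measure (\<mu> s) UNIV / measure lborel (ball (0::plane) r)
      \<le> (\<Sum>s=1..S. measure (\<mu> s) UNIV / measure lborel (ball (0::plane) r))"
    using s by (intro member_le_sum) auto
qed

text \<open>
  The measures may be atomic. For their averages over balls both sides agree; as the radius tends to
  \<open>0\<close> the right side converges, since \<open>V\<close> is continuous, and the left side is lower semicontinuous.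
\<close>

lemma energy_le_interaction:
  assumes \<mu>: "\<And>s. s \<in> {1..S} \<Longrightarrow> carried R (\<mu> s)"
    and V: "\<And>s t. s \<in> {1..S} \<Longrightarrow> t \<in> {1..S} \<Longrightarrow> continuous_on UNIV (V s t)"
      "\<And>s t. s \<in> {1..S} \<Longrightarrow> t \<in> {1..S} \<Longrightarrow>
         AE x in lborel. V s t x = (\<Sum>k=1..K. conv (reflect (W k s)) (W k t) x) + Vr s t x"
      "\<And>s t. s \<in> {1..S} \<Longrightarrow> t \<in> {1..S} \<Longrightarrow> continuous_on UNIV (Vr s t)"
    and W: "\<And>k s. k \<in> {1..K} \<Longrightarrow> s \<in> {1..S} \<Longrightarrow> integrable lborel (W k s)"
  shows "energy S K Vr W \<mu> \<le> ereal (interaction S V \<mu>)"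
proof -
  define r :: "nat \<Rightarrow> real" where "r n = 1 / real (Suc n)" for n
  have r: "r n > 0" "r n \<le> 1" for n by (auto simp: r_def)
  have r0: "r \<longlonglongrightarrow> 0" unfolding r_def by (rule LIMSEQ_Suc[OF lim_1_over_n])
  have c: "carried (R + 1) (smooth (r n) (\<mu> s))" if "s \<in> {1..S}" for n s
    using carried_mono[OF smooth_carried[OF \<mu>[OF that] r(1)]] r(2)[of n] by simp
  have c': "carried (R + 1) (\<mu> s)" if "s \<in> {1..S}" for s using carried_mono[OF \<mu>[OF that]] by simp
  have nc: "narrow_conv (\<lambda>n. smooth (r n) (\<mu> s)) (\<mu> s)" if "s \<in> {1..S}" for s
    by (rule smooth_narrow[OF \<mu>[OF that] r(1) r0])
  define d where "d n = (\<Sum>s=1..S. measure (\<mu> s) UNIV / measure lborel (ball (0::plane) (r n)))" for n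
  have dom: "dominated (d n) (smooth (r n) (\<mu> s))" if s: "s \<in> {1..S}" for n s
    unfolding d_def by (rule smooth_dominated_family[OF \<mu> r(1) s])
  have Vm: "V s t \<in> borel_measurable borel" if "s \<in> {1..S}" "t \<in> {1..S}" for s t
    using V(1)[OF that] by (rule borel_measurable_continuous_onI)
  have Vrm: "Vr s t \<in> borel_measurable borel" if "s \<in> {1..S}" "t \<in> {1..S}" for s t
    using V(3)[OF that] by (rule borel_measurable_continuous_onI)
  have eq: "energy S K Vr W (\<lambda>s. smooth (r n) (\<mu> s)) = ereal (interaction S V (\<lambda>s. smooth (r n) (\<mu> s)))" for n
    by (rule energy_eq_interaction[where R = "R + 1" and c = "d n"]) (intro c dom Vm V W; assumption)+
  have "energy S K Vr W \<mu> \<le> liminf (\<lambda>n. energy S K Vr W (\<lambda>s. smooth (r n) (\<mu> s)))"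
    by (rule energy_liminf[where R = "R + 1"]) (intro c c' nc V Vrm W uniform_limit_const; assumption)+
  also have "\<dots> = ereal (interaction S V \<mu>)"
    unfolding eq
    by (intro lim_imp_Liminf trivial_limit_sequentially tendsto_ereal interaction_tendsto[where R = "R + 1"] c c' nc V)
  finally show ?thesis .
qed

section \<open>From regularised to singular potentials\<close>

lemma punctured_continuous_measurable:
  fixes V :: "plane \<Rightarrow> real"
  assumes "continuous_on (UNIV - {0}) V"
  shows "V \<in> borel_measurable borel"
  by (rule borel_measurable_continuous_countable_exceptions[of "{0}"])
     (use assms in \<open>auto simp: Compl_eq_Diff_UNIV\<close>)

text \<open>
  Dominated convergence. Near the diagonal the majorant \<open>U\<close> applies, and it is integrable against a
  measure of bounded density; away from the diagonal the potentials converge uniformly.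
\<close>

lemma singular_pair_tendsto:
  fixes V U :: "plane \<Rightarrow> real" and Vn :: "nat \<Rightarrow> plane \<Rightarrow> real"
  assumes \<nu>s: "carried R \<nu>s" and \<nu>t: "carried R \<nu>t" "dominated c \<nu>t" and R: "R > 0"
    and V: "continuous_on (UNIV - {0}) V" and Vn: "\<And>n. continuous_on UNIV (Vn n)"
    and U: "set_integrable lborel (cball 0 1) U" "\<And>n z. z \<in> ball 0 1 - {0} \<Longrightarrow> \<bar>Vn n z\<bar> \<le> U z"
    and lim: "\<And>\<epsilon>. 0 < \<epsilon> \<Longrightarrow> \<epsilon> < 1 \<Longrightarrow> uniform_limit (ball 0 (1 / \<epsilon>) - ball 0 \<epsilon>) Vn V sequentially"
  shows "(\<lambda>n. LINT x|\<nu>s. LINT y|\<nu>t. Vn n (x - y)) \<longlonglongrightarrow> (LINT x|\<nu>s. LINT y|\<nu>t. V (x - y))"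
proof -
  have Vm: "V \<in> borel_measurable borel" by (rule punctured_continuous_measurable[OF V])
  have Vnm: "Vn n \<in> borel_measurable borel" for n using Vn by (rule borel_measurable_continuous_onI)
  have pt: "(\<lambda>n. Vn n z) \<longlonglongrightarrow> V z" if z: "z \<noteq> 0" for z
  proof -
    define \<epsilon> where "\<epsilon> = min (norm z) (min (1/2) (1 / (2 * norm z)))"
    have e: "0 < \<epsilon>" "\<epsilon> < 1" "\<epsilon> \<le> norm z" using z by (auto simp: \<epsilon>_def)
    have "\<epsilon> \<le> 1 / (2 * norm z)" by (simp add: \<epsilon>_def)
    then have "\<epsilon> * (2 * norm z) \<le> 1" using z by (simp add: pos_le_divide_eq)
    then have "2 * norm z \<le> 1 / \<epsilon>" using e(1) by (simp add: pos_le_divide_eq mult.commute)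
    then have "norm z < 1 / \<epsilon>" using z norm_ge_zero[of z] zero_less_norm_iff[of z] by linarith
    then have "z \<in> ball 0 (1 / \<epsilon>) - ball 0 \<epsilon>" using e(3) by simp
    from tendsto_uniform_limitI[OF lim[OF e(1,2)] this] show ?thesis .
  qed
  \<comment> \<open>an annulus containing all differences of points of the ball that are at distance at least \<open>1/2\<close>\<close>
  define \<epsilon> where "\<epsilon> = 1 / (2 * R + 2)"
  have e: "0 < \<epsilon>" "\<epsilon> < 1" "\<epsilon> \<le> 1 / 2" "1 / \<epsilon> = 2 * R + 2" using R by (auto simp: \<epsilon>_def field_simps)
  obtain M0 where M0: "\<And>z. z \<in> cball 0 (2 * R) - ball 0 (1/2) \<Longrightarrow> \<bar>V z\<bar> \<le> M0"
  proof -
    have "compact (cball 0 (2 * R) - ball (0::plane) (1/2))" by (intro compact_diff) auto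
    moreover have "continuous_on (cball 0 (2 * R) - ball 0 (1/2)) V"
      by (rule continuous_on_subset[OF V]) auto
    ultimately have "bounded (V ` (cball 0 (2 * R) - ball 0 (1/2)))"
      by (intro compact_imp_bounded compact_continuous_image)
    then have "\<exists>B. \<forall>z\<in>cball 0 (2 * R) - ball 0 (1/2). \<bar>V z\<bar> \<le> B" unfolding bounded_iff by simp
    then obtain B where "\<forall>z\<in>cball 0 (2 * R) - ball 0 (1/2). \<bar>V z\<bar> \<le> B" by (elim exE)
    then show ?thesis by (intro that[of B]) blast
  qed
  have "\<forall>\<^sub>F n in sequentially. \<forall>z\<in>ball 0 (1 / \<epsilon>) - ball 0 \<epsilon>. dist (Vn n z) (V z) < 1"
    using lim[OF e(1,2)] unfolding uniform_limit_iff by (elim allE[of _ 1]) simp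
  then obtain n0 where n0: "\<And>n z. n \<ge> n0 \<Longrightarrow> z \<in> ball 0 (1 / \<epsilon>) - ball 0 \<epsilon> \<Longrightarrow> dist (Vn n z) (V z) < 1"
    unfolding eventually_sequentially by blast
  \<comment> \<open>\<open>M + \<bar>T z\<bar>\<close> dominates \<open>Vn n z\<close> for large \<open>n\<close>: \<open>T\<close> near the origin, \<open>M\<close> elsewhere\<close>
  define M where "M = \<bar>M0\<bar> + 1"
  define T where "T z = indicator (cball 0 1) z * U z" for z
  have Ti: "integrable lborel T" using U(1) by (simp add: T_def[abs_def] set_integrable_def)
  have D: "\<bar>Vn n z\<bar> \<le> M + \<bar>T z\<bar>" if n: "n \<ge> n0" and z: "z \<noteq> 0" "norm z \<le> 2 * R" for n z
  proof (cases "norm z < 1/2")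
    case True
    then have "\<bar>Vn n z\<bar> \<le> U z" using z by (intro U(2)) simp
    moreover have "U z = T z" using True by (simp add: T_def)
    ultimately show ?thesis by (simp add: M_def)
  next
    case False
    then have "\<bar>V z\<bar> \<le> M0" using z by (intro M0) simp
    moreover have "dist (Vn n z) (V z) < 1" using False z e R by (intro n0[OF n]) auto
    ultimately have "\<bar>Vn n z\<bar> \<le> M" unfolding M_def dist_real_def by linarith
    then show ?thesis by simp
  qed
  interpret \<nu>t: finite_measure \<nu>t by (rule carriedD(1)[OF \<nu>t(1)])
  interpret \<nu>s: finite_measure \<nu>s by (rule carriedD(1)[OF \<nu>s])
  have w: "integrable \<nu>t (\<lambda>y. M + \<bar>T (x - y)\<bar>)" for x
    using dominated_reflect_integrable(1)[OF \<nu>t(2,1) Ti, of x] by auto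
  have aeD: "AE y in \<nu>t. \<bar>Vn (n + n0) (x - y)\<bar> \<le> M + \<bar>T (x - y)\<bar>" if x: "x \<in> cball 0 R" for x n
  proof -
    have "AE y in \<nu>t. y \<noteq> x" by (rule dominated_AE[OF \<nu>t(2,1) AE_lborel_singleton])
    then show ?thesis using carriedD(4)[OF \<nu>t(1)]
    proof eventually_elim
      case (elim y)
      then show ?case using x norm_triangle_ineq4[of x y] by (intro D) auto
    qed
  qed
  have msh: "(\<lambda>y. f (x - y)) \<in> borel_measurable \<nu>t" if [measurable]: "f \<in> borel_measurable borel" for f :: "plane \<Rightarrow> real" and x
    unfolding carried_measurable[OF \<nu>t(1)] by measurable
  have inner: "(\<lambda>n. LINT y|\<nu>t. Vn (n + n0) (x - y)) \<longlonglongrightarrow> (LINT y|\<nu>t. V (x - y))" if x: "x \<in> cball 0 R" for x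
  proof (rule integral_dominated_convergence[OF msh[OF Vm] msh[OF Vnm] w[of x]])
    have "AE y in \<nu>t. y \<noteq> x" by (rule dominated_AE[OF \<nu>t(2,1) AE_lborel_singleton])
    then show "AE y in \<nu>t. (\<lambda>n. Vn (n + n0) (x - y)) \<longlonglongrightarrow> V (x - y)"
    proof eventually_elim
      case (elim y)
      then show ?case by (intro LIMSEQ_ignore_initial_segment pt) simp
    qed
    show "AE y in \<nu>t. norm (Vn (n + n0) (x - y)) \<le> M + \<bar>T (x - y)\<bar>" for n
      using aeD[OF x] by simp
  qed
  define K where "K = M * measure \<nu>t UNIV + c * (LINT z|lborel. \<bar>T z\<bar>)"
  have bound: "\<bar>LINT y|\<nu>t. Vn (n + n0) (x - y)\<bar> \<le> K" if x: "x \<in> cball 0 R" for x n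
  proof -
    have i: "integrable \<nu>t (\<lambda>y. Vn (n + n0) (x - y))"
      by (intro carried_integrable_continuous[OF \<nu>t(1)] continuous_on_compose2[OF Vn]) (auto intro: continuous_intros)
    have "\<bar>LINT y|\<nu>t. Vn (n + n0) (x - y)\<bar> \<le> (LINT y|\<nu>t. \<bar>Vn (n + n0) (x - y)\<bar>)"
      using integral_norm_bound[of \<nu>t "\<lambda>y. Vn (n + n0) (x - y)"] by simp
    also have "\<dots> \<le> (LINT y|\<nu>t. M + \<bar>T (x - y)\<bar>)"
      using i w[of x] aeD[OF x] by (intro integral_mono_AE) auto
    also have "\<dots> = M * measure \<nu>t UNIV + (LINT y|\<nu>t. \<bar>T (x - y)\<bar>)"
      using dominated_reflect_integrable(1)[OF \<nu>t(2,1) Ti, of x] carriedD(3)[OF \<nu>t(1)] by simp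
    also have "(LINT y|\<nu>t. \<bar>T (x - y)\<bar>) \<le> c * (LINT z|lborel. \<bar>T z\<bar>)"
      using dominated_reflect_integrable(2)[OF \<nu>t(2,1), of "\<lambda>z. \<bar>T z\<bar>" x] Ti by (simp add: conv_measure_def)
    finally show ?thesis by (simp add: K_def)
  qed
  have om: "(\<lambda>x. LINT y|\<nu>t. f (x - y)) \<in> borel_measurable \<nu>s" if "f \<in> borel_measurable borel" for f :: "plane \<Rightarrow> real"
    unfolding carried_measurable[OF \<nu>s] by (rule inner_integral_measurable[OF \<nu>t(1) diff_measurable[OF that]])
  have "(\<lambda>n. LINT x|\<nu>s. LINT y|\<nu>t. Vn (n + n0) (x - y)) \<longlonglongrightarrow> (LINT x|\<nu>s. LINT y|\<nu>t. V (x - y))"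
  proof (rule integral_dominated_convergence[OF om[OF Vm] om[OF Vnm], of "\<lambda>_. K"])
    show "AE x in \<nu>s. (\<lambda>n. LINT y|\<nu>t. Vn (n + n0) (x - y)) \<longlonglongrightarrow> (LINT y|\<nu>t. V (x - y))"
      using carriedD(4)[OF \<nu>s] by eventually_elim (rule inner)
    show "AE x in \<nu>s. norm (LINT y|\<nu>t. Vn (n + n0) (x - y)) \<le> K" for n
      using carriedD(4)[OF \<nu>s] by eventually_elim (use bound in simp)
  qed simp
  then show ?thesis by (rule LIMSEQ_offset)
qed

section \<open>Choosing points one at a time\<close>

text \<open>
  The method of conditional expectations. Think of points drawn independently from a distribution for
  which \<open>h z\<close> is the mean of \<open>f z\<close> and \<open>H\<close> the mean of \<open>h\<close>. If \<open>k\<close> points have been chosen, the expected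
  value of the final off-diagonal sum is the off-diagonal sum so far, plus \<open>2 (n - k)\<close> times the sum of
  the values of \<open>h\<close>, plus \<open>(n - k) (n - k - 1) H\<close>. The hypothesis \<open>ex\<close> says that some next point does
  not increase this quantity.
\<close>

lemma greedy_sampling:
  fixes f :: "'a \<Rightarrow> 'a \<Rightarrow> real"
  assumes sym: "\<And>z w. f z w = f w z"
    and ex: "\<And>zs c. set zs \<subseteq> Z \<Longrightarrow> c \<ge> 0 \<Longrightarrow>
       \<exists>z\<in>Z. (\<Sum>w\<leftarrow>zs. f w z) + c * h z \<le> (\<Sum>w\<leftarrow>zs. h w) + c * H"
  obtains zs where "length zs = n" "set zs \<subseteq> Z"
    "(\<Sum>a\<leftarrow>zs. \<Sum>b\<leftarrow>zs. f a b) \<le> real n * (real n - 1) * H + (\<Sum>a\<leftarrow>zs. f a a)"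
proof -
  have "\<exists>zs. length zs = k \<and> set zs \<subseteq> Z \<and>
     (\<Sum>a\<leftarrow>zs. \<Sum>b\<leftarrow>zs. f a b) - (\<Sum>a\<leftarrow>zs. f a a) + 2 * (real n - real k) * (\<Sum>a\<leftarrow>zs. h a)
        + (real n - real k) * (real n - real k - 1) * H \<le> real n * (real n - 1) * H" if "k \<le> n" for k
    using that
  proof (induction k)
    case (Suc k)
    then obtain zs where zs: "length zs = k" "set zs \<subseteq> Z"
      "(\<Sum>a\<leftarrow>zs. \<Sum>b\<leftarrow>zs. f a b) - (\<Sum>a\<leftarrow>zs. f a a) + 2 * (real n - real k) * (\<Sum>a\<leftarrow>zs. h a)
        + (real n - real k) * (real n - real k - 1) * H \<le> real n * (real n - 1) * H"
      by (elim meta_impE exE conjE) auto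
    define c where "c = real n - real k - 1"
    have c: "c \<ge> 0" using Suc.prems by (simp add: c_def)
    obtain z where z: "z \<in> Z" "(\<Sum>w\<leftarrow>zs. f w z) + c * h z \<le> (\<Sum>w\<leftarrow>zs. h w) + c * H"
      using ex[OF zs(2) c] by blast
    have s: "(\<Sum>w\<leftarrow>zs. f z w) = (\<Sum>w\<leftarrow>zs. f w z)" by (simp add: sym[of z])
    have nk: "real n - real k = c + 1" "real n - real (Suc k) = c" by (simp_all add: c_def)
    let ?A = "\<Sum>a\<leftarrow>zs. \<Sum>b\<leftarrow>zs. f a b" and ?D = "\<Sum>a\<leftarrow>zs. f a a" and ?h = "\<Sum>a\<leftarrow>zs. h a" and ?F = "\<Sum>w\<leftarrow>zs. f w z"
    have full: "(\<Sum>a\<leftarrow>z # zs. \<Sum>b\<leftarrow>z # zs. f a b) = f z z + 2 * ?F + ?A"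
      using s by (simp add: sum_list_addf)
    have "(\<Sum>a\<leftarrow>z # zs. \<Sum>b\<leftarrow>z # zs. f a b) - (\<Sum>a\<leftarrow>z # zs. f a a)
        + 2 * (real n - real (Suc k)) * (\<Sum>a\<leftarrow>z # zs. h a) + (real n - real (Suc k)) * (real n - real (Suc k) - 1) * H
      = ?A - ?D + 2 * (?F + c * h z) + 2 * c * ?h + c * (c - 1) * H"
      unfolding full nk by (simp add: algebra_simps)
    also have "\<dots> \<le> ?A - ?D + 2 * (?h + c * H) + 2 * c * ?h + c * (c - 1) * H"
      by (intro add_right_mono add_left_mono mult_left_mono z(2)) simp
    also have "\<dots> = ?A - ?D + 2 * (c + 1) * ?h + (c + 1) * (c + 1 - 1) * H"
      by (simp add: algebra_simps)
    also have "\<dots> \<le> real n * (real n - 1) * H" using zs(3) unfolding nk .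
    finally show ?case using zs z by (intro exI[of _ "z # zs"]) auto
  qed simp
  from this[of n] obtain zs where "length zs = n" "set zs \<subseteq> Z"
     "(\<Sum>a\<leftarrow>zs. \<Sum>b\<leftarrow>zs. f a b) - (\<Sum>a\<leftarrow>zs. f a a) \<le> real n * (real n - 1) * H"
    by (elim meta_impE exE conjE) auto
  then show ?thesis by (intro that[of zs]) auto
qed

text \<open>
  If \<open>g\<close> exceeded its mean wherever the measures live, the integral of the difference, which is \<open>0\<close>
  because the total mass is one, would be positive.
\<close>

lemma exists_le_mean:
  fixes g :: "nat \<Rightarrow> plane \<Rightarrow> real"
  assumes \<nu>: "\<And>s. s \<in> {1..S} \<Longrightarrow> carried R (\<nu> s)" "(\<Sum>s=1..S. measure (\<nu> s) UNIV) = 1"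
    and g: "\<And>s. s \<in> {1..S} \<Longrightarrow> integrable (\<nu> s) (g s)"
  shows "\<exists>z\<in>{1..S} \<times> cball 0 R. g (fst z) (snd z) \<le> (\<Sum>s=1..S. LINT x|\<nu> s. g s x)"
proof (rule ccontr)
  define m where "m = (\<Sum>s=1..S. LINT x|\<nu> s. g s x)"
  assume "\<not> ?thesis"
  then have gt: "g s x > m" if "s \<in> {1..S}" "x \<in> cball 0 R" for s x
    using that by (force simp: m_def)
  have ae: "AE x in \<nu> s. g s x - m > 0" if s: "s \<in> {1..S}" for s
    using carriedD(4)[OF \<nu>(1)[OF s]] by eventually_elim (use gt[OF s] in simp)
  have int: "(LINT x|\<nu> s. g s x - m) = (LINT x|\<nu> s. g s x) - m * measure (\<nu> s) UNIV"
     "integrable (\<nu> s) (\<lambda>x. g s x - m)" if s: "s \<in> {1..S}" for s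
  proof -
    interpret finite_measure "\<nu> s" by (rule carriedD(1)[OF \<nu>(1)[OF s]])
    show "(LINT x|\<nu> s. g s x - m) = (LINT x|\<nu> s. g s x) - m * measure (\<nu> s) UNIV"
      "integrable (\<nu> s) (\<lambda>x. g s x - m)"
      using g[OF s] carriedD(3)[OF \<nu>(1)[OF s]] by simp_all
  qed
  have nn: "(LINT x|\<nu> s. g s x - m) \<ge> 0" if s: "s \<in> {1..S}" for s
    using ae[OF s] by (intro integral_nonneg_AE) (auto elim: eventually_mono)
  have "(\<Sum>s=1..S. LINT x|\<nu> s. g s x - m) = (\<Sum>s=1..S. (LINT x|\<nu> s. g s x) - m * measure (\<nu> s) UNIV)"
    by (intro sum.cong refl int(1))
  also have "\<dots> = m - m * (\<Sum>s=1..S. measure (\<nu> s) UNIV)"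
    by (simp add: sum_subtractf m_def sum_distrib_left)
  also have "\<dots> = 0" using \<nu>(2) by simp
  finally have z: "(LINT x|\<nu> s. g s x - m) = 0" if "s \<in> {1..S}" for s
    using that nn by (subst (asm) sum_nonneg_eq_0_iff) auto
  have "measure (\<nu> s) UNIV = 0" if s: "s \<in> {1..S}" for s
  proof -
    have "AE x in \<nu> s. g s x - m = 0"
      using z[OF s] ae[OF s] int(2)[OF s]
      by (subst integral_nonneg_eq_0_iff_AE[symmetric]) (auto elim: eventually_mono)
    with ae[OF s] have "AE x in \<nu> s. False" by eventually_elim simp
    then have "space (\<nu> s) \<in> null_sets (\<nu> s)" by (simp add: AE_iff_null)
    then show ?thesis using carriedD(3)[OF \<nu>(1)[OF s]] by (simp add: null_sets_def measure_def)
  qed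
  then show False using \<nu>(2) by simp
qed

text \<open>
  A countable family deciding narrow convergence on the ball: finite linear combinations, given as lists
  of pairs of a coefficient and an index, approximate every continuous function uniformly. The bound by
  \<open>1\<close> makes the family summable with geometric weights.
\<close>

definition bounded_dense_family :: "real \<Rightarrow> (nat \<Rightarrow> plane \<Rightarrow> real) \<Rightarrow> bool" where
  "bounded_dense_family R q \<longleftrightarrow> (\<forall>j. continuous_on UNIV (q j)) \<and> (\<forall>j x. \<bar>q j x\<bar> \<le> 1) \<and>
     (\<forall>\<phi> e. continuous_on UNIV \<phi> \<and> e > 0 \<longrightarrow>
       (\<exists>l. \<forall>x\<in>cball 0 R. \<bar>\<phi> x - (\<Sum>p\<leftarrow>l. fst p * q (snd p) x)\<bar> < e))"

text \<open>
  Monomials in the coordinates divided by \<open>R\<close>. Clipping the coordinates to \<open>[-1, 1]\<close> leaves them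
  unchanged on the ball and bounds the monomials on the whole plane.
\<close>

lemma bounded_dense_family_exists:
  assumes R: "R > 0"
  shows "\<exists>q. bounded_dense_family R q"
proof -
  define u where "u i x = max (-1) (min 1 (x $ i / R))" for i :: 2 and x :: plane
  define q where "q j x = u 1 x ^ fst (prod_decode j) * u 2 x ^ snd (prod_decode j)" for j x
  have uc: "continuous_on UNIV (u i)" for i
    unfolding u_def by (intro continuous_intros) (use R in auto)
  have ub: "\<bar>u i x\<bar> \<le> 1" for i x by (auto simp: u_def)
  have qc: "continuous_on UNIV (q j)" for j unfolding q_def by (intro continuous_intros uc)
  have qb: "\<bar>q j x\<bar> \<le> 1" for j x
    unfolding q_def abs_mult power_abs by (intro mult_le_one power_le_one ub) auto
  have "\<exists>l. \<forall>x\<in>cball 0 R. \<bar>\<phi> x - (\<Sum>p\<leftarrow>l. fst p * q (snd p) x)\<bar> < e"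
    if \<phi>: "continuous_on UNIV \<phi>" "e > 0" for \<phi> e
  proof -
    obtain l where l: "snd ` set l \<subseteq> range q" "\<And>x. x \<in> cball 0 R \<Longrightarrow> \<bar>\<phi> x - (\<Sum>p\<leftarrow>l. fst p * snd p x)\<bar> < e"
    proof (rule multiplicative_family_dense[of "cball 0 R" "range q" \<phi> e])
      show "continuous_on (cball 0 R) g" if "g \<in> range q" for g
        using that qc continuous_on_subset by blast
      have "q (prod_encode (0, 0)) = (\<lambda>_. 1)" by (simp add: q_def fun_eq_iff)
      then show "(\<lambda>_. 1) \<in> range q" by (metis rangeI)
      show "(\<lambda>x. g x * h x) \<in> range q" if gh: "g \<in> range q" "h \<in> range q" for g h
      proof -
        obtain i j where ij: "g = q i" "h = q j" using gh by blast
        have "(\<lambda>x. g x * h x) = q (prod_encode (fst (prod_decode i) + fst (prod_decode j), snd (prod_decode i) + snd (prod_decode j)))"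
          by (simp add: ij q_def fun_eq_iff power_add)
        then show ?thesis by (rule range_eqI)
      qed
      show "\<exists>g\<in>range q. g x \<noteq> g y" if xy: "x \<in> cball 0 R" "y \<in> cball 0 R" "x \<noteq> y" for x y
      proof -
        have ui: "u i z = z $ i / R" if "z \<in> cball 0 R" for z i
        proof -
          have "\<bar>z $ i\<bar> \<le> R" using component_le_norm_cart[of z i] that by simp
          then have "\<bar>z $ i / R\<bar> \<le> 1" using R by simp
          then show ?thesis unfolding u_def by linarith
        qed
        obtain i where i: "x $ i \<noteq> y $ i" using xy(3) by (auto simp: vec_eq_iff)
        have ne: "u i x \<noteq> u i y" using i R by (simp add: ui[OF xy(1)] ui[OF xy(2)])
        have q1: "q (prod_encode (1, 0)) = u 1" and q2: "q (prod_encode (0, 1)) = u 2"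
          by (simp_all add: q_def fun_eq_iff)
        have "i = 1 \<or> i = 2" using exhaust_2 by blast
        then show ?thesis
        proof
          assume "i = 1"
          then show ?thesis using ne rangeI[of q "prod_encode (1, 0)"] unfolding q1 by blast
        next
          assume "i = 2"
          then show ?thesis using ne rangeI[of q "prod_encode (0, 1)"] unfolding q2 by blast
        qed
      qed
      show "continuous_on (cball 0 R) \<phi>" using \<phi>(1) continuous_on_subset by blast
    qed (use \<phi> in auto)
    have "\<forall>p\<in>set l. \<exists>j. snd p = q j" using l(1) by auto
    then have "\<exists>J. \<forall>p\<in>set l. snd p = q (J p)" by (rule bchoice)
    then obtain J where J: "\<forall>p\<in>set l. snd p = q (J p)" by (elim exE)
    have "(\<Sum>p\<leftarrow>map (\<lambda>p. (fst p, J p)) l. fst p * q (snd p) x) = (\<Sum>p\<leftarrow>l. fst p * snd p x)" for x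
      using J by (auto simp: o_def intro!: arg_cong[where f = sum_list])
    then show ?thesis using l(2) by (intro exI[of _ "map (\<lambda>p. (fst p, J p)) l"]) auto
  qed
  then have "bounded_dense_family R q" unfolding bounded_dense_family_def using qc qb by blast
  then show ?thesis by blast
qed

section \<open>Empirical measures\<close>

text \<open>
  A configuration is a list of pairs of a species and a position; every particle has mass
  \<open>1 / length zs\<close>, whatever its species.
\<close>

definition empirical :: "(nat \<times> plane) list \<Rightarrow> nat \<Rightarrow> plane measure" where
  "empirical zs s =
     distr (density (count_space {..<length zs}) (\<lambda>i. ennreal (if fst (zs ! i) = s then 1 / length zs else 0)))
       borel (\<lambda>i. snd (zs ! i))"

lemma empirical_sets: "sets (empirical zs s) = sets borel" "space (empirical zs s) = UNIV"
  by (simp_all add: empirical_def)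

lemma empirical_emeasure:
  assumes A: "A \<in> sets borel"
  shows "emeasure (empirical zs s) A
    = (\<Sum>i<length zs. ennreal (if fst (zs ! i) = s then 1 / length zs else 0) * indicator A (snd (zs ! i)))"
proof -
  have "emeasure (empirical zs s) A = (\<integral>\<^sup>+x. indicator A x \<partial>empirical zs s)"
    using A by (simp add: empirical_sets)
  also have "\<dots> = (\<integral>\<^sup>+i. indicator A (snd (zs ! i)) \<partial>density (count_space {..<length zs}) (\<lambda>i. ennreal (if fst (zs ! i) = s then 1 / length zs else 0)))"
    unfolding empirical_def using A by (intro nn_integral_distr) auto
  also have "\<dots> = (\<integral>\<^sup>+i. ennreal (if fst (zs ! i) = s then 1 / length zs else 0) * indicator A (snd (zs ! i)) \<partial>count_space {..<length zs})"
    by (intro nn_integral_density) auto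
  also have "\<dots> = (\<Sum>i<length zs. ennreal (if fst (zs ! i) = s then 1 / length zs else 0) * indicator A (snd (zs ! i)))"
    by (rule nn_integral_count_space_finite) simp
  finally show ?thesis .
qed

lemma empirical_integral:
  fixes \<phi> :: "plane \<Rightarrow> real"
  assumes "\<phi> \<in> borel_measurable borel"
  shows "(LINT x|empirical zs s. \<phi> x) = (\<Sum>i<length zs. (if fst (zs ! i) = s then 1 / length zs else 0) * \<phi> (snd (zs ! i)))"
proof -
  have "(LINT x|empirical zs s. \<phi> x) = (LINT i|density (count_space {..<length zs}) (\<lambda>i. ennreal (if fst (zs ! i) = s then 1 / length zs else 0)). \<phi> (snd (zs ! i)))"
    unfolding empirical_def using assms by (intro integral_distr) auto
  also have "\<dots> = (LINT i|count_space {..<length zs}. (if fst (zs ! i) = s then 1 / length zs else 0) *\<^sub>R \<phi> (snd (zs ! i)))"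
    by (intro integral_density) auto
  also have "\<dots> = (\<Sum>i<length zs. (if fst (zs ! i) = s then 1 / length zs else 0) * \<phi> (snd (zs ! i)))"
    by (subst lebesgue_integral_count_space_finite) auto
  finally show ?thesis .
qed

lemma empirical_carried:
  assumes "set zs \<subseteq> {1..S} \<times> cball 0 R"
  shows "carried R (empirical zs s)" "measure (empirical zs s) UNIV \<le> 1"
proof -
  have "emeasure (empirical zs s) UNIV = (\<Sum>i<length zs. ennreal (if fst (zs ! i) = s then 1 / length zs else 0))"
    by (subst empirical_emeasure) auto
  also have "\<dots> \<le> (\<Sum>i<length zs. ennreal (1 / length zs))"
    by (intro sum_mono ennreal_leI) auto
  also have "\<dots> = ennreal (\<Sum>i<length zs. 1 / length zs)" by (intro sum_ennreal) auto
  also have "\<dots> \<le> ennreal 1" by (intro ennreal_leI) auto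
  finally have le: "emeasure (empirical zs s) UNIV \<le> ennreal 1" .
  show fin: "measure (empirical zs s) UNIV \<le> 1"
    unfolding measure_def using le by (intro enn2real_leI) auto
  have "finite_measure (empirical zs s)"
    using le by (intro finite_measureI) (auto simp: empirical_sets top_unique)
  moreover have "AE x in empirical zs s. x \<in> cball 0 R"
  proof (rule AE_I')
    have "(\<Sum>i<length zs. ennreal (if fst (zs ! i) = s then 1 / length zs else 0) * indicator (- cball 0 R) (snd (zs ! i))) = 0"
    proof (intro sum.neutral ballI)
      fix i assume "i \<in> {..<length zs}"
      then have "zs ! i \<in> {1..S} \<times> cball 0 R" using assms by (auto dest: nth_mem)
      then show "ennreal (if fst (zs ! i) = s then 1 / length zs else 0) * indicator (- cball 0 R) (snd (zs ! i)) = 0"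
        by (auto simp: mem_Times_iff)
    qed
    then show "- cball 0 R \<in> null_sets (empirical zs s)"
      by (simp add: null_sets_def empirical_sets empirical_emeasure)
  qed auto
  ultimately show "carried R (empirical zs s)" by (simp add: carried_def empirical_sets)
qed

lemma sum_list_eq_sum_nth: "(\<Sum>a\<leftarrow>zs. f a) = (\<Sum>i<length zs. f (zs ! i))"
  by (simp add: sum_list_sum_nth atLeast0LessThan)

lemma empirical_in_D_En:
  assumes zs: "set zs \<subseteq> {1..S} \<times> cball 0 R"
  shows "empirical zs \<in> D_En S (length zs)"
proof -
  define L where "L s = filter (\<lambda>a. fst a = s) zs" for s
  define N where "N s = length (L s)" for s
  define x where "x s i = snd (L s ! (i - 1))" for s i
  have "(\<Sum>s=1..S. N s) = length zs"
    using zs unfolding N_def L_def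
  proof (induction zs)
    case (Cons a zs)
    have "(\<Sum>s=1..S. length (filter (\<lambda>a. fst a = s) (a # zs)))
        = (\<Sum>s=1..S. (if fst a = s then 1 else 0) + length (filter (\<lambda>a. fst a = s) zs))"
      by (intro sum.cong) auto
    also have "\<dots> = 1 + length zs" using Cons by (simp add: sum.distrib mem_Times_iff)
    finally show ?case by simp
  qed simp
  moreover have "emeasure (empirical zs s) A =
      ennreal (1 / real (length zs)) * (\<Sum>i=1..N s. emeasure (return borel (x s i)) A)"
    if A: "A \<in> sets borel" for s A
  proof -
    have "(\<Sum>i=1..N s. emeasure (return borel (x s i)) A) = (\<Sum>i<N s. indicator A (snd (L s ! i)))"
      using A by (simp add: sum.atLeast1_atMost_eq x_def)
    also have "\<dots> = (\<Sum>a\<leftarrow>L s. indicator A (snd a))"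
      by (simp add: sum_list_eq_sum_nth N_def)
    also have "\<dots> = (\<Sum>a\<leftarrow>zs. if fst a = s then indicator A (snd a) else 0)"
      unfolding L_def by (rule sum_list_map_filter')
    also have "\<dots> = (\<Sum>i<length zs. if fst (zs ! i) = s then indicator A (snd (zs ! i)) else 0)"
      by (rule sum_list_eq_sum_nth)
    finally have "ennreal (1 / real (length zs)) * (\<Sum>i=1..N s. emeasure (return borel (x s i)) A)
       = (\<Sum>i<length zs. ennreal (1 / real (length zs)) * (if fst (zs ! i) = s then indicator A (snd (zs ! i)) else 0))"
      by (simp add: sum_distrib_left)
    also have "\<dots> = (\<Sum>i<length zs. ennreal (if fst (zs ! i) = s then 1 / length zs else 0) * indicator A (snd (zs ! i)))"
      by (intro sum.cong) auto
    finally show ?thesis using empirical_emeasure[OF A] by simp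
  qed
  ultimately show ?thesis unfolding D_En_def mem_Collect_eq
    by (intro exI[of _ N] exI[of _ x]) (auto simp: empirical_sets)
qed

text \<open>
  Summing over all species picks, for every pair of particles, the potential of their species.
\<close>

lemma empirical_interaction:
  assumes zs: "set zs \<subseteq> {1..S} \<times> cball 0 R"
    and V: "\<And>s t. s \<in> {1..S} \<Longrightarrow> t \<in> {1..S} \<Longrightarrow> V s t \<in> borel_measurable borel"
  shows "interaction S V (empirical zs) =
    (\<Sum>i<length zs. \<Sum>j<length zs. V (fst (zs ! i)) (fst (zs ! j)) (snd (zs ! i) - snd (zs ! j))) / (real (length zs))\<^sup>2"
proof -
  define n where "n = length zs"
  define p where "p s i = (if fst (zs ! i) = s then 1 / real n else 0)" for s i
  have sp: "fst (zs ! i) \<in> {1..S}" if "i < n" for i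
  proof -
    have "zs ! i \<in> {1..S} \<times> cball 0 R" using zs nth_mem[of i zs] that unfolding n_def by blast
    then show ?thesis by (simp add: mem_Times_iff)
  qed
  have st: "(LINT x|empirical zs s. LINT y|empirical zs t. V s t (x - y))
     = (\<Sum>i<n. \<Sum>j<n. p s i * (p t j * V s t (snd (zs ! i) - snd (zs ! j))))" if "s \<in> {1..S}" "t \<in> {1..S}" for s t
  proof -
    have [measurable]: "V s t \<in> borel_measurable borel" using V that by blast
    have "(LINT y|empirical zs t. V s t (x - y)) = (\<Sum>j<n. p t j * V s t (x - snd (zs ! j)))" for x
      unfolding p_def n_def by (rule empirical_integral) measurable
    then have "(LINT x|empirical zs s. LINT y|empirical zs t. V s t (x - y))
       = (LINT x|empirical zs s. (\<Sum>j<n. p t j * V s t (x - snd (zs ! j))))" by simp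
    also have "\<dots> = (\<Sum>i<n. p s i * (\<Sum>j<n. p t j * V s t (snd (zs ! i) - snd (zs ! j))))"
      unfolding p_def n_def by (rule empirical_integral) measurable
    finally show ?thesis by (simp add: sum_distrib_left)
  qed
  have pick: "(\<Sum>s=1..S. p s i * g s) = g (fst (zs ! i)) / n" if "i < n" for i and g :: "nat \<Rightarrow> real"
  proof -
    have "(\<Sum>s=1..S. p s i * g s) = (\<Sum>s=1..S. if s = fst (zs ! i) then g s / n else 0)"
      by (intro sum.cong) (auto simp: p_def)
    also have "\<dots> = g (fst (zs ! i)) / n" using sp[OF that] by (simp add: sum.delta)
    finally show ?thesis .
  qed
  have "interaction S V (empirical zs) =
     (\<Sum>s=1..S. \<Sum>t=1..S. \<Sum>i<n. \<Sum>j<n. p s i * (p t j * V s t (snd (zs ! i) - snd (zs ! j))))"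
    unfolding interaction_def by (intro sum.cong refl st)
  also have "\<dots> = (\<Sum>s=1..S. \<Sum>i<n. \<Sum>t=1..S. \<Sum>j<n. p s i * (p t j * V s t (snd (zs ! i) - snd (zs ! j))))"
    by (intro sum.cong refl sum.swap)
  also have "\<dots> = (\<Sum>i<n. \<Sum>s=1..S. \<Sum>t=1..S. \<Sum>j<n. p s i * (p t j * V s t (snd (zs ! i) - snd (zs ! j))))"
    by (rule sum.swap)
  also have "\<dots> = (\<Sum>i<n. \<Sum>s=1..S. \<Sum>j<n. \<Sum>t=1..S. p s i * (p t j * V s t (snd (zs ! i) - snd (zs ! j))))"
    by (intro sum.cong refl sum.swap)
  also have "\<dots> = (\<Sum>i<n. \<Sum>j<n. \<Sum>s=1..S. \<Sum>t=1..S. p s i * (p t j * V s t (snd (zs ! i) - snd (zs ! j))))"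
    by (intro sum.cong refl sum.swap)
  also have "\<dots> = (\<Sum>i<n. \<Sum>j<n. V (fst (zs ! i)) (fst (zs ! j)) (snd (zs ! i) - snd (zs ! j)) / n / n)"
  proof (intro sum.cong refl)
    fix i j assume "i \<in> {..<n}" "j \<in> {..<n}"
    then have ij: "i < n" "j < n" by auto
    have "(\<Sum>s=1..S. \<Sum>t=1..S. p s i * (p t j * V s t (snd (zs ! i) - snd (zs ! j))))
      = (\<Sum>s=1..S. p s i * (V s (fst (zs ! j)) (snd (zs ! i) - snd (zs ! j)) / n))"
      unfolding sum_distrib_left[symmetric] pick[OF ij(2)] ..
    also have "\<dots> = V (fst (zs ! i)) (fst (zs ! j)) (snd (zs ! i) - snd (zs ! j)) / n / n"
      by (rule pick[OF ij(1)])
    finally show "(\<Sum>s=1..S. \<Sum>t=1..S. p s i * (p t j * V s t (snd (zs ! i) - snd (zs ! j))))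
      = V (fst (zs ! i)) (fst (zs ! j)) (snd (zs ! i) - snd (zs ! j)) / n / n" .
  qed
  also have "\<dots> = (\<Sum>i<n. \<Sum>j<n. V (fst (zs ! i)) (fst (zs ! j)) (snd (zs ! i) - snd (zs ! j))) / (real n)\<^sup>2"
    by (simp add: sum_divide_distrib power2_eq_square)
  finally show ?thesis unfolding n_def .
qed

section \<open>Particle configurations of low energy close to a given measure\<close>

text \<open>
  The greedy choice is applied to the interaction plus \<open>\<kappa>\<close> times the kernel \<open>kq\<close>. This kernel is
  positive semidefinite, and summed over all pairs of particles it gives \<open>n\<^sup>2\<close> times a weighted sum of
  squared differences of the integrals of \<open>q j\<close> against the empirical measure and against \<open>\<nu>\<close>. Since its
  mean in each variable vanishes, it does not contribute to the mean on the right-hand side. The last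
  two terms on the right bound the diagonal.
\<close>

lemma sampling:
  fixes \<nu> :: "nat \<Rightarrow> plane measure" and q :: "nat \<Rightarrow> plane \<Rightarrow> real"
  assumes \<nu>: "\<And>s. s \<in> {1..S} \<Longrightarrow> carried R (\<nu> s)" "(\<Sum>s=1..S. measure (\<nu> s) UNIV) = 1"
    and V: "\<And>s t. s \<in> {1..S} \<Longrightarrow> t \<in> {1..S} \<Longrightarrow> continuous_on UNIV (V s t)"
    and q: "\<And>j. continuous_on UNIV (q j)" "\<And>j x. \<bar>q j x\<bar> \<le> 1"
    and n: "n \<ge> 1" and \<kappa>: "\<kappa> \<ge> 0"
  shows "\<exists>zs. length zs = n \<and> set zs \<subseteq> {1..S} \<times> cball 0 R \<and>
    interaction S V (empirical zs)
      + \<kappa> * (\<Sum>r=1..S. \<Sum>j<n. (1/2) ^ j * ((LINT x|empirical zs r. q j x) - (LINT x|\<nu> r. q j x))\<^sup>2)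
     \<le> (1 - 1 / n) * interaction S V \<nu> + (\<Sum>s=1..S. \<bar>V s s 0\<bar>) / n + 8 * real S * \<kappa> / n"
proof -
  define m where "m r j = (LINT x|\<nu> r. q j x)" for r j
  define \<psi> where "\<psi> r j z = (if fst z = r then q j (snd z) else 0) - m r j" for r j and z :: "nat \<times> plane"
  define kq where "kq z w = (\<Sum>r=1..S. \<Sum>j<n. (1/2) ^ j * \<psi> r j z * \<psi> r j w)" for z w
  define v where "v z w = V (fst z) (fst w) (snd z - snd w)" for z w :: "nat \<times> plane"
  \<comment> \<open>\<open>V s t\<close> and \<open>V t s\<close> are unrelated, so the potential is made symmetric by hand\<close>
  define f where "f z w = (v z w + v w z) / 2 + \<kappa> * kq z w" for z w
  define h where "h z = (\<Sum>t=1..S. LINT y|\<nu> t. f z (t, y))" for z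
  define Z where "Z = {1..S} \<times> cball (0::plane) R"
  have kqs: "kq z w = kq w z" for z w by (simp add: kq_def mult_ac)
  have fs: "f z w = f w z" for z w by (simp add: f_def kqs add.commute)
  have vc: "continuous_on UNIV (\<lambda>y. v z (t, y))" "continuous_on UNIV (\<lambda>y. v (t, y) z)"
    if "z \<in> Z" "t \<in> {1..S}" for z t
    using that unfolding v_def Z_def
    by (auto intro!: continuous_on_compose2[OF V] continuous_intros)
  have \<psi>c: "continuous_on UNIV (\<lambda>y. \<psi> r j (t, y))" for r j t
    unfolding \<psi>_def by (cases "t = r") (auto intro!: continuous_intros q(1))
  have kqc: "continuous_on UNIV (\<lambda>y. kq z (t, y))" for z t
    unfolding kq_def by (intro continuous_intros \<psi>c)
  have fc: "continuous_on UNIV (\<lambda>y. f z (t, y))" if "z \<in> Z" "t \<in> {1..S}" for z t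
    unfolding f_def by (intro continuous_intros vc that kqc) auto
  \<comment> \<open>the subtracted constant \<open>m r j\<close> is the mean, since the total mass is one\<close>
  have mean0: "(\<Sum>t=1..S. LINT y|\<nu> t. \<psi> r j (t, y)) = 0" if r: "r \<in> {1..S}" for r j
  proof -
    have "(LINT y|\<nu> t. \<psi> r j (t, y)) = (if t = r then m r j else 0) - m r j * measure (\<nu> t) UNIV"
      if t: "t \<in> {1..S}" for t
    proof -
      interpret finite_measure "\<nu> t" by (rule carriedD(1)[OF \<nu>(1)[OF t]])
      define w where "w y = (if t = r then q j y else 0)" for y
      have "continuous_on UNIV w" unfolding w_def by (cases "t = r") (simp_all add: q(1))
      then have "integrable (\<nu> t) w" by (rule carried_integrable_continuous[OF \<nu>(1)[OF t]])
      then have "(LINT y|\<nu> t. w y - m r j) = (LINT y|\<nu> t. w y) - m r j * measure (\<nu> t) UNIV"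
        by (simp add: carriedD(3)[OF \<nu>(1)[OF t]])
      moreover have "(LINT y|\<nu> t. w y) = (if t = r then m r j else 0)"
        unfolding w_def m_def by (cases "t = r") simp_all
      moreover have "\<psi> r j (t, y) = w y - m r j" for y by (simp add: \<psi>_def w_def)
      ultimately show ?thesis by simp
    qed
    then have "(\<Sum>t=1..S. LINT y|\<nu> t. \<psi> r j (t, y)) = (\<Sum>t=1..S. (if t = r then m r j else 0) - m r j * measure (\<nu> t) UNIV)"
      by (intro sum.cong refl) blast
    also have "\<dots> = m r j - m r j * (\<Sum>t=1..S. measure (\<nu> t) UNIV)"
      using r by (simp add: sum_subtractf sum_distrib_left)
    finally show ?thesis using \<nu>(2) by simp
  qed
  have kq0: "(\<Sum>t=1..S. LINT y|\<nu> t. kq z (t, y)) = 0" for z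
  proof -
    have "(\<Sum>t=1..S. LINT y|\<nu> t. kq z (t, y))
       = (\<Sum>t=1..S. \<Sum>r=1..S. \<Sum>j<n. (1/2) ^ j * \<psi> r j z * (LINT y|\<nu> t. \<psi> r j (t, y)))"
    proof (intro sum.cong refl)
      fix t assume t: "t \<in> {1..S}"
      have i: "integrable (\<nu> t) (\<lambda>y. \<psi> r j (t, y))" for r j
        by (rule carried_integrable_continuous[OF \<nu>(1)[OF t] \<psi>c])
      show "(LINT y|\<nu> t. kq z (t, y)) = (\<Sum>r=1..S. \<Sum>j<n. (1/2) ^ j * \<psi> r j z * (LINT y|\<nu> t. \<psi> r j (t, y)))"
        unfolding kq_def using i by (simp add: Bochner_Integration.integral_sum Bochner_Integration.integrable_sum)
    qed
    also have "\<dots> = (\<Sum>r=1..S. \<Sum>t=1..S. \<Sum>j<n. (1/2) ^ j * \<psi> r j z * (LINT y|\<nu> t. \<psi> r j (t, y)))"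
      by (rule sum.swap)
    also have "\<dots> = (\<Sum>r=1..S. \<Sum>j<n. \<Sum>t=1..S. (1/2) ^ j * \<psi> r j z * (LINT y|\<nu> t. \<psi> r j (t, y)))"
      by (intro sum.cong refl sum.swap)
    also have "\<dots> = (\<Sum>r=1..S. \<Sum>j<n. (1/2) ^ j * \<psi> r j z * (\<Sum>t=1..S. LINT y|\<nu> t. \<psi> r j (t, y)))"
      by (simp add: sum_distrib_left)
    also have "\<dots> = 0" by (intro sum.neutral ballI) (simp only: mean0 mult_zero_right)
    finally show ?thesis .
  qed
  have vi: "integrable (\<nu> t) (\<lambda>y. v z (t, y))" "integrable (\<nu> t) (\<lambda>y. v (t, y) z)"
    if "z \<in> Z" "t \<in> {1..S}" for z t
    using that by (auto intro!: carried_integrable_continuous[OF \<nu>(1)] vc)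
  have heq: "h z = ((\<Sum>t=1..S. LINT y|\<nu> t. v z (t, y)) + (\<Sum>t=1..S. LINT y|\<nu> t. v (t, y) z)) / 2"
    if z: "z \<in> Z" for z
  proof -
    have "h z = (\<Sum>t=1..S. (LINT y|\<nu> t. v z (t, y)) / 2 + (LINT y|\<nu> t. v (t, y) z) / 2 + \<kappa> * (LINT y|\<nu> t. kq z (t, y)))"
      unfolding h_def
    proof (intro sum.cong refl)
      fix t assume t: "t \<in> {1..S}"
      have "integrable (\<nu> t) (\<lambda>y. kq z (t, y))" by (rule carried_integrable_continuous[OF \<nu>(1)[OF t] kqc])
      then show "(LINT y|\<nu> t. f z (t, y)) = (LINT y|\<nu> t. v z (t, y)) / 2 + (LINT y|\<nu> t. v (t, y) z) / 2 + \<kappa> * (LINT y|\<nu> t. kq z (t, y))"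
        unfolding f_def using vi[OF z t] by (simp add: add_divide_distrib)
    qed
    also have "\<dots> = ((\<Sum>t=1..S. LINT y|\<nu> t. v z (t, y)) + (\<Sum>t=1..S. LINT y|\<nu> t. v (t, y) z)) / 2
        + \<kappa> * (\<Sum>t=1..S. LINT y|\<nu> t. kq z (t, y))"
      by (simp add: sum.distrib sum_distrib_left sum_divide_distrib add_divide_distrib)
    finally show ?thesis unfolding kq0 by simp
  qed
  have V': "continuous_on UNIV (\<lambda>z. V s t (- z))" if "s \<in> {1..S}" "t \<in> {1..S}" for s t
    by (rule continuous_on_compose2[OF V[OF that]]) (auto intro: continuous_intros)
  have oi1: "integrable (\<nu> s) (\<lambda>x. LINT y|\<nu> t. v (s, x) (t, y))" if "s \<in> {1..S}" "t \<in> {1..S}" for s t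
    using continuous_pair_integrable(1)[OF \<nu>(1) \<nu>(1) V, of s t s t] that by (simp add: v_def)
  have oi2: "integrable (\<nu> s) (\<lambda>x. LINT y|\<nu> t. v (t, y) (s, x))" if "s \<in> {1..S}" "t \<in> {1..S}" for s t
    using continuous_pair_integrable(1)[OF \<nu>(1) \<nu>(1) V', of s t t s] that by (simp add: v_def)
  have sw: "(LINT x|\<nu> s. LINT y|\<nu> t. v (t, y) (s, x)) = (LINT y|\<nu> t. LINT x|\<nu> s. v (t, y) (s, x))" if "s \<in> {1..S}" "t \<in> {1..S}" for s t
    using continuous_pair_integrable(2)[OF \<nu>(1) \<nu>(1) V', of s t t s] that by (simp add: v_def)
  define g where "g s x = ((\<Sum>t=1..S. LINT y|\<nu> t. v (s, x) (t, y)) + (\<Sum>t=1..S. LINT y|\<nu> t. v (t, y) (s, x))) / 2" for s x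
  have gi: "integrable (\<nu> s) (g s)" if s: "s \<in> {1..S}" for s
    unfolding g_def using oi1[OF s] oi2[OF s]
    by (intro Bochner_Integration.integrable_divide Bochner_Integration.integrable_add Bochner_Integration.integrable_sum) auto
  have hg: "h (s, x) = g s x" if "s \<in> {1..S}" "x \<in> cball 0 R" for s x
    unfolding g_def by (rule heq) (use that in \<open>simp add: Z_def\<close>)
  define H where "H = (\<Sum>s=1..S. LINT x|\<nu> s. g s x)"
  have Heq: "H = interaction S V \<nu>"
  proof -
    have "H = (\<Sum>s=1..S. ((\<Sum>t=1..S. LINT x|\<nu> s. LINT y|\<nu> t. v (s, x) (t, y)) + (\<Sum>t=1..S. LINT x|\<nu> s. LINT y|\<nu> t. v (t, y) (s, x))) / 2)"
      unfolding H_def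
    proof (intro sum.cong refl)
      fix s assume s: "s \<in> {1..S}"
      show "(LINT x|\<nu> s. g s x) = ((\<Sum>t=1..S. LINT x|\<nu> s. LINT y|\<nu> t. v (s, x) (t, y)) + (\<Sum>t=1..S. LINT x|\<nu> s. LINT y|\<nu> t. v (t, y) (s, x))) / 2"
      proof -
        have i1: "integrable (\<nu> s) (\<lambda>x. \<Sum>t=1..S. LINT y|\<nu> t. v (s, x) (t, y))"
          by (intro Bochner_Integration.integrable_sum oi1[OF s])
        have i2: "integrable (\<nu> s) (\<lambda>x. \<Sum>t=1..S. LINT y|\<nu> t. v (t, y) (s, x))"
          by (intro Bochner_Integration.integrable_sum oi2[OF s])
        have e1: "(LINT x|\<nu> s. (\<Sum>t=1..S. LINT y|\<nu> t. v (s, x) (t, y))) = (\<Sum>t=1..S. LINT x|\<nu> s. LINT y|\<nu> t. v (s, x) (t, y))"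
          by (intro Bochner_Integration.integral_sum oi1[OF s])
        have e2: "(LINT x|\<nu> s. (\<Sum>t=1..S. LINT y|\<nu> t. v (t, y) (s, x))) = (\<Sum>t=1..S. LINT x|\<nu> s. LINT y|\<nu> t. v (t, y) (s, x))"
          by (intro Bochner_Integration.integral_sum oi2[OF s])
        show ?thesis unfolding g_def integral_divide_zero Bochner_Integration.integral_add[OF i1 i2] e1 e2 ..
      qed
    qed
    also have "\<dots> = ((\<Sum>s=1..S. \<Sum>t=1..S. LINT x|\<nu> s. LINT y|\<nu> t. v (s, x) (t, y))
        + (\<Sum>s=1..S. \<Sum>t=1..S. LINT x|\<nu> s. LINT y|\<nu> t. v (t, y) (s, x))) / 2"
      by (simp add: sum.distrib sum_divide_distrib add_divide_distrib)
    also have "(\<Sum>s=1..S. \<Sum>t=1..S. LINT x|\<nu> s. LINT y|\<nu> t. v (t, y) (s, x))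
        = (\<Sum>s=1..S. \<Sum>t=1..S. LINT y|\<nu> t. LINT x|\<nu> s. v (t, y) (s, x))"
      by (intro sum.cong refl sw)
    also have "\<dots> = (\<Sum>t=1..S. \<Sum>s=1..S. LINT y|\<nu> t. LINT x|\<nu> s. v (t, y) (s, x))" by (rule sum.swap)
    finally show ?thesis by (simp add: interaction_def v_def)
  qed
  have fsi: "integrable (\<nu> s) (\<lambda>x. \<Sum>w\<leftarrow>zs. f w (s, x))" if "set zs \<subseteq> Z" and s: "s \<in> {1..S}" for zs s
    using that(1)
  proof (induction zs)
    case (Cons w zs)
    have "integrable (\<nu> s) (\<lambda>x. f w (s, x))"
      using Cons.prems by (intro carried_integrable_continuous[OF \<nu>(1)[OF s]] fc s) auto
    moreover have "integrable (\<nu> s) (\<lambda>x. \<Sum>w\<leftarrow>zs. f w (s, x))" using Cons by simp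
    ultimately show ?case by simp
  qed simp
  obtain zs where zs: "length zs = n" "set zs \<subseteq> Z"
    "(\<Sum>a\<leftarrow>zs. \<Sum>b\<leftarrow>zs. f a b) \<le> real n * (real n - 1) * H + (\<Sum>a\<leftarrow>zs. f a a)"
  proof (rule greedy_sampling[of f Z h H n])
    fix zs :: "(nat \<times> plane) list" and c :: real
    assume zs: "set zs \<subseteq> Z" and "c \<ge> 0"
    have "\<exists>z\<in>Z. (\<lambda>s x. (\<Sum>w\<leftarrow>zs. f w (s, x)) + c * g s x) (fst z) (snd z) \<le> (\<Sum>s=1..S. LINT x|\<nu> s. (\<Sum>w\<leftarrow>zs. f w (s, x)) + c * g s x)"
      unfolding Z_def
    proof (rule exists_le_mean[OF \<nu>])
      fix s assume s: "s \<in> {1..S}"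
      have "integrable (\<nu> s) (\<lambda>x. \<Sum>w\<leftarrow>zs. f w (s, x))" by (rule fsi[OF zs s])
      then show "integrable (\<nu> s) (\<lambda>x. (\<Sum>w\<leftarrow>zs. f w (s, x)) + c * g s x)" using gi[OF s] by simp
    qed
    moreover have "(\<Sum>s=1..S. LINT x|\<nu> s. (\<Sum>w\<leftarrow>zs. f w (s, x)) + c * g s x) = (\<Sum>w\<leftarrow>zs. h w) + c * H"
      using zs
    proof (induction zs)
      case Nil
      then show ?case by (simp add: H_def sum_distrib_left)
    next
      case (Cons w zs)
      have "(LINT x|\<nu> s. (\<Sum>w\<leftarrow>w # zs. f w (s, x)) + c * g s x)
          = (LINT x|\<nu> s. f w (s, x)) + (LINT x|\<nu> s. (\<Sum>w\<leftarrow>zs. f w (s, x)) + c * g s x)" if s: "s \<in> {1..S}" for s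
      proof -
        have 1: "integrable (\<nu> s) (\<lambda>x. f w (s, x))"
          using Cons.prems by (intro carried_integrable_continuous[OF \<nu>(1)[OF s]] fc s) auto
        have "integrable (\<nu> s) (\<lambda>x. \<Sum>w\<leftarrow>zs. f w (s, x))"
          using Cons.prems by (intro fsi s) auto
        then have 2: "integrable (\<nu> s) (\<lambda>x. (\<Sum>w\<leftarrow>zs. f w (s, x)) + c * g s x)" using gi[OF s] by simp
        show ?thesis using Bochner_Integration.integral_add[OF 1 2] by (simp add: add.assoc)
      qed
      then have "(\<Sum>s=1..S. LINT x|\<nu> s. (\<Sum>w\<leftarrow>w # zs. f w (s, x)) + c * g s x)
          = h w + (\<Sum>s=1..S. LINT x|\<nu> s. (\<Sum>w\<leftarrow>zs. f w (s, x)) + c * g s x)"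
        by (simp add: h_def sum.distrib)
      then show ?case using Cons by simp
    qed
    ultimately show "\<exists>z\<in>Z. (\<Sum>w\<leftarrow>zs. f w z) + c * h z \<le> (\<Sum>w\<leftarrow>zs. h w) + c * H"
      using hg by (fastforce simp: Z_def)
  qed (use fs in auto)
  have Vm: "V s t \<in> borel_measurable borel" if "s \<in> {1..S}" "t \<in> {1..S}" for s t
    using V[OF that] by (rule borel_measurable_continuous_onI)
  define z where "z i = zs ! i" for i
  have zZ: "z i \<in> Z" if "i < n" for i using zs that by (auto simp: z_def)
  define D where "D = (\<Sum>r=1..S. \<Sum>j<n. (1/2) ^ j * ((LINT x|empirical zs r. q j x) - (LINT x|\<nu> r. q j x))\<^sup>2)"
  have np: "real n > 0" using n by simp
  have \<psi>sum: "(\<Sum>i<n. \<psi> r j (z i)) = n * ((LINT x|empirical zs r. q j x) - (LINT x|\<nu> r. q j x))" for r j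
  proof -
    have "(LINT x|empirical zs r. q j x) = (\<Sum>i<n. (if fst (z i) = r then 1 / n else 0) * q j (snd (z i)))"
      unfolding z_def zs(1)[symmetric] by (rule empirical_integral[OF borel_measurable_continuous_onI[OF q(1)]])
    then have "n * (LINT x|empirical zs r. q j x) = (\<Sum>i<n. if fst (z i) = r then q j (snd (z i)) else 0)"
      using np by (auto simp: sum_distrib_left intro!: sum.cong)
    then show ?thesis by (simp add: \<psi>_def m_def sum_subtractf right_diff_distrib)
  qed
  have "(\<Sum>i<n. \<Sum>j<n. kq (z i) (z j)) = (real n)\<^sup>2 * D"
  proof -
    have "(\<Sum>i<n. \<Sum>i'<n. kq (z i) (z i')) = (\<Sum>i<n. \<Sum>r=1..S. \<Sum>i'<n. \<Sum>j<n. (1/2) ^ j * \<psi> r j (z i) * \<psi> r j (z i'))"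
      unfolding kq_def by (intro sum.cong refl sum.swap)
    also have "\<dots> = (\<Sum>r=1..S. \<Sum>i<n. \<Sum>i'<n. \<Sum>j<n. (1/2) ^ j * \<psi> r j (z i) * \<psi> r j (z i'))" by (rule sum.swap)
    also have "\<dots> = (\<Sum>r=1..S. \<Sum>i<n. \<Sum>j<n. \<Sum>i'<n. (1/2) ^ j * \<psi> r j (z i) * \<psi> r j (z i'))" by (intro sum.cong refl sum.swap)
    also have "\<dots> = (\<Sum>r=1..S. \<Sum>j<n. \<Sum>i<n. \<Sum>i'<n. (1/2) ^ j * \<psi> r j (z i) * \<psi> r j (z i'))" by (intro sum.cong refl sum.swap)
    also have "\<dots> = (\<Sum>r=1..S. \<Sum>j<n. (1/2) ^ j * (\<Sum>i<n. \<psi> r j (z i))\<^sup>2)"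
      unfolding power2_eq_square sum_product by (simp only: sum_distrib_left mult.assoc)
    also have "\<dots> = (real n)\<^sup>2 * D"
      unfolding \<psi>sum D_def by (simp add: power_mult_distrib sum_distrib_left mult_ac)
    finally show ?thesis .
  qed
  moreover have "(\<Sum>i<n. \<Sum>j<n. v (z i) (z j)) = (real n)\<^sup>2 * interaction S V (empirical zs)"
    using empirical_interaction[of zs S R V] zs(2) Vm np zs(1) unfolding Z_def v_def z_def by simp
  moreover have "(\<Sum>i<n. \<Sum>j<n. v (z j) (z i)) = (\<Sum>i<n. \<Sum>j<n. v (z i) (z j))" by (rule sum.swap)
  moreover have "(\<Sum>i<n. \<Sum>j<n. f (z i) (z j)) =
      ((\<Sum>i<n. \<Sum>j<n. v (z i) (z j)) + (\<Sum>i<n. \<Sum>j<n. v (z j) (z i))) / 2 + \<kappa> * (\<Sum>i<n. \<Sum>j<n. kq (z i) (z j))"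
    by (simp add: f_def sum.distrib sum_distrib_left sum_divide_distrib add_divide_distrib)
  ultimately have lhs: "(\<Sum>a\<leftarrow>zs. \<Sum>b\<leftarrow>zs. f a b) = (real n)\<^sup>2 * (interaction S V (empirical zs) + \<kappa> * D)"
    by (simp add: sum_list_eq_sum_nth zs(1) z_def algebra_simps)
  have \<psi>b: "\<bar>\<psi> r j w\<bar> \<le> 2" if r: "r \<in> {1..S}" for r j w
  proof -
    have "measure (\<nu> r) UNIV \<le> (\<Sum>s=1..S. measure (\<nu> s) UNIV)" by (rule member_le_sum[OF r]) auto
    then have "measure (\<nu> r) UNIV \<le> 1" using \<nu>(2) by simp
    moreover have "\<bar>m r j\<bar> \<le> 1 * measure (\<nu> r) (space (\<nu> r))"
      unfolding m_def by (rule integral_abs_le_mass[OF carriedD(1)[OF \<nu>(1)[OF r]]]) (use q(2) in auto)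
    ultimately have "\<bar>m r j\<bar> \<le> 1" using carriedD(3)[OF \<nu>(1)[OF r]] by simp
    then show ?thesis using q(2)[of j "snd w"] unfolding \<psi>_def by (auto simp: abs_le_iff)
  qed
  have kqb: "kq w w \<le> 8 * real S" for w
  proof -
    have "kq w w \<le> (\<Sum>r=1..S. \<Sum>j<n. (1/2) ^ j * 4)"
      unfolding kq_def
    proof (intro sum_mono)
      fix r j assume r: "r \<in> {1..S}"
      have "\<bar>\<psi> r j w\<bar>\<^sup>2 \<le> 2\<^sup>2" using \<psi>b[OF r] by (intro power_mono) auto
      then have "\<psi> r j w * \<psi> r j w \<le> 4" by (simp add: power2_eq_square)
      then show "(1/2) ^ j * \<psi> r j w * \<psi> r j w \<le> (1/2) ^ j * 4"
        unfolding mult.assoc by (intro mult_left_mono) auto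
    qed
    also have "\<dots> = S * (4 * (\<Sum>j<n. (1/2) ^ j))" by (simp add: sum_distrib_left mult.commute)
    also have "\<dots> \<le> real S * (4 * 2)"
    proof (intro mult_left_mono)
      show "(\<Sum>j<n. (1/2::real) ^ j) \<le> 2" by (subst sum_gp_strict) auto
    qed auto
    finally show ?thesis by simp
  qed
  have fb: "f w w \<le> (\<Sum>s=1..S. \<bar>V s s 0\<bar>) + 8 * real S * \<kappa>" if w: "w \<in> Z" for w
  proof -
    have "v w w \<le> \<bar>V (fst w) (fst w) 0\<bar>" by (simp add: v_def)
    also have "\<dots> \<le> (\<Sum>s=1..S. \<bar>V s s 0\<bar>)"
      by (rule member_le_sum[of "fst w" "{1..S}" "\<lambda>s. \<bar>V s s 0\<bar>"]) (use w in \<open>auto simp: Z_def\<close>)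
    finally have "v w w \<le> (\<Sum>s=1..S. \<bar>V s s 0\<bar>)" .
    moreover have "\<kappa> * kq w w \<le> \<kappa> * (8 * real S)" by (intro mult_left_mono kqb \<kappa>)
    ultimately show ?thesis by (simp add: f_def mult_ac)
  qed
  define C where "C = (\<Sum>s=1..S. \<bar>V s s 0\<bar>) + 8 * real S * \<kappa>"
  have "(\<Sum>a\<leftarrow>zs. f a a) = (\<Sum>i<n. f (z i) (z i))" by (simp add: sum_list_eq_sum_nth zs(1) z_def)
  also have "\<dots> \<le> (\<Sum>i<n. C)" unfolding C_def by (intro sum_mono fb zZ) auto
  finally have "(\<Sum>a\<leftarrow>zs. f a a) \<le> n * C" by simp
  with zs(3) have "(real n)\<^sup>2 * (interaction S V (empirical zs) + \<kappa> * D) \<le> real n * (real n - 1) * H + n * C"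
    unfolding lhs by linarith
  also have "\<dots> = (real n)\<^sup>2 * ((1 - 1 / n) * H + C / n)"
    using np by (simp add: field_simps power2_eq_square)
  finally have "interaction S V (empirical zs) + \<kappa> * D \<le> (1 - 1 / n) * H + C / n"
    using np by simp
  then have "interaction S V (empirical zs) + \<kappa> * D
     \<le> (1 - 1 / n) * interaction S V \<nu> + (\<Sum>s=1..S. \<bar>V s s 0\<bar>) / n + 8 * real S * \<kappa> / n"
    unfolding Heq C_def by (simp add: add_divide_distrib)
  then show ?thesis using zs(1,2) unfolding Z_def D_def by (intro exI[of _ zs] conjI)
qed

section \<open>Supports and diagonal sequences\<close>

text \<open>
  The complement of the support is a union of open null sets, and by the Lindelof property countably
  many of them suffice.
\<close>

lemma msupp_subset_carried:
  assumes \<mu>: "\<mu> \<in> finite_borel_measures" and s: "msupp \<mu> \<subseteq> cball 0 R"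
  shows "carried R \<mu>"
proof -
  have sets: "sets \<mu> = sets borel" "finite_measure \<mu>" using \<mu> by (auto simp: finite_borel_measures_def)
  define F where "F = {G :: plane set. open G \<and> emeasure \<mu> G = 0}"
  obtain F' where F': "F' \<subseteq> F" "countable F'" "\<Union>F' = \<Union>F"
    by (rule Lindelof[of F]) (auto simp: F_def)
  have "G \<in> null_sets \<mu>" if "G \<in> F'" for G
    using that F'(1) sets by (auto simp: F_def null_sets_def)
  then have "\<Union>F' \<in> null_sets \<mu>" using F'(2) by (intro null_sets_UN'[where N = "\<lambda>G. G", simplified]) auto
  moreover have "{x \<in> space \<mu>. \<not> x \<in> cball 0 R} \<subseteq> \<Union>F'"
  proof
    fix x assume "x \<in> {x \<in> space \<mu>. \<not> x \<in> cball 0 R}"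
    then have "x \<notin> msupp \<mu>" using s by auto
    then obtain G where "open G" "x \<in> G" "emeasure \<mu> G = 0"
      unfolding msupp_def using zero_less_iff_neq_zero by auto
    then show "x \<in> \<Union>F'" unfolding F'(3) F_def by auto
  qed
  ultimately have "AE x in \<mu>. x \<in> cball 0 R" by (rule AE_I')
  then show ?thesis using sets by (simp add: carried_def)
qed

lemma carried_msupp_subset:
  assumes "carried R \<mu>"
  shows "msupp \<mu> \<subseteq> cball 0 R"
proof (rule subsetI, rule ccontr)
  fix x assume x: "x \<in> msupp \<mu>" "x \<notin> cball 0 R"
  have "- cball 0 R \<in> sets \<mu>" using carriedD(2)[OF assms] by simp
  then have "emeasure \<mu> (- cball 0 R) = 0"
    using carriedD(4)[OF assms] carriedD(3)[OF assms] by (subst (asm) AE_iff_measurable[of "- cball 0 R"]) auto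
  moreover have "emeasure \<mu> (- cball 0 R) > 0"
  proof -
    have "open (- cball (0::plane) R)" "x \<in> - cball 0 R" using x(2) by (simp_all only: open_Compl closed_cball Compl_iff not_False_eq_True)
    then show ?thesis using x(1) unfolding msupp_def by blast
  qed
  ultimately show False by simp
qed

lemma D_En_finite_borel:
  assumes "\<mu> \<in> D_En S n" "s \<in> {1..S}"
  shows "\<mu> s \<in> finite_borel_measures"
proof -
  obtain N and x :: "nat \<Rightarrow> nat \<Rightarrow> plane" where Nx: "\<forall>s\<in>{1..S}. sets (\<mu> s) = sets borel \<and>
      (\<forall>A\<in>sets borel. emeasure (\<mu> s) A =
         ennreal (1 / real n) * (\<Sum>i=1..N s. emeasure (return borel (x s i)) A))"
    using assms(1) unfolding D_En_def mem_Collect_eq by (elim exE conjE)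
  have *: "sets (\<mu> s) = sets borel" "\<And>A. A \<in> sets borel \<Longrightarrow> emeasure (\<mu> s) A =
      ennreal (1 / real n) * (\<Sum>i=1..N s. emeasure (return borel (x s i)) A)"
    using bspec[OF Nx assms(2)] by auto
  have "emeasure (\<mu> s) (space (\<mu> s)) = ennreal (1 / real n) * (\<Sum>i=1..N s. 1)"
    using *(2)[of UNIV] sets_eq_imp_space_eq[OF *(1)] by simp
  also have "\<dots> < \<infinity>" by (simp add: ennreal_mult_less_top of_nat_less_top)
  finally have "finite_measure (\<mu> s)" by (intro finite_measureI) simp
  then show ?thesis using *(1) by (simp add: finite_borel_measures_def)
qed

lemma bounded_msupp_carried:
  fixes S :: nat and \<mu> :: "nat \<Rightarrow> plane measure"
  assumes "bounded (\<Union>s\<in>{1..S}. msupp (\<mu> s))" "\<And>s. s \<in> {1..S} \<Longrightarrow> \<mu> s \<in> finite_borel_measures"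
  shows "\<exists>R>0. \<forall>s\<in>{1..S}. carried R (\<mu> s)"
proof -
  have "\<exists>a>0. \<forall>x\<in>\<Union>s\<in>{1..S}. msupp (\<mu> s). norm x \<le> a" using assms(1) by (simp only: bounded_pos)
  then obtain a where a: "a > 0" "\<forall>x\<in>\<Union>s\<in>{1..S}. msupp (\<mu> s). norm x \<le> a" by blast
  have "carried a (\<mu> s)" if "s \<in> {1..S}" for s
    using a(2) that by (intro msupp_subset_carried assms(2)) auto
  then show ?thesis using a(1) by blast
qed

text \<open>
  The index \<open>g i\<close> is the largest \<open>m \<le> i\<close> such that \<open>P m\<close> holds from some index not exceeding \<open>i\<close> on.
\<close>

lemma diagonal_index:
  assumes "\<And>m. eventually (P m) sequentially"
  obtains g :: "nat \<Rightarrow> nat" where "filterlim g at_top sequentially" "eventually (\<lambda>i. P (g i) i) sequentially"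
proof -
  have "\<forall>m. \<exists>N. \<forall>i\<ge>N. P m i" using assms by (simp add: eventually_sequentially)
  then have "\<exists>N. \<forall>m. \<forall>i\<ge>N m. P m i" by (rule choice)
  then obtain N where "\<forall>m. \<forall>i\<ge>N m. P m i" by (elim exE)
  then have N: "\<And>m i. i \<ge> N m \<Longrightarrow> P m i" by simp
  define A where "A i = {m. m \<le> i \<and> N m \<le> i}" for i
  have fin: "finite (A i)" for i by (rule finite_subset[of _ "{..i}"]) (auto simp: A_def)
  define g where "g i = Max (A i)" for i
  have "\<forall>\<^sub>F i in sequentially. m \<le> g i" for m
    using eventually_ge_at_top[of "max m (N m)"]
  proof eventually_elim
    case (elim i)
    then have "m \<in> A i" by (simp add: A_def)
    then show ?case unfolding g_def by (rule Max_ge[OF fin])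
  qed
  then have 1: "filterlim g at_top sequentially" by (simp add: filterlim_at_top)
  have 2: "\<forall>\<^sub>F i in sequentially. P (g i) i"
    using eventually_ge_at_top[of "N 0"]
  proof eventually_elim
    case (elim i)
    then have "0 \<in> A i" by (simp add: A_def)
    then have "g i \<in> A i" unfolding g_def by (intro Max_in fin) auto
    then show ?case by (intro N) (simp add: A_def)
  qed
  show ?thesis by (rule that[OF 1 2])
qed

lemma L2_norm_sq_nonneg: "(L2_norm f)\<^sup>2 \<ge> 0"
  by (simp add: L2_norm_sq integral_nonneg_AE)

lemma narrow_conv_Suc_iff: "narrow_conv (\<lambda>n. \<nu> (Suc n)) \<mu> \<longleftrightarrow> narrow_conv \<nu> \<mu>"
proof -
  have "(\<lambda>n. LINT x|\<nu> (Suc n). \<phi> x) \<longlonglongrightarrow> l \<longleftrightarrow> (\<lambda>n. LINT x|\<nu> n. \<phi> x) \<longlonglongrightarrow> l" for \<phi> :: "plane \<Rightarrow> real" and l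
    by (rule filterlim_sequentially_Suc)
  then show ?thesis unfolding narrow_conv_def by (simp only:)
qed

lemma narrow_conv_dense_family:
  fixes q :: "nat \<Rightarrow> plane \<Rightarrow> real"
  assumes \<nu>: "\<And>i. carried R (\<nu> i)" "carried R \<mu>" "\<And>i. measure (\<nu> i) UNIV \<le> 1" "measure \<mu> UNIV \<le> 1"
    and fam: "bounded_dense_family R q"
    and lim: "\<And>j. (\<lambda>i. LINT x|\<nu> i. q j x) \<longlonglongrightarrow> (LINT x|\<mu>. q j x)"
  shows "narrow_conv \<nu> \<mu>"
  unfolding narrow_conv_def
proof (intro allI impI LIMSEQ_I)
  fix \<phi> :: "plane \<Rightarrow> real" and e :: real
  assume "continuous_on UNIV \<phi> \<and> bounded (range \<phi>)" and e: "0 < e"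
  then have \<phi>: "continuous_on UNIV \<phi>" by simp
  have q: "continuous_on UNIV (q j)" for j using fam by (simp add: bounded_dense_family_def)
  have "\<exists>l. \<forall>x\<in>cball 0 R. \<bar>\<phi> x - (\<Sum>p\<leftarrow>l. fst p * q (snd p) x)\<bar> < e / 4"
    using fam \<phi> e unfolding bounded_dense_family_def by (elim conjE allE[of _ \<phi>] allE[of _ "e / 4"]) simp
  then obtain l where "\<forall>x\<in>cball 0 R. \<bar>\<phi> x - (\<Sum>p\<leftarrow>l. fst p * q (snd p) x)\<bar> < e / 4" by (elim exE)
  then have l: "\<And>x. x \<in> cball 0 R \<Longrightarrow> \<bar>\<phi> x - (\<Sum>p\<leftarrow>l. fst p * q (snd p) x)\<bar> < e / 4" by blast
  define p where "p x = (\<Sum>p\<leftarrow>l. fst p * q (snd p) x)" for x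
  have pc: "continuous_on UNIV p" unfolding p_def
    by (induction l) (auto intro!: continuous_on_add continuous_on_mult continuous_on_const q)
  have pint: "(LINT x|\<rho>. p x) = (\<Sum>p\<leftarrow>l. fst p * (LINT x|\<rho>. q (snd p) x))" if c: "carried R \<rho>" for \<rho>
  proof -
    have "(LINT x|\<rho>. p x) = (\<Sum>p\<leftarrow>l. fst p * (LINT x|\<rho>. q (snd p) x)) \<and> integrable \<rho> p"
      unfolding p_def
      by (induction l) (use carried_integrable_continuous[OF c q] in auto)
    then show ?thesis by simp
  qed
  have "(\<lambda>i. \<Sum>p\<leftarrow>l. fst p * (LINT x|\<nu> i. q (snd p) x)) \<longlonglongrightarrow> (\<Sum>p\<leftarrow>l. fst p * (LINT x|\<mu>. q (snd p) x))"
    by (induction l) (auto intro!: tendsto_intros lim)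
  then have "(\<lambda>i. LINT x|\<nu> i. p x) \<longlonglongrightarrow> (LINT x|\<mu>. p x)" using pint \<nu> by simp
  then have "\<forall>\<^sub>F i in sequentially. dist (LINT x|\<nu> i. p x) (LINT x|\<mu>. p x) < e / 4"
    using e by (intro tendstoD) auto
  then obtain i0 where i0: "\<And>i. i \<ge> i0 \<Longrightarrow> dist (LINT x|\<nu> i. p x) (LINT x|\<mu>. p x) < e / 4"
    unfolding eventually_sequentially by blast
  have close: "\<bar>(LINT x|\<rho>. \<phi> x) - (LINT x|\<rho>. p x)\<bar> \<le> e / 4" if c: "carried R \<rho>" "measure \<rho> UNIV \<le> 1" for \<rho>
  proof -
    have "AE x in \<rho>. \<bar>\<phi> x - p x\<bar> \<le> e / 4"
      using carriedD(4)[OF c(1)] by eventually_elim (use l in \<open>auto simp: p_def intro: less_imp_le\<close>)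
    then have "\<bar>LINT x|\<rho>. \<phi> x - p x\<bar> \<le> e / 4 * measure \<rho> (space \<rho>)"
      by (rule integral_abs_le_mass[OF carriedD(1)[OF c(1)]]) (use e in simp)
    also have "\<dots> \<le> e / 4 * 1" using c e carriedD(3)[OF c(1)] by (intro mult_left_mono) auto
    finally show ?thesis
      using carried_integrable_continuous[OF c(1) \<phi>] carried_integrable_continuous[OF c(1) pc] by simp
  qed
  have "norm ((LINT x|\<nu> i. \<phi> x) - (LINT x|\<mu>. \<phi> x)) < e" if "i \<ge> i0" for i
    using close[OF \<nu>(1)[of i] \<nu>(3)[of i]] close[OF \<nu>(2,4)] i0[OF that] e unfolding dist_real_def real_norm_def by linarith
  then show "\<exists>no. \<forall>i\<ge>no. norm ((LINT x|\<nu> i. \<phi> x) - (LINT x|\<mu>. \<phi> x)) < e" by blast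
qed

section \<open>The two inequalities\<close>

lemma assumption_AD:
  assumes "assumption_A S K V Vreg W" "s \<in> {1..S}" "t \<in> {1..S}"
  shows "AE x in lborel. V s t x = (\<Sum>k=1..K. conv (reflect (W k s)) (W k t) x) + Vreg s t x"
    "continuous_on UNIV (Vreg s t)" "continuous_on (UNIV - {0}) (V s t)"
  using assms by (simp_all add: assumption_A_def)

lemma assumption_A_integrable:
  assumes "assumption_A S K V Vreg W" "k \<in> {1..K}" "s \<in> {1..S}"
  shows "integrable lborel (W k s)"
  using assms by (simp add: assumption_A_def)

lemma assumption_BD:
  assumes "assumption_B S K V Vreg W V\<delta> Vreg\<delta> W\<delta>" "d > 0" "s \<in> {1..S}" "t \<in> {1..S}"
  shows "AE x in lborel. V\<delta> d s t x = (\<Sum>k=1..K. conv (reflect (W\<delta> d k s)) (W\<delta> d k t) x) + Vreg\<delta> d s t x"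
    "continuous_on UNIV (V\<delta> d s t)" "continuous_on UNIV (Vreg\<delta> d s t)"
  using assms by (simp_all add: assumption_B_def)

lemma assumption_B_integrable:
  assumes "assumption_B S K V Vreg W V\<delta> Vreg\<delta> W\<delta>" "d > 0" "k \<in> {1..K}" "s \<in> {1..S}"
  shows "integrable lborel (W\<delta> d k s)"
  using assms by (simp add: assumption_B_def)

lemma assumption_B_annuli:
  assumes "assumption_B S K V Vreg W V\<delta> Vreg\<delta> W\<delta>" "s \<in> {1..S}" "t \<in> {1..S}" "0 < \<epsilon>" "\<epsilon> < 1"
  shows "uniform_limit (ball 0 (1 / \<epsilon>) - ball 0 \<epsilon>) (\<lambda>\<delta>. V\<delta> \<delta> s t) (V s t) (at_right 0)"
  using assms by (simp add: assumption_B_def)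

lemma assumption_B_conv:
  assumes "assumption_B S K V Vreg W V\<delta> Vreg\<delta> W\<delta>" "k \<in> {1..K}" "s \<in> {1..S}" "test_function \<phi>" "compact C"
  shows "uniform_limit C (\<lambda>\<delta>. conv (W\<delta> \<delta> k s) \<phi>) (conv (W k s) \<phi>) (at_right 0)"
  using assms by (simp add: assumption_B_def tendsto_Cloc_def)

lemma assumption_B_Vreg:
  assumes "assumption_B S K V Vreg W V\<delta> Vreg\<delta> W\<delta>" "s \<in> {1..S}" "t \<in> {1..S}" "compact C"
  shows "uniform_limit C (\<lambda>\<delta>. Vreg\<delta> \<delta> s t) (Vreg s t) (at_right 0)"
  using assms by (simp add: assumption_B_def tendsto_Cloc_def)

lemma assumption_B_majorant:
  assumes "assumption_B S K V Vreg W V\<delta> Vreg\<delta> W\<delta>" "s \<in> {1..S}" "t \<in> {1..S}"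
  shows "\<exists>U. radial_majorant U \<and> (\<forall>x \<in> ball 0 1 - {0}. \<forall>\<delta>. 0 < \<delta> \<and> \<delta> < 1 \<longrightarrow> \<bar>V\<delta> \<delta> s t x\<bar> \<le> U x)"
  using assms by (simp add: assumption_B_def)

lemma interaction_lower_bound:
  fixes \<nu> :: "nat \<Rightarrow> plane measure"
  assumes \<nu>: "\<And>s. carried R (\<nu> s)" "\<And>s. measure (\<nu> s) UNIV \<le> 1"
    and V: "\<And>s t. s \<in> {1..S} \<Longrightarrow> t \<in> {1..S} \<Longrightarrow> V s t \<in> borel_measurable borel"
      "\<And>s t z. s \<in> {1..S} \<Longrightarrow> t \<in> {1..S} \<Longrightarrow> z \<in> cball 0 (2 * R) \<Longrightarrow> \<bar>V s t z\<bar> \<le> b s t"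
    and b: "\<And>s t. s \<in> {1..S} \<Longrightarrow> t \<in> {1..S} \<Longrightarrow> b s t \<ge> 0"
  shows "- (\<Sum>s=1..S. \<Sum>t=1..S. b s t) \<le> interaction S V \<nu>"
proof -
  have one: "- b s t \<le> (LINT x|\<nu> s. LINT y|\<nu> t. V s t (x - y))" if st: "s \<in> {1..S}" "t \<in> {1..S}" for s t
  proof -
    have nx: "x - y \<in> cball 0 (2 * R)" if "x \<in> cball 0 R" "y \<in> cball 0 R" for x y :: plane
      using that norm_triangle_ineq4[of x y] by simp
    have "\<bar>(LINT x|\<nu> s. LINT y|\<nu> t. V s t (x - y)) - (LINT x|\<nu> s. LINT y|\<nu> t. 0)\<bar>
        \<le> b s t * measure (\<nu> t) UNIV * measure (\<nu> s) UNIV"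
      using V(2)[OF st nx]
      by (intro carried_iterated_bound[OF \<nu>(1) \<nu>(1) b[OF st] diff_measurable[OF V(1)[OF st]], where B = 0]) auto
    also have "\<dots> \<le> b s t * 1 * 1"
      using \<nu>(2) b[OF st] by (intro mult_mono mult_nonneg_nonneg) auto
    finally show ?thesis by simp
  qed
  have "- (\<Sum>s=1..S. \<Sum>t=1..S. b s t) = (\<Sum>s=1..S. \<Sum>t=1..S. - b s t)" by (simp add: sum_negf)
  also have "\<dots> \<le> interaction S V \<nu>" unfolding interaction_def by (intro sum_mono one)
  finally show ?thesis .
qed

text \<open>
  The measures are fixed and have bounded densities, so the diagonal singularity of the limit is
  integrable.
\<close>

lemma regularised_interaction_tendsto:
  fixes \<nu> :: "nat \<Rightarrow> plane measure"
  assumes A: "assumption_A S K V Vreg W" and B: "assumption_B S K V Vreg W V\<delta> Vreg\<delta> W\<delta>"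
    and \<delta>: "\<And>i. \<delta> i > 0" "\<delta> \<longlonglongrightarrow> 0" and R: "R > 0"
    and \<nu>: "\<And>s. s \<in> {1..S} \<Longrightarrow> carried R (\<nu> s)" "\<And>s. s \<in> {1..S} \<Longrightarrow> dominated c (\<nu> s)"
  shows "(\<lambda>i. interaction S (V\<delta> (\<delta> i)) \<nu>) \<longlonglongrightarrow> interaction S V \<nu>"
  unfolding interaction_def
proof (intro tendsto_sum)
  fix s t assume st: "s \<in> {1..S}" "t \<in> {1..S}"
  have \<delta>lim: "filterlim \<delta> (at_right 0) sequentially"
    using \<delta> less_imp_neq[OF \<delta>(1)] by (simp add: filterlim_at)
  obtain U where U: "radial_majorant U" "\<And>x \<delta>. x \<in> ball 0 1 - {0} \<Longrightarrow> 0 < \<delta> \<Longrightarrow> \<delta> < 1 \<Longrightarrow> \<bar>V\<delta> \<delta> s t x\<bar> \<le> U x"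
    using assumption_B_majorant[OF B st] by blast
  \<comment> \<open>the majorant is only available for parameters below \<open>1\<close>, hence the shift by \<open>i1\<close>\<close>
  have "\<forall>\<^sub>F i in sequentially. \<delta> i < 1" using \<delta>(2) by (rule order_tendstoD) simp
  then obtain i1 where i1: "\<And>i. i \<ge> i1 \<Longrightarrow> \<delta> i < 1" unfolding eventually_sequentially by blast
  have "(\<lambda>i. LINT x|\<nu> s. LINT y|\<nu> t. V\<delta> (\<delta> (i + i1)) s t (x - y)) \<longlonglongrightarrow> (LINT x|\<nu> s. LINT y|\<nu> t. V s t (x - y))"
  proof (rule singular_pair_tendsto[OF \<nu>(1)[OF st(1)] \<nu>(1)[OF st(2)] \<nu>(2)[OF st(2)] R assumption_AD(3)[OF A st]])
    show "set_integrable lborel (cball 0 1) U" using U(1) unfolding radial_majorant_def by auto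
    show "\<bar>V\<delta> (\<delta> (i + i1)) s t z\<bar> \<le> U z" if "z \<in> ball 0 1 - {0}" for i z
      by (rule U(2)[OF that \<delta>(1) i1]) simp
    show "uniform_limit (ball 0 (1 / \<epsilon>) - ball 0 \<epsilon>) (\<lambda>i. V\<delta> (\<delta> (i + i1)) s t) (V s t) sequentially"
      if "0 < \<epsilon>" "\<epsilon> < 1" for \<epsilon>
      by (rule filterlim_compose[OF filterlim_compose[OF assumption_B_annuli[OF B st that] \<delta>lim] filterlim_add_const_nat_at_top])
  qed (rule assumption_BD(2)[OF B \<delta>(1) st])
  then show "(\<lambda>i. LINT x|\<nu> s. LINT y|\<nu> t. V\<delta> (\<delta> i) s t (x - y)) \<longlonglongrightarrow> (LINT x|\<nu> s. LINT y|\<nu> t. V s t (x - y))"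
    by (rule LIMSEQ_offset)
qed

text \<open>
  The interaction of an averaged measure is its energy. The quadratic part of this energy is at most
  that of \<open>\<mu>\<close>, and the regular part converges to that of \<open>\<mu>\<close>.
\<close>

lemma interaction_smooth_bound:
  fixes \<mu> :: "nat \<Rightarrow> plane measure" and r :: "nat \<Rightarrow> real"
  assumes A: "assumption_A S K V Vreg W"
    and \<mu>: "\<And>s. s \<in> {1..S} \<Longrightarrow> carried R (\<mu> s)" and fin: "energy S K Vreg W \<mu> \<noteq> \<infinity>"
    and r: "\<And>m. r m > 0" "\<And>m. r m \<le> 1" "r \<longlonglongrightarrow> 0"
  shows "\<exists>b e. energy S K Vreg W \<mu> = ereal e \<and> b \<longlonglongrightarrow> e \<and>
           (\<forall>m. interaction S V (\<lambda>s. smooth (r m) (\<mu> s)) \<le> b m)"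
proof -
  define Q where "Q = (\<Sum>k=1..K. (L2_norm (\<lambda>x. \<Sum>s=1..S. conv_measure (W k s) (\<mu> s) x))\<^sup>2)"
  have E: "energy S K Vreg W \<mu> = ereal (interaction S Vreg \<mu>) + Q" by (simp add: energy_alt Q_def)
  have "Q \<ge> 0" unfolding Q_def by (intro sum_nonneg L2_norm_sq_nonneg)
  moreover have "Q \<noteq> \<infinity>" using fin E by auto
  ultimately obtain Q' where Q': "Q = ereal Q'" by (cases Q) auto
  define b where "b m = interaction S Vreg (\<lambda>s. smooth (r m) (\<mu> s)) + Q'" for m
  have c: "carried (R + 1) (smooth (r m) (\<mu> s))" if "s \<in> {1..S}" for m s
    using carried_mono[OF smooth_carried[OF \<mu>[OF that] r(1)]] r(2)[of m] by simp
  have c': "carried (R + 1) (\<mu> s)" if "s \<in> {1..S}" for s using carried_mono[OF \<mu>[OF that]] by simp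
  have le: "interaction S V (\<lambda>s. smooth (r m) (\<mu> s)) \<le> b m" for m
  proof -
    have "ereal (interaction S V (\<lambda>s. smooth (r m) (\<mu> s))) = energy S K Vreg W (\<lambda>s. smooth (r m) (\<mu> s))"
    proof (rule energy_eq_interaction[where R = "R + 1", symmetric])
      show "V s t \<in> borel_measurable borel" if "s \<in> {1..S}" "t \<in> {1..S}" for s t
        by (rule punctured_continuous_measurable[OF assumption_AD(3)[OF A that]])
    qed (rule c smooth_dominated_family[OF \<mu> r(1)] assumption_AD(1)[OF A] assumption_AD(2)[OF A]
        assumption_A_integrable[OF A]; assumption)+
    also have "\<dots> \<le> ereal (interaction S Vreg (\<lambda>s. smooth (r m) (\<mu> s))) + Q"
      unfolding Q_def by (rule energy_smooth_le[OF \<mu> r(1) assumption_A_integrable[OF A]])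
    finally show ?thesis by (simp add: Q' b_def)
  qed
  have "b \<longlonglongrightarrow> interaction S Vreg \<mu> + Q'"
    unfolding b_def
    by (intro tendsto_add tendsto_const interaction_tendsto[where R = "R + 1"] c c' smooth_narrow[OF \<mu> r(1,3)]
        assumption_AD(2)[OF A])
  then show ?thesis using le by (intro exI[of _ b] exI[of _ "interaction S Vreg \<mu> + Q'"]) (simp add: E Q')
qed

text \<open>
  Configurations with \<open>Suc i\<close> particles are sampled from the average of \<open>\<mu>\<close> over balls of radius
  \<open>r (g i)\<close>, where \<open>g\<close> grows slowly. The weight \<open>\<kappa> i\<close> of the discrepancy is the square root of the number
  of particles: energies that are small compared with it force the discrepancy to vanish, and since
  it grows more slowly than the number of particles, the diagonal of the penalty is negligible.
\<close>

lemma recovery_sequence: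
  fixes \<mu> :: "nat \<Rightarrow> plane measure" and \<delta> :: "nat \<Rightarrow> real"
  assumes A: "assumption_A S K V Vreg W" and B: "assumption_B S K V Vreg W V\<delta> Vreg\<delta> W\<delta>"
    and \<delta>: "\<And>i. \<delta> i > 0" "\<delta> \<longlonglongrightarrow> 0"
    and \<gamma>: "\<And>s. s \<in> {1..S} \<Longrightarrow> (\<lambda>i. \<bar>V\<delta> (\<delta> i) s s 0\<bar> / real (Suc i)) \<longlonglongrightarrow> 0"
    and \<mu>: "\<And>s. s \<in> {1..S} \<Longrightarrow> carried R (\<mu> s)" "(\<Sum>s=1..S. measure (\<mu> s) UNIV) = 1" and R: "R > 0"
  shows "\<exists>zs :: nat \<Rightarrow> (nat \<times> plane) list. (\<forall>i. length (zs i) = Suc i \<and> set (zs i) \<subseteq> {1..S} \<times> cball 0 (R + 1)) \<and>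
    (\<forall>s\<in>{1..S}. narrow_conv (\<lambda>i. empirical (zs i) s) (\<mu> s)) \<and>
    limsup (\<lambda>i. energy S K (Vreg\<delta> (\<delta> i)) (W\<delta> (\<delta> i)) (empirical (zs i))) \<le> energy S K Vreg W \<mu>"
proof -
  have \<delta>lim: "filterlim \<delta> (at_right 0) sequentially"
    using \<delta> less_imp_neq[OF \<delta>(1)] by (simp add: filterlim_at)
  note A' = assumption_AD[OF A]
  note B1 = assumption_BD[OF B \<delta>(1)]
  note BW = assumption_B_integrable[OF B \<delta>(1)]
  have B3: "uniform_limit C (\<lambda>i. Vreg\<delta> (\<delta> i) s t) (Vreg s t) sequentially"
    if "s \<in> {1..S}" "t \<in> {1..S}" "compact C" for s t C
    by (rule filterlim_compose[OF assumption_B_Vreg[OF B that] \<delta>lim])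
  define R1 where "R1 = R + 1"
  have R1: "R1 > 0" using R by (simp add: R1_def)
  define r :: "nat \<Rightarrow> real" where "r m = 1 / real (Suc m)" for m
  have r: "r m > 0" "r m \<le> 1" for m by (auto simp: r_def)
  have r0: "r \<longlonglongrightarrow> 0" unfolding r_def by (rule LIMSEQ_Suc[OF lim_1_over_n])
  define \<nu> where "\<nu> m s = smooth (r m) (\<mu> s)" for m s
  have \<nu>c: "carried R1 (\<nu> m s)" if "s \<in> {1..S}" for m s
    unfolding \<nu>_def R1_def using carried_mono[OF smooth_carried[OF \<mu>(1)[OF that] r(1)]] r(2)[of m] by simp
  have \<mu>c: "carried R1 (\<mu> s)" if "s \<in> {1..S}" for s
    unfolding R1_def using carried_mono[OF \<mu>(1)[OF that]] by simp
  have \<nu>n: "narrow_conv (\<lambda>m. \<nu> m s) (\<mu> s)" if "s \<in> {1..S}" for s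
    unfolding \<nu>_def by (rule smooth_narrow[OF \<mu>(1)[OF that] r(1) r0])
  have \<nu>mass: "(\<Sum>s=1..S. measure (\<nu> m s) UNIV) = 1" for m
    unfolding \<nu>_def \<mu>(2)[symmetric] by (intro sum.cong refl smooth_mass[OF \<mu>(1) r(1)])
  define c where "c m = (\<Sum>s=1..S. measure (\<mu> s) UNIV / measure lborel (ball (0::plane) (r m)))" for m
  have \<nu>d: "dominated (c m) (\<nu> m s)" if "s \<in> {1..S}" for m s
    unfolding \<nu>_def c_def by (rule smooth_dominated_family[OF \<mu>(1) r(1) that])

  define a where "a m i = interaction S (V\<delta> (\<delta> i)) (\<nu> m)" for m i
  define L where "L m = interaction S V (\<nu> m)" for m
  have a_lim: "(\<lambda>i. a m i) \<longlonglongrightarrow> L m" for m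
    unfolding a_def L_def by (rule regularised_interaction_tendsto[OF A B \<delta> R1 \<nu>c \<nu>d])

  have sq: "filterlim (\<lambda>i. sqrt (real (Suc i))) at_top sequentially"
    by (intro filterlim_compose[OF sqrt_at_top] filterlim_compose[OF filterlim_real_sequentially] filterlim_Suc)
  \<comment> \<open>the second condition keeps the mean energies small compared with the penalty weight \<open>sqrt (Suc i)\<close>\<close>
  define P where "P m i \<longleftrightarrow> \<bar>a m i - L m\<bar> < r m \<and> \<bar>a m i\<bar> / sqrt (real (Suc i)) < r m" for m i
  have "eventually (P m) sequentially" for m
  proof -
    have "(\<lambda>i. \<bar>a m i\<bar> / sqrt (real (Suc i))) \<longlonglongrightarrow> 0"
      by (rule real_tendsto_divide_at_top[OF tendsto_rabs[OF a_lim] sq])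
    then have "\<forall>\<^sub>F i in sequentially. \<bar>a m i\<bar> / sqrt (real (Suc i)) < r m"
      by (rule order_tendstoD) (rule r)
    moreover have "\<forall>\<^sub>F i in sequentially. dist (a m i) (L m) < r m"
      by (rule tendstoD[OF a_lim r(1)])
    ultimately show ?thesis
      by eventually_elim (simp add: P_def dist_real_def)
  qed
  then obtain g where g: "filterlim g at_top sequentially" "eventually (\<lambda>i. P (g i) i) sequentially"
    by (rule diagonal_index)

  obtain q where fam: "bounded_dense_family R1 q" using bounded_dense_family_exists[OF R1] by (elim exE)
  have q: "continuous_on UNIV (q j)" "\<bar>q j x\<bar> \<le> 1" for j x
    using fam by (simp_all add: bounded_dense_family_def)
  define \<kappa> where "\<kappa> i = sqrt (real (Suc i))" for i
  have \<kappa>: "\<kappa> i > 0" "\<kappa> i / real (Suc i) = 1 / \<kappa> i" for i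
  proof -
    show pos: "\<kappa> i > 0" by (simp add: \<kappa>_def)
    have "real (Suc i) = \<kappa> i * \<kappa> i" by (simp add: \<kappa>_def)
    then show "\<kappa> i / real (Suc i) = 1 / \<kappa> i" using pos by simp
  qed
  define G where "G i = (\<Sum>s=1..S. \<bar>V\<delta> (\<delta> i) s s 0\<bar>) / real (Suc i)" for i
  define close_sample where "close_sample i zs \<longleftrightarrow> length zs = Suc i \<and> set zs \<subseteq> {1..S} \<times> cball 0 R1 \<and>
    interaction S (V\<delta> (\<delta> i)) (empirical zs)
      + \<kappa> i * (\<Sum>s=1..S. \<Sum>j<Suc i. (1/2) ^ j * ((LINT x|empirical zs s. q j x) - (LINT x|\<nu> (g i) s. q j x))\<^sup>2)
     \<le> (1 - 1 / real (Suc i)) * a (g i) i + G i + 8 * real S / \<kappa> i" for i zs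
  have "\<exists>zs. close_sample i zs" for i
  proof -
    have "8 * real S * \<kappa> i / real (Suc i) = 8 * real S * (\<kappa> i / real (Suc i))" by simp
    also have "\<dots> = 8 * real S / \<kappa> i" unfolding \<kappa>(2) by simp
    finally have e: "8 * real S * \<kappa> i / real (Suc i) = 8 * real S / \<kappa> i" .
    show ?thesis unfolding close_sample_def a_def G_def e[symmetric]
    proof (rule sampling)
      show "carried R1 (\<nu> (g i) s)" if "s \<in> {1..S}" for s by (rule \<nu>c[OF that])
      show "(\<Sum>s=1..S. measure (\<nu> (g i) s) UNIV) = 1" by (rule \<nu>mass)
      show "continuous_on UNIV (V\<delta> (\<delta> i) s t)" if "s \<in> {1..S}" "t \<in> {1..S}" for s t by (rule B1(2)[OF that])
      show "continuous_on UNIV (q j)" "\<bar>q j x\<bar> \<le> 1" for j x by (rule q)+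
      show "1 \<le> Suc i" by simp
      show "0 \<le> \<kappa> i" using \<kappa>(1)[of i] by simp
    qed
  qed
  then have "\<exists>zs. \<forall>i. close_sample i (zs i)" by (intro choice allI)
  then obtain zs where zs': "\<forall>i. close_sample i (zs i)" by (elim exE)
  have zs: "length (zs i) = Suc i" "set (zs i) \<subseteq> {1..S} \<times> cball 0 R1" for i
    using spec[OF zs', of i] by (simp_all only: close_sample_def)
  define I where "I i = interaction S (V\<delta> (\<delta> i)) (empirical (zs i))" for i
  define D where "D i = (\<Sum>s=1..S. \<Sum>j<Suc i. (1/2) ^ j * ((LINT x|empirical (zs i) s. q j x) - (LINT x|\<nu> (g i) s. q j x))\<^sup>2)" for i
  note ec = empirical_carried[OF zs(2)]
  have main: "I i + \<kappa> i * D i \<le> (1 - 1 / real (Suc i)) * a (g i) i + G i + 8 * real S / \<kappa> i" for i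
    using spec[OF zs', of i] unfolding close_sample_def I_def D_def by (elim conjE)
  have D0: "D i \<ge> 0" for i unfolding D_def by (intro sum_nonneg mult_nonneg_nonneg) auto
  have EI: "energy S K (Vreg\<delta> (\<delta> i)) (W\<delta> (\<delta> i)) (empirical (zs i)) \<le> ereal (I i)" for i
    unfolding I_def by (rule energy_le_interaction[OF ec(1) B1(2) B1(1) B1(3) BW])
  have G0: "G \<longlonglongrightarrow> 0"
  proof -
    have "(\<lambda>i. \<Sum>s=1..S. \<bar>V\<delta> (\<delta> i) s s 0\<bar> / real (Suc i)) \<longlonglongrightarrow> (\<Sum>s=1..S. 0)"
      by (intro tendsto_sum \<gamma>)
    then show ?thesis by (simp add: G_def[abs_def] sum_divide_distrib)
  qed
  have \<kappa>0: "(\<lambda>i. C / \<kappa> i) \<longlonglongrightarrow> 0" for C :: real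
    unfolding \<kappa>_def by (rule real_tendsto_divide_at_top[OF tendsto_const sq])
  have rg: "(\<lambda>i. r (g i)) \<longlonglongrightarrow> 0" by (rule filterlim_compose[OF r0 g(1)])

  \<comment> \<open>interactions dominate energies, and these are bounded below by their regular part\<close>
  have "\<exists>C. \<forall>\<^sub>F i in sequentially. - C \<le> I i"
  proof -
    have "\<exists>b\<ge>0. \<forall>\<^sub>F i in sequentially. \<forall>z\<in>cball 0 (2 * R1). \<bar>Vreg\<delta> (\<delta> i) s t z\<bar> \<le> b"
      if st: "s \<in> {1..S}" "t \<in> {1..S}" for s t
    proof -
      obtain b where b: "b \<ge> 0" "\<And>z. z \<in> cball 0 (2 * R1) \<Longrightarrow> \<bar>Vreg s t z\<bar> \<le> b"
        using continuous_bounded_on_cball[OF continuous_on_subset[OF A'(2)[OF st]], of "2 * R1"] by auto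
      have "\<forall>\<^sub>F i in sequentially. \<forall>z\<in>cball 0 (2 * R1). dist (Vreg\<delta> (\<delta> i) s t z) (Vreg s t z) < 1"
        using B3[OF st compact_cball[of 0 "2 * R1"]] unfolding uniform_limit_iff by (elim allE[of _ 1]) simp
      then have "\<forall>\<^sub>F i in sequentially. \<forall>z\<in>cball 0 (2 * R1). \<bar>Vreg\<delta> (\<delta> i) s t z\<bar> \<le> b + 1"
      proof eventually_elim
        case (elim i)
        show ?case
        proof
          fix z :: plane assume z: "z \<in> cball 0 (2 * R1)"
          have "\<bar>Vreg\<delta> (\<delta> i) s t z - Vreg s t z\<bar> < 1" using elim z unfolding dist_real_def by blast
          then show "\<bar>Vreg\<delta> (\<delta> i) s t z\<bar> \<le> b + 1" using b(2)[OF z] by linarith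
        qed
      qed
      then show ?thesis using b(1) by (intro exI[of _ "b + 1"]) auto
    qed
    note ex = this
    define b where "b s t = (SOME b. b \<ge> 0 \<and> (\<forall>\<^sub>F i in sequentially. \<forall>z\<in>cball 0 (2 * R1). \<bar>Vreg\<delta> (\<delta> i) s t z\<bar> \<le> b))" for s t
    have b: "b s t \<ge> 0" "\<forall>\<^sub>F i in sequentially. \<forall>z\<in>cball 0 (2 * R1). \<bar>Vreg\<delta> (\<delta> i) s t z\<bar> \<le> b s t"
      if st: "s \<in> {1..S}" "t \<in> {1..S}" for s t
      using someI_ex[OF ex[OF st]] unfolding b_def by (rule conjunct1, rule conjunct2)
    have "\<forall>\<^sub>F i in sequentially. \<forall>s\<in>{1..S}. \<forall>t\<in>{1..S}. \<forall>z\<in>cball 0 (2 * R1). \<bar>Vreg\<delta> (\<delta> i) s t z\<bar> \<le> b s t"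
      by (intro eventually_ball_finite finite_atLeastAtMost ballI b(2))
    then have "\<forall>\<^sub>F i in sequentially. - (\<Sum>s=1..S. \<Sum>t=1..S. b s t) \<le> I i"
    proof eventually_elim
      case (elim i)
      have "- (\<Sum>s=1..S. \<Sum>t=1..S. b s t) \<le> interaction S (Vreg\<delta> (\<delta> i)) (empirical (zs i))"
        by (rule interaction_lower_bound[OF ec _ _ b(1)])
           (use elim borel_measurable_continuous_onI[OF B1(3)] in blast)+
      also have "\<dots> \<le> I i"
      proof -
        have "ereal (interaction S (Vreg\<delta> (\<delta> i)) (empirical (zs i))) \<le> energy S K (Vreg\<delta> (\<delta> i)) (W\<delta> (\<delta> i)) (empirical (zs i))"
          unfolding energy_alt by (intro ereal_le_add_self sum_nonneg L2_norm_sq_nonneg)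
        from order_trans[OF this EI] show ?thesis by simp
      qed
      finally show ?case .
    qed
    then show ?thesis by blast
  qed
  then obtain C where C: "\<forall>\<^sub>F i in sequentially. - C \<le> I i" by (elim exE)
  have D_lim: "D \<longlonglongrightarrow> 0"
  proof (rule tendsto_sandwich[OF _ _ tendsto_const])
    show "\<forall>\<^sub>F i in sequentially. 0 \<le> D i" using D0 by simp
    show "\<forall>\<^sub>F i in sequentially. D i \<le> r (g i) + (C + G i + 8 * real S / \<kappa> i) / \<kappa> i"
      using C g(2)
    proof eventually_elim
      case (elim i)
      have "(1 - 1 / real (Suc i)) * a (g i) i \<le> (1 - 1 / real (Suc i)) * \<bar>a (g i) i\<bar>"
        by (intro mult_left_mono) auto
      also have "\<dots> \<le> 1 * \<bar>a (g i) i\<bar>" by (intro mult_right_mono) auto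
      finally have "\<kappa> i * D i \<le> \<bar>a (g i) i\<bar> + (C + G i + 8 * real S / \<kappa> i)"
        using main[of i] elim(1) by linarith
      then have "D i \<le> (\<bar>a (g i) i\<bar> + (C + G i + 8 * real S / \<kappa> i)) / \<kappa> i"
        using \<kappa>(1)[of i] by (simp add: pos_le_divide_eq mult.commute)
      also have "\<dots> = \<bar>a (g i) i\<bar> / \<kappa> i + (C + G i + 8 * real S / \<kappa> i) / \<kappa> i" by (simp add: add_divide_distrib)
      finally show ?case using elim(2) unfolding P_def \<kappa>_def by linarith
    qed
    have "(\<lambda>i. r (g i) + (C + G i + 8 * real S / \<kappa> i) * (1 / \<kappa> i)) \<longlonglongrightarrow> 0 + (C + 0 + 0) * 0"
      by (intro tendsto_intros rg G0 \<kappa>0)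
    then show "(\<lambda>i. r (g i) + (C + G i + 8 * real S / \<kappa> i) / \<kappa> i) \<longlonglongrightarrow> 0" by simp
  qed

  have nar: "narrow_conv (\<lambda>i. empirical (zs i) s) (\<mu> s)" if s: "s \<in> {1..S}" for s
  proof (rule narrow_conv_dense_family[OF ec(1) \<mu>c[OF s] ec(2) _ fam])
    have "measure (\<mu> s) UNIV \<le> (\<Sum>s=1..S. measure (\<mu> s) UNIV)" by (rule member_le_sum[OF s]) auto
    then show "measure (\<mu> s) UNIV \<le> 1" using \<mu>(2) by simp
    fix j
    define d where "d i = (LINT x|empirical (zs i) s. q j x) - (LINT x|\<nu> (g i) s. q j x)" for i
    have "(\<lambda>i. (d i)\<^sup>2) \<longlonglongrightarrow> 0"
    proof (rule tendsto_sandwich[OF _ _ tendsto_const])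
      show "\<forall>\<^sub>F i in sequentially. 0 \<le> (d i)\<^sup>2" by simp
      show "\<forall>\<^sub>F i in sequentially. (d i)\<^sup>2 \<le> 2 ^ j * D i"
        using eventually_ge_at_top[of j]
      proof eventually_elim
        case (elim i)
        have "(1/2) ^ j * (d i)\<^sup>2 \<le> (\<Sum>j<Suc i. (1/2) ^ j * ((LINT x|empirical (zs i) s. q j x) - (LINT x|\<nu> (g i) s. q j x))\<^sup>2)"
          unfolding d_def
          by (rule member_le_sum[of j "{..<Suc i}" "\<lambda>j. (1/2) ^ j * ((LINT x|empirical (zs i) s. q j x) - (LINT x|\<nu> (g i) s. q j x))\<^sup>2"])
             (use elim in auto)
        also have "\<dots> \<le> D i" unfolding D_def
          by (rule member_le_sum[OF s]) (auto intro!: sum_nonneg simp del: sum.lessThan_Suc)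
        finally show ?case by (simp add: power_one_over field_simps)
      qed
      show "(\<lambda>i. 2 ^ j * D i) \<longlonglongrightarrow> 0" using tendsto_mult_right_zero[OF D_lim] .
    qed
    from tendsto_real_sqrt[OF this] have "d \<longlonglongrightarrow> 0" by (simp add: tendsto_rabs_zero_iff)
    moreover have "(\<lambda>i. LINT x|\<nu> (g i) s. q j x) \<longlonglongrightarrow> (LINT x|\<mu> s. q j x)"
    proof -
      have "bounded (range (q j))" unfolding bounded_iff using q(2)[of j] by auto
      then have "(\<lambda>m. LINT x|\<nu> m s. q j x) \<longlonglongrightarrow> (LINT x|\<mu> s. q j x)"
        using \<nu>n[OF s] q(1) unfolding narrow_conv_def by blast
      from filterlim_compose[OF this g(1)] show ?thesis .
    qed
    ultimately have "(\<lambda>i. d i + (LINT x|\<nu> (g i) s. q j x)) \<longlonglongrightarrow> 0 + (LINT x|\<mu> s. q j x)"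
      by (rule tendsto_add)
    then show "(\<lambda>i. LINT x|empirical (zs i) s. q j x) \<longlonglongrightarrow> (LINT x|\<mu> s. q j x)" by (simp add: d_def)
  qed

  have "limsup (\<lambda>i. energy S K (Vreg\<delta> (\<delta> i)) (W\<delta> (\<delta> i)) (empirical (zs i))) \<le> energy S K Vreg W \<mu>"
  proof (cases "energy S K Vreg W \<mu> = \<infinity>")
    case False
    obtain b e where e: "energy S K Vreg W \<mu> = ereal e" and b: "b \<longlonglongrightarrow> e"
      and "\<forall>m. interaction S V (\<lambda>s. smooth (r m) (\<mu> s)) \<le> b m"
      using interaction_smooth_bound[OF A \<mu>(1) False r r0] by blast
    then have Lb: "L m \<le> b m" for m unfolding L_def \<nu>_def by blast
    have bg: "(\<lambda>i. b (g i)) \<longlonglongrightarrow> e" by (rule filterlim_compose[OF b g(1)])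
    define C' where "C' i = (1 - 1 / real (Suc i)) * (b (g i) + r (g i)) + G i + 8 * real S / \<kappa> i" for i
    have "C' \<longlonglongrightarrow> (1 - 0) * (e + 0) + 0 + 0"
      unfolding C'_def by (intro tendsto_intros bg rg G0 \<kappa>0 LIMSEQ_Suc[OF lim_1_over_n])
    then have C'l: "limsup (\<lambda>i. ereal (C' i)) = ereal e"
      by (intro lim_imp_Limsup trivial_limit_sequentially) simp
    have "\<forall>\<^sub>F i in sequentially. energy S K (Vreg\<delta> (\<delta> i)) (W\<delta> (\<delta> i)) (empirical (zs i)) \<le> ereal (C' i)"
      using g(2)
    proof eventually_elim
      case (elim i)
      have "a (g i) i \<le> b (g i) + r (g i)" using elim Lb[of "g i"] unfolding P_def by linarith
      then have "(1 - 1 / real (Suc i)) * a (g i) i \<le> (1 - 1 / real (Suc i)) * (b (g i) + r (g i))"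
        by (intro mult_left_mono) auto
      moreover have "0 \<le> \<kappa> i * D i" using \<kappa>(1)[of i] D0[of i] by simp
      ultimately have "I i \<le> C' i" using main[of i] unfolding C'_def by linarith
      then show ?case by (intro order_trans[OF EI[of i]]) (simp only: ereal_less_eq(3))
    qed
    then have "limsup (\<lambda>i. energy S K (Vreg\<delta> (\<delta> i)) (W\<delta> (\<delta> i)) (empirical (zs i))) \<le> limsup (\<lambda>i. ereal (C' i))"
      by (rule Limsup_mono)
    then show ?thesis unfolding C'l e by simp
  qed simp
  moreover have "\<forall>i. length (zs i) = Suc i \<and> set (zs i) \<subseteq> {1..S} \<times> cball 0 (R + 1)"
    using zs(1,2) unfolding R1_def by simp
  moreover have "\<forall>s\<in>{1..S}. narrow_conv (\<lambda>i. empirical (zs i) s) (\<mu> s)"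
    by (intro ballI nar)
  ultimately show ?thesis by (intro exI[of _ zs] conjI)
qed

theorem theorem2p3:
  fixes S K :: nat
    and V Vreg W :: "nat \<Rightarrow> nat \<Rightarrow> plane \<Rightarrow> real"
    and V\<delta> Vreg\<delta> W\<delta> :: "real \<Rightarrow> nat \<Rightarrow> nat \<Rightarrow> plane \<Rightarrow> real"
    and \<delta> :: "nat \<Rightarrow> real"
  assumes "S \<ge> 1"
    and "assumption_A S K V Vreg W"
    and "assumption_B S K V Vreg W V\<delta> Vreg\<delta> W\<delta>"
    and "\<forall>n\<ge>1. \<delta> n > 0"
    and "\<delta> \<longlonglongrightarrow> 0"
    and "\<forall>N :: nat \<Rightarrow> nat \<Rightarrow> nat. (\<forall>n\<ge>1. (\<Sum>s=1..S. N n s) = n) \<longrightarrow>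
           (\<lambda>n. 1 / (real n)\<^sup>2 * (\<Sum>s=1..S. real (N n s) * \<bar>V\<delta> (\<delta> n) s s 0\<bar>)) \<longlonglongrightarrow> 0"
  shows "(\<forall>\<mu>\<in>D_E S. \<forall>\<mu>n :: nat \<Rightarrow> nat \<Rightarrow> plane measure.
            (\<forall>n\<ge>1. \<mu>n n \<in> D_En S n) \<and> mod_narrow_conv S \<mu>n \<mu> \<longrightarrow>
            liminf (\<lambda>n. energy S K (Vreg\<delta> (\<delta> n)) (W\<delta> (\<delta> n)) (\<mu>n n)) \<ge> energy S K Vreg W \<mu>) \<and>
         (\<forall>\<mu>\<in>D_E S. \<exists>\<mu>n :: nat \<Rightarrow> nat \<Rightarrow> plane measure.
            (\<forall>n\<ge>1. \<mu>n n \<in> D_En S n) \<and> mod_narrow_conv S \<mu>n \<mu> \<and>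
            limsup (\<lambda>n. energy S K (Vreg\<delta> (\<delta> n)) (W\<delta> (\<delta> n)) (\<mu>n n)) \<le> energy S K Vreg W \<mu>)"
proof (intro conjI ballI)
  note A = assms(2) and B = assms(3)
  \<comment> \<open>the value \<open>\<delta> 0\<close> is unconstrained, so all sequences are shifted by one\<close>
  define \<delta>' where "\<delta>' i = \<delta> (Suc i)" for i
  have \<delta>': "\<delta>' i > 0" for i using assms(4) by (simp add: \<delta>'_def)
  have \<delta>'0: "\<delta>' \<longlonglongrightarrow> 0" unfolding \<delta>'_def by (rule LIMSEQ_Suc[OF assms(5)])
  have \<delta>lim: "filterlim \<delta>' (at_right 0) sequentially"
    using \<delta>' \<delta>'0 less_imp_neq[OF \<delta>'] by (simp add: filterlim_at)
  fix \<mu> assume \<mu>: "\<mu> \<in> D_E S"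
  then have \<mu>f: "\<And>s. s \<in> {1..S} \<Longrightarrow> \<mu> s \<in> finite_borel_measures" and \<mu>1: "(\<Sum>s=1..S. measure (\<mu> s) UNIV) = 1"
    and \<mu>b: "bounded (\<Union>s\<in>{1..S}. msupp (\<mu> s))"
    by (auto simp: D_E_def prob_tuples_def)
  have "\<exists>R>0. \<forall>s\<in>{1..S}. carried R (\<mu> s)" by (rule bounded_msupp_carried[OF \<mu>b \<mu>f])
  then obtain R0 where R0': "R0 > 0" "\<forall>s\<in>{1..S}. carried R0 (\<mu> s)" by (elim exE conjE)
  note R0 = R0'(1) bspec[OF R0'(2)]
  show "\<forall>\<mu>n :: nat \<Rightarrow> nat \<Rightarrow> plane measure.
            (\<forall>n\<ge>1. \<mu>n n \<in> D_En S n) \<and> mod_narrow_conv S \<mu>n \<mu> \<longrightarrow>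
            liminf (\<lambda>n. energy S K (Vreg\<delta> (\<delta> n)) (W\<delta> (\<delta> n)) (\<mu>n n)) \<ge> energy S K Vreg W \<mu>"
  proof (intro allI impI, elim conjE)
    fix \<mu>n :: "nat \<Rightarrow> nat \<Rightarrow> plane measure"
    assume n: "\<forall>n\<ge>1. \<mu>n n \<in> D_En S n" and nc: "mod_narrow_conv S \<mu>n \<mu>"
    have "bounded (\<Union>n\<in>{1..}. \<Union>s\<in>{1..S}. msupp (\<mu>n n s))" using nc by (simp add: mod_narrow_conv_def)
    then have "\<exists>a>0. \<forall>x\<in>\<Union>n\<in>{1..}. \<Union>s\<in>{1..S}. msupp (\<mu>n n s). norm x \<le> a" by (simp only: bounded_pos)
    then obtain a where a: "a > 0" "\<forall>x\<in>\<Union>n\<in>{1..}. \<Union>s\<in>{1..S}. msupp (\<mu>n n s). norm x \<le> a" by blast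
    define R where "R = max R0 a"
    have \<nu>c: "carried R (\<mu>n (Suc i) s)" if s: "s \<in> {1..S}" for i s
    proof (rule msupp_subset_carried)
      show "\<mu>n (Suc i) s \<in> finite_borel_measures"
        by (rule D_En_finite_borel[OF _ s, of _ "Suc i"]) (use n in simp)
      show "msupp (\<mu>n (Suc i) s) \<subseteq> cball 0 R"
      proof
        fix x assume "x \<in> msupp (\<mu>n (Suc i) s)"
        then have "x \<in> (\<Union>n\<in>{1..}. \<Union>s\<in>{1..S}. msupp (\<mu>n n s))" using s by (intro UN_I[of "Suc i"] UN_I[of s]) auto
        then have "norm x \<le> a" using a(2) by blast
        then show "x \<in> cball 0 R" by (simp add: R_def)
      qed
    qed
    have "energy S K Vreg W \<mu> \<le> liminf (\<lambda>i. energy S K (Vreg\<delta> (\<delta>' i)) (W\<delta> (\<delta>' i)) (\<mu>n (Suc i)))"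
    proof (rule energy_liminf[where R = R])
      show "carried R (\<mu>n (Suc i) s)" if "s \<in> {1..S}" for i s by (rule \<nu>c[OF that])
      show "carried R (\<mu> s)" if "s \<in> {1..S}" for s
        by (rule carried_mono[OF R0(2)[OF that]]) (simp add: R_def)
      show "narrow_conv (\<lambda>i. \<mu>n (Suc i) s) (\<mu> s)" if "s \<in> {1..S}" for s
      proof -
        have "narrow_conv (\<lambda>n. \<mu>n n s) (\<mu> s)" using nc that by (simp add: mod_narrow_conv_def)
        then show ?thesis by (simp only: narrow_conv_Suc_iff[of "\<lambda>n. \<mu>n n s"])
      qed
      show "continuous_on UNIV (Vreg s t)" if "s \<in> {1..S}" "t \<in> {1..S}" for s t
        by (rule assumption_AD(2)[OF A that])
      show "Vreg\<delta> (\<delta>' i) s t \<in> borel_measurable borel" if "s \<in> {1..S}" "t \<in> {1..S}" for i s t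
        by (rule borel_measurable_continuous_onI[OF assumption_BD(3)[OF B \<delta>' that]])
      show "uniform_limit (cball 0 (2 * R)) (\<lambda>i. Vreg\<delta> (\<delta>' i) s t) (Vreg s t) sequentially"
        if "s \<in> {1..S}" "t \<in> {1..S}" for s t
        by (rule filterlim_compose[OF assumption_B_Vreg[OF B that compact_cball] \<delta>lim])
      show "integrable lborel (W\<delta> (\<delta>' i) k s)" if "k \<in> {1..K}" "s \<in> {1..S}" for i k s
        by (rule assumption_B_integrable[OF B \<delta>' that])
      show "integrable lborel (W k s)" if "k \<in> {1..K}" "s \<in> {1..S}" for k s
        by (rule assumption_A_integrable[OF A that])
      show "uniform_limit (cball 0 R) (\<lambda>i. conv (W\<delta> (\<delta>' i) k s) \<phi>) (conv (W k s) \<phi>) sequentially"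
        if "k \<in> {1..K}" "s \<in> {1..S}" "test_function \<phi>" for k s \<phi>
        by (rule filterlim_compose[OF assumption_B_conv[OF B that compact_cball] \<delta>lim])
    qed
    also have "\<dots> = liminf (\<lambda>n. energy S K (Vreg\<delta> (\<delta> n)) (W\<delta> (\<delta> n)) (\<mu>n n))"
      using liminf_shift[of "\<lambda>n. energy S K (Vreg\<delta> (\<delta> n)) (W\<delta> (\<delta> n)) (\<mu>n n)"] by (simp add: \<delta>'_def)
    finally show "energy S K Vreg W \<mu> \<le> liminf (\<lambda>n. energy S K (Vreg\<delta> (\<delta> n)) (W\<delta> (\<delta> n)) (\<mu>n n))" .
  qed
  have \<gamma>: "(\<lambda>i. \<bar>V\<delta> (\<delta>' i) s s 0\<bar> / real (Suc i)) \<longlonglongrightarrow> 0" if s: "s \<in> {1..S}" for s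
  proof -
    \<comment> \<open>all particles of the same species\<close>
    define N where "N n t = (if t = s then n else 0)" for n t :: nat
    have "\<forall>n\<ge>1. (\<Sum>t=1..S. N n t) = n" using s by (simp add: N_def)
    then have "(\<lambda>n. 1 / (real n)\<^sup>2 * (\<Sum>t=1..S. real (N n t) * \<bar>V\<delta> (\<delta> n) t t 0\<bar>)) \<longlonglongrightarrow> 0"
      using assms(6) by blast
    moreover have "(\<Sum>t=1..S. real (N n t) * \<bar>V\<delta> (\<delta> n) t t 0\<bar>) = real n * \<bar>V\<delta> (\<delta> n) s s 0\<bar>" for n
    proof -
      have "(\<Sum>t=1..S. real (N n t) * \<bar>V\<delta> (\<delta> n) t t 0\<bar>) = (\<Sum>t=1..S. if t = s then real n * \<bar>V\<delta> (\<delta> n) t t 0\<bar> else 0)"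
        by (intro sum.cong) (auto simp: N_def)
      then show ?thesis using s by simp
    qed
    ultimately have "(\<lambda>n. 1 / (real n)\<^sup>2 * (real n * \<bar>V\<delta> (\<delta> n) s s 0\<bar>)) \<longlonglongrightarrow> 0" by simp
    from LIMSEQ_Suc[OF this] show ?thesis
      by (simp add: \<delta>'_def power2_eq_square del: of_nat_Suc)
  qed
  have recov: "\<exists>zs :: nat \<Rightarrow> (nat \<times> plane) list. (\<forall>i. length (zs i) = Suc i \<and> set (zs i) \<subseteq> {1..S} \<times> cball 0 (R0 + 1)) \<and>
    (\<forall>s\<in>{1..S}. narrow_conv (\<lambda>i. empirical (zs i) s) (\<mu> s)) \<and>
    limsup (\<lambda>i. energy S K (Vreg\<delta> (\<delta>' i)) (W\<delta> (\<delta>' i)) (empirical (zs i))) \<le> energy S K Vreg W \<mu>"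
    by (rule recovery_sequence[OF A B \<delta>' \<delta>'0 \<gamma> R0(2) \<mu>1 R0(1)])
  obtain zs :: "nat \<Rightarrow> (nat \<times> plane) list" where
    zs12: "\<forall>i. length (zs i) = Suc i \<and> set (zs i) \<subseteq> {1..S} \<times> cball 0 (R0 + 1)"
    and zs3: "\<forall>s\<in>{1..S}. narrow_conv (\<lambda>i. empirical (zs i) s) (\<mu> s)"
    and zs4: "limsup (\<lambda>i. energy S K (Vreg\<delta> (\<delta>' i)) (W\<delta> (\<delta>' i)) (empirical (zs i))) \<le> energy S K Vreg W \<mu>"
    using recov by (elim exE conjE)
  note zs = conjunct1[OF spec[OF zs12]] conjunct2[OF spec[OF zs12]] bspec[OF zs3] zs4
  define \<mu>n where "\<mu>n n = empirical (zs (n - 1))" for n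
  have \<mu>nS: "\<mu>n (Suc i) = empirical (zs i)" for i by (simp add: \<mu>n_def)
  show "\<exists>\<mu>n :: nat \<Rightarrow> nat \<Rightarrow> plane measure.
            (\<forall>n\<ge>1. \<mu>n n \<in> D_En S n) \<and> mod_narrow_conv S \<mu>n \<mu> \<and>
            limsup (\<lambda>n. energy S K (Vreg\<delta> (\<delta> n)) (W\<delta> (\<delta> n)) (\<mu>n n)) \<le> energy S K Vreg W \<mu>"
  proof (intro exI[of _ \<mu>n] conjI allI impI)
    fix n :: nat assume "1 \<le> n"
    then show "\<mu>n n \<in> D_En S n"
      using empirical_in_D_En[OF zs(2)[of "n - 1"]] zs(1)[of "n - 1"] by (simp add: \<mu>n_def)
  next
    show "mod_narrow_conv S \<mu>n \<mu>"
      unfolding mod_narrow_conv_def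
    proof (intro conjI ballI)
      fix s assume "s \<in> {1..S}"
      then have "narrow_conv (\<lambda>i. \<mu>n (Suc i) s) (\<mu> s)" using zs(3) by (simp add: \<mu>nS)
      then show "narrow_conv (\<lambda>n. \<mu>n n s) (\<mu> s)" by (simp only: narrow_conv_Suc_iff[of "\<lambda>n. \<mu>n n s"])
    next
      have "(\<Union>n\<in>{1..}. \<Union>s\<in>{1..S}. msupp (\<mu>n n s)) \<subseteq> cball 0 (R0 + 1)"
        unfolding \<mu>n_def by (intro UN_least carried_msupp_subset empirical_carried(1)[OF zs(2)])
      then show "bounded (\<Union>n\<in>{1..}. \<Union>s\<in>{1..S}. msupp (\<mu>n n s))"
        using bounded_subset[OF bounded_cball] by blast
    qed
  next
    have "limsup (\<lambda>n. energy S K (Vreg\<delta> (\<delta> n)) (W\<delta> (\<delta> n)) (\<mu>n n))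
        = limsup (\<lambda>i. energy S K (Vreg\<delta> (\<delta>' i)) (W\<delta> (\<delta>' i)) (empirical (zs i)))"
      using limsup_shift[of "\<lambda>n. energy S K (Vreg\<delta> (\<delta> n)) (W\<delta> (\<delta> n)) (\<mu>n n)"] by (simp add: \<delta>'_def \<mu>nS)
    then show "limsup (\<lambda>n. energy S K (Vreg\<delta> (\<delta> n)) (W\<delta> (\<delta> n)) (\<mu>n n)) \<le> energy S K Vreg W \<mu>"
      using zs(4) by simp
  qed
qed

end
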